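(* Let $\mathbf{W}=\{\mathbf{W}(t):t\ge 0\}$ be standard planar Brownian motion started at the origin, and for $t\ge 0$ let $\mathsf{D}(t)$ be the diameter of $\mathrm{H}(t)=\operatorname{conv}\{\mathbf{W}(s):s\in[0,t]\}$. Let $\Theta^{\mathsf{D}}=\inf\{t\ge 0:\mathsf{D}(t)>1\}$. Then $$0.1803\approx\frac{1}{8\log 2}\le \mathbb{E}\left[\Theta^{\mathsf{D}}\right]\le \mathfrak{r}\approx 0.3466,$$ where $\mathfrak{r}=\mathbb{E}\left[\min\{\Theta^{R_1},\Theta^{R_2}\}\right]$ and $\Theta^{R_i}$ is the first time the range of the $i$-th coordinate of $\mathbf{W}$ exceeds $1$.
   Context: Standard planar Brownian motion is $\mathbf{W}(t)=(W_1(t),W_2(t))$ with $W_1,W_2$ independent one-dimensional standard Brownian motions started at $0$. $\operatorname{conv}A$ is the convex hull of $A\subset\mathbb{R}^2$. The diameter of a set is the supremum of Euclidean distances between its points. For $i=1,2$, $R_i(t)=\sup_{0\le s\le t}W_i(s)-\inf_{0\le s\le t}W_i(s)$ and $\Theta^{R_i}=\inf\{t\ge 0:R_i(t)>1\}$. The constant $\mathfrak{r}$ satisfies $$\mathfrak{r}=\frac12-\frac{2}{\pi}\int_0^\infty\left(1-\frac{4}{(\cos t+\cosh t)^2}\right)\frac{1}{t^3}\,dt\approx 0.346554.$$ $\log$ is the natural logarithm; the symbol $\approx$ only indicates a numerical approximation of the exact expression. *)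

theory Defs
  imports "HOL-Analysis.Analysis" "HOL-Probability.Probability"
begin

text \<open>Processes are functions \<^term>\<open>X :: real \<Rightarrow> 'a \<Rightarrow> 'b\<close> of time and outcome; only the times
  \<open>t \<ge> 0\<close> matter. The normal density of the library is parametrised by the standard deviation.
  The starting point and the continuity of the paths are only required almost surely.\<close>

definition standard_brownian_motion :: "'a measure \<Rightarrow> (real \<Rightarrow> 'a \<Rightarrow> real) \<Rightarrow> bool" where
  "standard_brownian_motion M B \<longleftrightarrow>
     prob_space M \<and>
     (\<forall>t\<ge>0. B t \<in> borel_measurable M) \<and>
     (AE \<omega> in M. B 0 \<omega> = 0) \<and>
     (\<forall>n (\<tau> :: nat \<Rightarrow> real). 0 \<le> \<tau> 0 \<and> (\<forall>i<n. \<tau> i \<le> \<tau> (Suc i)) \<longrightarrow>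
        prob_space.indep_vars M (\<lambda>_. borel) (\<lambda>i \<omega>. B (\<tau> (Suc i)) \<omega> - B (\<tau> i) \<omega>) {..<n}) \<and>
     (\<forall>s t. 0 \<le> s \<and> s < t \<longrightarrow>
        distributed M lborel (\<lambda>\<omega>. B t \<omega> - B s \<omega>) (normal_density 0 (sqrt (t - s)))) \<and>
     (AE \<omega> in M. continuous_on {0..} (\<lambda>t. B t \<omega>))"

text \<open>Independence of the two coordinates is independence as processes, that is, as random
  elements of the product space \<open>\<real>\<^bsup>[0,\<infinity>)\<^esup>\<close> with its product sigma-algebra.\<close>

definition standard_planar_brownian_motion ::
    "'a measure \<Rightarrow> (real \<Rightarrow> 'a \<Rightarrow> real ^ 2) \<Rightarrow> bool" where
  "standard_planar_brownian_motion M W \<longleftrightarrow>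
     (\<forall>i. standard_brownian_motion M (\<lambda>t \<omega>. W t \<omega> $ i)) \<and>
     prob_space.indep_var M
       (PiM {0..} (\<lambda>_. borel)) (\<lambda>\<omega>. \<lambda>t\<in>{0..}. W t \<omega> $ 1)
       (PiM {0..} (\<lambda>_. borel)) (\<lambda>\<omega>. \<lambda>t\<in>{0..}. W t \<omega> $ 2)"

definition hull_process :: "(real \<Rightarrow> real ^ 2) \<Rightarrow> real \<Rightarrow> (real ^ 2) set" where
  "hull_process w t = convex hull (w ` {0..t})"

definition diameter_process :: "(real \<Rightarrow> real ^ 2) \<Rightarrow> real \<Rightarrow> real" where
  "diameter_process w t = diameter (hull_process w t)"

definition range_process :: "(real \<Rightarrow> real) \<Rightarrow> real \<Rightarrow> real" where
  "range_process b t = (SUP s\<in>{0..t}. b s) - (INF s\<in>{0..t}. b s)"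

text \<open>The infimum is taken in \<open>[0,\<infinity>]\<close>, so it is \<open>\<infinity>\<close> if the level \<open>1\<close> is never exceeded.\<close>

definition exceedance_time :: "(real \<Rightarrow> real) \<Rightarrow> ennreal" where
  "exceedance_time f = Inf {ennreal t | t. 0 \<le> t \<and> f t > 1}"

definition Theta_D :: "(real \<Rightarrow> 'a \<Rightarrow> real ^ 2) \<Rightarrow> 'a \<Rightarrow> ennreal" where
  "Theta_D W \<omega> = exceedance_time (diameter_process (\<lambda>s. W s \<omega>))"

definition Theta_R :: "(real \<Rightarrow> 'a \<Rightarrow> real ^ 2) \<Rightarrow> 2 \<Rightarrow> 'a \<Rightarrow> ennreal" where
  "Theta_R W i \<omega> = exceedance_time (range_process (\<lambda>s. W s \<omega> $ i))"

definition frak_r :: real where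
  "frak_r = 1 / 2 - 2 / pi *
     (LINT t:{0<..}|lborel. (1 - 4 / (cos t + cosh t)\<^sup>2) * (1 / t ^ 3))"

end

theory Submission
  imports Defs "HOL-Real_Asymp.Real_Asymp"
begin

text \<open>All three quantities are governed by the escape time of one-dimensional Brownian motion, the
  first time its range exceeds \<open>1\<close>. For a walk with Gaussian steps let \<open>Y\<close> and \<open>V\<close> be the distances
  of the current position from the running maximum and minimum. Up to second-order terms in the
  increments of the range, \<open>exp (- \<mu>\<^sup>2 t / 2) (cosh (\<mu> Y) + cosh (\<mu> V))\<close> is a martingale; it starts
  at \<open>2\<close>, and when the range reaches \<open>1\<close> one of \<open>Y\<close>, \<open>V\<close> is \<open>0\<close> and the other \<open>1\<close>. Refining the grid
  gives \<open>E exp (- \<mu>\<^sup>2 \<Theta> / 2) = 1 / cosh (\<mu> / 2)\<^sup>2\<close> for all complex \<open>\<mu>\<close> with \<open>\<bar>Im \<mu>\<bar> \<le> Re \<mu>\<close>.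
  Hence the law of \<open>\<Theta>\<close> is unique, \<open>E \<Theta> = 1 / 2\<close> and \<open>E (1 / \<Theta>) = 4 ln 2\<close>.

  With \<open>\<mu> = (1 + \<i>) t\<close> the squared modulus of the characteristic function appears as
  \<open>4 / (cos t + cosh t)\<^sup>2\<close>, so the integral in \<open>frak_r\<close> is a multiple of \<open>E \<bar>\<Theta>\<^sub>1 - \<Theta>\<^sub>2\<bar>\<close>. For the
  lower bound, \<open>D(t)\<^sup>2 \<le> R\<^sub>1(t)\<^sup>2 + R\<^sub>2(t)\<^sup>2\<close>, and by scaling \<open>R\<^sub>i(t)\<^sup>2\<close> has the law of \<open>t / \<Theta>\<^sub>i\<close>;
  hence \<open>E \<Theta>\<^sup>D \<ge> E (1 / (1 / \<Theta>\<^sub>1 + 1 / \<Theta>\<^sub>2)) \<ge> 1 / (8 ln 2)\<close> by Jensen's inequality.\<close>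

subsection \<open>The range of a walk\<close>

text \<open>The obstacle is the size of the second-order terms. Bounding them by the squared steps
  of the walk is useless: N steps of variance h contribute N h, the time horizon itself. But they
  are quadratic in the increments of the range, and these increments telescope: up to and including
  the exceedance, with the last one capped at 1, they add up to at most 2. Splitting a quadratic
  term into \<epsilon> times the increment plus a fourth power over \<epsilon>^3 therefore leaves an
  error of order \<epsilon> + N h^2 / \<epsilon>^3, which a suitable grid sends to 0. The sector of
  admissible \<mu> is the part of Re (\<mu>^2) \<ge> 0 with Re \<mu> \<ge> 0, so the discount factor
  stays bounded by 1. Real \<mu> yield the Laplace transform and from it both moments; the boundary
  rays, where \<mu>^2 is imaginary, yield the characteristic function, hence uniqueness of the law
  and the integral in \<open>frak_r\<close>.\<close>

primrec drawdown :: "(nat \<Rightarrow> real) \<Rightarrow> nat \<Rightarrow> real" where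
  "drawdown x 0 = 0"
| "drawdown x (Suc k) = max 0 (drawdown x k - x k)"

text \<open>\<open>drawdown\<close> is the Lindley recursion: for the partial sums of
  \<open>x\<close> it is the gap below the running maximum, and with flipped signs the gap above the
  running minimum, so the two add up to the range. The recursive form shows one step as a function
  of the past and of the next increment, which is what the martingale argument uses.\<close>

definition osc :: "(nat \<Rightarrow> real) \<Rightarrow> nat \<Rightarrow> real" where
  "osc x k = drawdown x k + drawdown (\<lambda>i. - x i) k"

lemma drawdown_nonneg: "0 \<le> drawdown x k"
  by (cases k) auto

lemma osc_0 [simp]: "osc x 0 = 0"
  by (simp add: osc_def)

lemma osc_Suc_ge: "osc x k \<le> osc x (Suc k)"
  by (simp add: osc_def)

lemma osc_Suc_le: "osc x (Suc k) \<le> osc x k + \<bar>x k\<bar>"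
  using drawdown_nonneg[of x k] drawdown_nonneg[of "\<lambda>i. - x i" k] by (simp add: osc_def max_def)

lemma osc_mono: "i \<le> k \<Longrightarrow> osc x i \<le> osc x k"
  using osc_Suc_ge lift_Suc_mono_le[of "osc x"] by blast

lemma drawdown_sum_diff: "j \<le> k \<Longrightarrow> (\<Sum>i<j. x i) - (\<Sum>i<k. x i) \<le> drawdown x k"
proof (induction k)
  case (Suc k)
  then show ?case by (cases "j = Suc k") (auto simp: max_def)
qed simp

lemma drawdown_attained: "\<exists>j\<le>k. (\<Sum>i<j. x i) - (\<Sum>i<k. x i) = drawdown x k"
proof (induction k)
  case (Suc k)
  then obtain j where j: "j \<le> k" "(\<Sum>i<j. x i) - (\<Sum>i<k. x i) = drawdown x k" by blast
  show ?case
  proof (cases "drawdown x k - x k \<ge> 0")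
    case True
    then show ?thesis using j by (intro exI[of _ j]) auto
  next
    case False
    then show ?thesis by (intro exI[of _ "Suc k"]) auto
  qed
qed simp

text \<open>Some index attains the running maximum and some index the running minimum, so the range
  is itself one of the differences on the right and dominates all others. The starting value
  \<open>s 0\<close> cancels.\<close>

lemma osc_gt_iff:
  "osc (\<lambda>i. s (Suc i) - s i) k > a \<longleftrightarrow> (\<exists>i\<le>k. \<exists>j\<le>k. s i - s j > a)"
proof -
  let ?x = "\<lambda>i. s (Suc i) - s i" and ?y = "\<lambda>i. - (s (Suc i) - s i)"
  have s: "(\<Sum>i<j. ?x i) = s j - s 0" "(\<Sum>i<j. ?y i) = s 0 - s j" for j
    by (rule sum_lessThan_telescope) (induction j; simp)
  obtain i where i: "i \<le> k" "s i - s k = drawdown ?x k"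
    using drawdown_attained[of k ?x] unfolding s by auto
  obtain j where j: "j \<le> k" "s k - s j = drawdown ?y k"
    using drawdown_attained[of k ?y] unfolding s by auto
  have "s i' - s j' \<le> osc ?x k" if "i' \<le> k" "j' \<le> k" for i' j'
    using drawdown_sum_diff[OF that(1), of ?x] drawdown_sum_diff[OF that(2), of ?y]
    unfolding s osc_def by auto
  moreover have "s i - s j = osc ?x k" using i j by (simp add: osc_def)
  ultimately show ?thesis using i j by (metis less_le_trans)
qed

section \<open>Growth and Lipschitz bounds for complex \<open>cosh\<close> and
  \<open>sinh\<close>\<close>

lemma norm_sinh_cosh_le:
  fixes z :: complex
  shows "norm (cosh z) \<le> exp (norm z)" "norm (sinh z) \<le> exp (norm z)"
proof -
  have "norm (exp z) \<le> exp (norm z)" "norm (exp (-z)) \<le> exp (norm z)"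
    using norm_exp[of z] norm_exp[of "-z"] by auto
  then have "norm (exp z + exp (-z)) \<le> 2 * exp (norm z)" "norm (exp z - exp (-z)) \<le> 2 * exp (norm z)"
    using norm_triangle_ineq[of "exp z" "exp (-z)"] norm_triangle_ineq4[of "exp z" "exp (-z)"] by linarith+
  then show "norm (cosh z) \<le> exp (norm z)" "norm (sinh z) \<le> exp (norm z)"
    unfolding cosh_def sinh_def by (auto simp: norm_divide)
qed

lemma norm_cosh_diff_le:
  fixes z w :: complex
  assumes "norm z \<le> r" "norm w \<le> r"
  shows "norm (cosh z - cosh w) \<le> norm (z - w) * exp r"
proof -
  have "norm (cosh z - cosh w) \<le> exp r * norm (z - w)"
  proof (rule field_differentiable_bound[where S = "cball 0 r" and f' = sinh])
    show "norm (sinh x) \<le> exp r" if "x \<in> cball 0 r" for x :: complex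
      using norm_sinh_cosh_le(2)[of x] that by (smt (verit) exp_le_cancel_iff mem_cball_0)
  qed (use assms in \<open>auto intro!: derivative_eq_intros\<close>)
  then show ?thesis by (simp add: mult.commute)
qed

lemma norm_sinh_le:
  fixes z :: complex
  shows "norm (sinh z) \<le> norm z * exp (norm z)"
proof -
  have "norm (sinh z - sinh 0) \<le> exp (norm z) * norm (z - 0)"
  proof (rule field_differentiable_bound[where S = "cball 0 (norm z)" and f' = cosh])
    show "norm (cosh x) \<le> exp (norm z)" if "x \<in> cball 0 (norm z)" for x :: complex
      using norm_sinh_cosh_le(1)[of x] that by (smt (verit) exp_le_cancel_iff mem_cball_0)
  qed (auto intro!: derivative_eq_intros)
  then show ?thesis by (simp add: mult.commute)
qed

text \<open>The half-angle formula turns \<open>1 - cosh z\<close> into a multiple of a squared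
  \<open>sinh\<close>, which gives second order in \<open>z\<close>. The first-order bound of
  \<open>norm_cosh_diff_le\<close> would leave an error that does not vanish when summed over all
  steps.\<close>

lemma norm_one_minus_cosh_le:
  fixes z :: complex
  shows "norm (1 - cosh z) \<le> (norm z)\<^sup>2 * exp (norm z)"
proof -
  have "cosh z = cosh (2 * (z/2))" by simp
  also have "\<dots> = 1 + 2 * sinh (z/2) ^ 2"
    unfolding cosh_double cosh_square_eq by simp
  finally have "norm (1 - cosh z) = 2 * norm (sinh (z/2)) ^ 2"
    by (simp add: norm_mult norm_power)
  also have "\<dots> \<le> 2 * (norm (z/2) * exp (norm (z/2))) ^ 2"
    by (intro mult_left_mono power_mono norm_sinh_le) auto
  also have "\<dots> = (norm z)\<^sup>2 * exp (norm z) / 2"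
    by (simp add: power_mult_distrib power_divide norm_divide flip: exp_double)
  also have "\<dots> \<le> (norm z)\<^sup>2 * exp (norm z)" by simp
  finally show ?thesis .
qed

text \<open>Reflecting instead of truncating at \<open>0\<close> would make the sum an exact martingale, because
  \<open>cosh\<close> is even; the last summand is the price of truncation, quadratic in the increment of the
  range.\<close>

lemma cosh_drawdown_Suc:
  fixes \<mu> :: complex and x :: "nat \<Rightarrow> real"
  defines "Y \<equiv> drawdown x" and "V \<equiv> drawdown (\<lambda>i. - x i)"
  shows "cosh (\<mu> * Y (Suc k)) + cosh (\<mu> * V (Suc k)) =
    cosh (\<mu> * (Y k - x k)) + cosh (\<mu> * (V k + x k)) + (1 - cosh (\<mu> * (osc x (Suc k) - osc x k)))"
proof -
  have nn: "0 \<le> Y k" "0 \<le> V k" by (simp_all add: Y_def V_def drawdown_nonneg)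
  have Suc: "Y (Suc k) = max 0 (Y k - x k)" "V (Suc k) = max 0 (V k + x k)"
    "osc x (Suc k) - osc x k = max 0 (Y k - x k) + max 0 (V k + x k) - Y k - V k"
    by (simp_all add: Y_def V_def osc_def)
  have sym: "cosh (\<mu> * complex_of_real a) = cosh (\<mu> * complex_of_real b)" if "a = - b" for a b
    using that by simp
  \<comment> \<open>In the first two cases one distance is cut off at 0 and the range grows by
    exactly the amount cut off, so evenness of \<open>cosh\<close> matches the truncated term with
    the correction. In the third case nothing is cut off and the range stays the same.\<close>
  consider "x k > Y k" | "x k < - V k" | "x k \<le> Y k" "x k \<ge> - V k" by linarith
  then show ?thesis
  proof cases
    case 1
    have "cosh (\<mu> * complex_of_real (Y k - x k)) = cosh (\<mu> * complex_of_real (x k - Y k))"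
      by (rule sym) simp
    with 1 nn show ?thesis unfolding Suc by (simp add: max_def)
  next
    case 2
    have "cosh (\<mu> * complex_of_real (V k + x k)) = cosh (\<mu> * complex_of_real (- x k - V k))"
      by (rule sym) simp
    with 2 nn show ?thesis unfolding Suc by (simp add: max_def)
  next
    case 3
    then have "Y k - x k \<ge> 0" "V k + x k \<ge> 0" by auto
    then have "max 0 (Y k - x k) = Y k - x k" "max 0 (V k + x k) = V k + x k" by auto
    then show ?thesis unfolding Suc by simp
  qed
qed

text \<open>When the range grows, the walk sits at a new maximum or a new minimum, so one of the two
  distances is 0 and the other is the whole range.\<close>

lemma cosh_drawdown_new_extremum:
  fixes \<mu> :: complex
  assumes "osc x k < osc x (Suc k)"
  shows "cosh (\<mu> * drawdown x (Suc k)) + cosh (\<mu> * drawdown (\<lambda>i. - x i) (Suc k)) =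
    1 + cosh (\<mu> * osc x (Suc k))"
  using assms drawdown_nonneg[of x k] drawdown_nonneg[of "\<lambda>i. - x i" k]
  by (auto simp: osc_def max_def split: if_splits)

text \<open>Optional stopping written out pathwise. The sum with the factor \<open>A\<close>
  collects the increments up to the first exceedance, 2 is the starting value and
  \<open>1 + cosh \<mu>\<close> the ideal value at the exceedance. On the right remain the walks
  that have not yet exceeded, the overshoot beyond range 1 (factor \<open>B\<close>) and the
  truncation corrections (factor \<open>A\<close>).\<close>

lemma osc_martingale_identity:
  fixes \<mu> q :: complex and x :: "nat \<Rightarrow> real"
  defines "Y \<equiv> drawdown x" and "V \<equiv> drawdown (\<lambda>i. - x i)"
  defines "A \<equiv> \<lambda>k. of_bool (osc x k \<le> 1) :: complex"
  defines "B \<equiv> \<lambda>k. of_bool (osc x k \<le> 1 \<and> osc x (Suc k) > 1) :: complex"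
  shows "2 - (1 + cosh \<mu>) * (\<Sum>k<N. q ^ Suc k * B k) +
      (\<Sum>k<N. A k * (q ^ Suc k * (cosh (\<mu> * (Y k - x k)) + cosh (\<mu> * (V k + x k))) -
                    q ^ k * (cosh (\<mu> * Y k) + cosh (\<mu> * V k)))) =
    q ^ N * A N * (cosh (\<mu> * Y N) + cosh (\<mu> * V N)) +
      (\<Sum>k<N. q ^ Suc k * (B k * (cosh (\<mu> * osc x (Suc k)) - cosh \<mu>) -
                    A k * (1 - cosh (\<mu> * (osc x (Suc k) - osc x k)))))"
proof (induction N)
  case 0
  show ?case by (simp add: A_def Y_def V_def)
next
  case (Suc N)
  let ?D = "1 - cosh (\<mu> * (osc x (Suc N) - osc x N))"
  define a where "a = cosh (\<mu> * (Y N - x N)) + cosh (\<mu> * (V N + x N))"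
  define b where "b = cosh (\<mu> * Y (Suc N)) + cosh (\<mu> * V (Suc N))"
  have a: "a = b - ?D"
    unfolding a_def b_def Y_def V_def cosh_drawdown_Suc by simp
  have B: "A (Suc N) = A N - B N"
    using osc_Suc_ge[of x N] by (auto simp: A_def B_def)
  have Bb: "B N * b = B N * (1 + cosh (\<mu> * osc x (Suc N)))"
    using cosh_drawdown_new_extremum[of x N \<mu>] by (auto simp: B_def b_def Y_def V_def)
  have "q ^ Suc N * (A N * b) - q ^ Suc N * (B N * (1 + cosh \<mu>)) =
      q ^ Suc N * (A (Suc N) * b) + q ^ Suc N * (B N * (cosh (\<mu> * osc x (Suc N)) - cosh \<mu>))"
    using Bb unfolding B by (simp add: algebra_simps)
  then show ?case
    using Suc.IH unfolding sum.lessThan_Suc a_def[symmetric] b_def[symmetric] a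
    by (simp add: algebra_simps)
qed

text \<open>A monotone sequence crosses the level once. Bounding by the indicator instead of by 1
  makes the induction go through: at the crossing step the earlier sum is known to be 0.\<close>

lemma sum_first_exceedance_le: "(\<Sum>k<N. of_bool (osc x k \<le> 1 \<and> osc x (Suc k) > 1)) \<le> (of_bool (osc x N > 1) :: real)"
proof (induction N)
  case (Suc N)
  then show ?case using osc_Suc_ge[of x N] by (auto split: if_splits)
qed simp

text \<open>Increments telescope to at most 1 while the range is at most 1, and the cap lets the
  crossing increment add at most 1 more. The minimum with \<open>osc x N\<close> is the invariant
  that carries the telescoping.\<close>

lemma sum_osc_increments_le:
  "(\<Sum>k<N. of_bool (osc x k \<le> 1) * min 1 (osc x (Suc k) - osc x k)) \<le> min 2 (osc x N)"
proof (induction N)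
  case (Suc N)
  then show ?case using osc_Suc_ge[of x N] by (auto simp: min_def split: if_splits)
qed simp

text \<open>Used for the overshoot, which occurs only once, so that a first-order term may be paid
  with \<epsilon>. The excess is charged to a fourth power because its expectation is of order h^2
  per step.\<close>

lemma le_eps_plus_power4:
  fixes g \<epsilon> :: real
  assumes "0 \<le> g" "0 < \<epsilon>"
  shows "g \<le> \<epsilon> + g ^ 4 / \<epsilon> ^ 3"
proof (cases "g \<le> \<epsilon>")
  case True
  then show ?thesis using assms by (simp add: add_increasing2)
next
  case False
  then have "\<epsilon> ^ 3 \<le> g ^ 3" using assms by (intro power_mono) auto
  then have "g * \<epsilon> ^ 3 \<le> g * g ^ 3" using assms by (intro mult_left_mono) auto
  then have "g * \<epsilon> ^ 3 \<le> g ^ 4" by (simp add: numeral_eq_Suc)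
  then have "g \<le> g ^ 4 / \<epsilon> ^ 3" using assms by (simp add: pos_le_divide_eq)
  then show ?thesis using assms by linarith
qed

text \<open>For small \<open>D\<close> one of the two factors \<open>D\<close> is traded for
  \<epsilon>, and what is left is summable by \<open>sum_osc_increments_le\<close>; there
  \<open>D\<close> is below 1, so the cap does no harm. For large \<open>D\<close> the fourth power
  dominates.\<close>

lemma square_exp_le_eps:
  fixes D \<epsilon> c :: real
  assumes D: "0 \<le> D" and e: "0 < \<epsilon>" "\<epsilon> \<le> 1" and c: "0 \<le> c"
  shows "D\<^sup>2 * exp (c * D) \<le> \<epsilon> * min 1 D + (D * exp (c * D)) ^ 4 / \<epsilon> ^ 3"
proof -
  define g where "g = D * exp (c * D)"
  have Dg: "D \<le> g" using D c by (simp add: g_def mult_left_le_one_le mult_le_cancel_left1)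
  have eq: "D\<^sup>2 * exp (c * D) = D * g" by (simp add: g_def power2_eq_square)
  show ?thesis
  proof (cases "g \<le> \<epsilon>")
    case True
    then have "D \<le> 1" using Dg e by linarith
    have "D * g \<le> \<epsilon> * D" using True D by (simp add: mult.commute mult_left_mono)
    with \<open>D \<le> 1\<close> have "D * g \<le> \<epsilon> * min 1 D" by (simp add: min_def)
    moreover have "0 \<le> g ^ 4 / \<epsilon> ^ 3" using e by simp
    ultimately show ?thesis unfolding eq g_def[symmetric] by linarith
  next
    case False
    then have g: "g > \<epsilon>" by simp
    have "\<epsilon> ^ 3 \<le> \<epsilon> ^ 2" using e by (intro power_decreasing) auto
    also have "\<dots> \<le> g ^ 2" using g e by (intro power_mono) auto
    finally have "g ^ 2 * \<epsilon> ^ 3 \<le> g ^ 2 * g ^ 2" by (intro mult_left_mono) auto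
    then have "g ^ 2 * \<epsilon> ^ 3 \<le> g ^ 4" by (simp add: numeral_eq_Suc)
    then have "g ^ 2 \<le> g ^ 4 / \<epsilon> ^ 3" using e by (simp add: pos_le_divide_eq)
    moreover have "D * g \<le> g ^ 2" using Dg D by (simp add: power2_eq_square mult_right_mono)
    moreover have "0 \<le> \<epsilon> * min 1 D" using D e by simp
    ultimately show ?thesis unfolding eq g_def[symmetric] by linarith
  qed
qed

text \<open>Before the exceedance both distances are at most 1, so the end term decays like
  \<open>norm q ^ N\<close>. In \<open>3 * \<epsilon>\<close>, one \<epsilon> pays for the single
  overshoot and two for the telescoping truncation terms; each of the two kinds of error also
  contributes one sum of fourth powers, whence the factor 2.\<close>

lemma osc_martingale_bound:
  fixes \<mu> q :: complex and x :: "nat \<Rightarrow> real"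
  defines "Y \<equiv> drawdown x" and "V \<equiv> drawdown (\<lambda>i. - x i)"
  defines "A \<equiv> \<lambda>k. of_bool (osc x k \<le> 1) :: complex"
  defines "B \<equiv> \<lambda>k. of_bool (osc x k \<le> 1 \<and> osc x (Suc k) > 1) :: complex"
  assumes q: "norm q \<le> 1" and e: "0 < \<epsilon>" "\<epsilon> \<le> 1"
  shows "norm (2 - (1 + cosh \<mu>) * (\<Sum>k<N. q ^ Suc k * B k) +
      (\<Sum>k<N. A k * (q ^ Suc k * (cosh (\<mu> * (Y k - x k)) + cosh (\<mu> * (V k + x k))) -
                    q ^ k * (cosh (\<mu> * Y k) + cosh (\<mu> * V k)))))
    \<le> 2 * exp (norm \<mu>) * norm q ^ N + (1 + norm \<mu>)\<^sup>2 * exp (norm \<mu>) *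
       (3 * \<epsilon> + 2 / \<epsilon> ^ 3 * (\<Sum>k<N. (\<bar>x k\<bar> * exp (norm \<mu> * \<bar>x k\<bar>)) ^ 4))"
proof -
  define c where "c = norm \<mu>"
  \<comment> \<open>Chosen to dominate both constants that occur: \<open>c * exp c\<close> from the
    overshoot and \<open>c\<^sup>2\<close> from the truncation.\<close>
  define K where "K = (1 + c)\<^sup>2 * exp c"
  define D where "D = (\<lambda>k. osc x (Suc k) - osc x k)"
  define g where "g = (\<lambda>y. y * exp (c * y))"
  have c: "0 \<le> c" by (simp add: c_def)
  have K: "c * exp c \<le> K" "c\<^sup>2 \<le> K" "0 \<le> K"
  proof -
    have "c \<le> (1 + c)\<^sup>2" using c by (simp add: power2_eq_square algebra_simps add_increasing)
    then show "c * exp c \<le> K" unfolding K_def by (intro mult_right_mono) auto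
    have "c\<^sup>2 \<le> (1 + c)\<^sup>2" using c by (intro power_mono) auto
    also have "\<dots> \<le> K" unfolding K_def using c by (simp add: mult_le_cancel_left1)
    finally show "c\<^sup>2 \<le> K" .
  qed (simp add: K_def)
  have D: "0 \<le> D k" "D k \<le> \<bar>x k\<bar>" for k
    using osc_Suc_ge[of x k] osc_Suc_le[of x k] by (auto simp: D_def)
  have gD: "0 \<le> g (D k)" "g (D k) ^ 4 / \<epsilon> ^ 3 \<le> g \<bar>x k\<bar> ^ 4 / \<epsilon> ^ 3" for k
  proof -
    show "0 \<le> g (D k)" using D by (simp add: g_def)
    have "g (D k) \<le> g \<bar>x k\<bar>" unfolding g_def using D[of k] c
      by (intro mult_mono) (auto intro: mult_left_mono)
    then show "g (D k) ^ 4 / \<epsilon> ^ 3 \<le> g \<bar>x k\<bar> ^ 4 / \<epsilon> ^ 3"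
      using e \<open>0 \<le> g (D k)\<close> by (intro divide_right_mono power_mono) auto
  qed
  have end_term: "norm (q ^ N * A N * (cosh (\<mu> * Y N) + cosh (\<mu> * V N))) \<le> 2 * exp c * norm q ^ N"
  proof (cases "osc x N \<le> 1")
    case True
    then have YV: "0 \<le> Y N" "Y N \<le> 1" "0 \<le> V N" "V N \<le> 1"
      using drawdown_nonneg[of x N] drawdown_nonneg[of "\<lambda>i. - x i" N] by (auto simp: osc_def Y_def V_def)
    have *: "norm (cosh (\<mu> * complex_of_real y)) \<le> exp c" if "0 \<le> y" "y \<le> 1" for y
    proof -
      have "norm (\<mu> * complex_of_real y) \<le> c"
        using that by (simp add: norm_mult c_def mult_left_le)
      then show ?thesis using norm_sinh_cosh_le(1) by (meson exp_le_cancel_iff order_trans)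
    qed
    have "norm (cosh (\<mu> * Y N) + cosh (\<mu> * V N)) \<le> exp c + exp c"
      using YV by (intro norm_triangle_mono *)
    then have "norm q ^ N * norm (cosh (\<mu> * Y N) + cosh (\<mu> * V N)) \<le> norm q ^ N * (exp c + exp c)"
      by (intro mult_left_mono) auto
    then show ?thesis using True by (simp add: A_def norm_mult norm_power mult_ac)
  qed (simp add: A_def)
  have term1: "norm (B k * (cosh (\<mu> * osc x (Suc k)) - cosh \<mu>)) \<le> 
      K * (\<epsilon> * of_bool (osc x k \<le> 1 \<and> osc x (Suc k) > 1) + g \<bar>x k\<bar> ^ 4 / \<epsilon> ^ 3)" for k
  proof (cases "osc x k \<le> 1 \<and> osc x (Suc k) > 1")
    case True
    have R: "osc x (Suc k) \<le> 1 + D k" using True by (simp add: D_def)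
    have "norm (cosh (\<mu> * osc x (Suc k)) - cosh \<mu>) \<le> norm (\<mu> * osc x (Suc k) - \<mu>) * exp (c * (1 + D k))"
    proof (rule norm_cosh_diff_le)
      show "norm (\<mu> * osc x (Suc k)) \<le> c * (1 + D k)"
        using R True c by (auto simp: norm_mult c_def intro!: mult_left_mono)
      show "norm \<mu> \<le> c * (1 + D k)" using D[of k] c by (simp add: c_def algebra_simps)
    qed
    also have "\<mu> * osc x (Suc k) - \<mu> = \<mu> * (osc x (Suc k) - 1)"
      by (simp add: algebra_simps)
    also have "norm \<dots> = c * (osc x (Suc k) - 1)"
    proof -
      have "norm (complex_of_real (osc x (Suc k)) - 1) = norm (complex_of_real (osc x (Suc k) - 1))" by simp
      also have "\<dots> = osc x (Suc k) - 1" using True unfolding norm_of_real by simp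
      finally show ?thesis by (simp add: norm_mult c_def)
    qed
    also have "\<dots> * exp (c * (1 + D k)) \<le> c * D k * exp (c * (1 + D k))"
      using R c by (intro mult_right_mono mult_left_mono) auto
    also have "\<dots> = c * exp c * g (D k)" by (simp add: g_def algebra_simps exp_add)
    also have "\<dots> \<le> K * g (D k)" using K gD by (intro mult_right_mono) auto
    also have "\<dots> \<le> K * (\<epsilon> + g (D k) ^ 4 / \<epsilon> ^ 3)"
      using K e gD by (intro mult_left_mono le_eps_plus_power4) auto
    also have "\<dots> \<le> K * (\<epsilon> + g \<bar>x k\<bar> ^ 4 / \<epsilon> ^ 3)"
      using K gD by (intro mult_left_mono add_left_mono) auto
    finally show ?thesis using True by (simp add: B_def)
  next
    case False
    have "0 \<le> K * (g \<bar>x k\<bar> ^ 4 / \<epsilon> ^ 3)" using K e by simp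
    then show ?thesis using False by (auto simp: B_def)
  qed
  have term2: "norm (A k * (1 - cosh (\<mu> * (osc x (Suc k) - osc x k)))) \<le> 
      K * (\<epsilon> * (of_bool (osc x k \<le> 1) * min 1 (D k)) + g \<bar>x k\<bar> ^ 4 / \<epsilon> ^ 3)" for k
  proof (cases "osc x k \<le> 1")
    case True
    have "complex_of_real (osc x (Suc k)) - osc x k = complex_of_real (D k)" by (simp add: D_def)
    then have nm: "norm (\<mu> * (complex_of_real (osc x (Suc k)) - osc x k)) = c * D k"
      using D by (simp add: norm_mult c_def)
    have "norm (1 - cosh (\<mu> * (complex_of_real (osc x (Suc k)) - osc x k))) \<le> (c * D k)\<^sup>2 * exp (c * D k)"
      using norm_one_minus_cosh_le nm by metis
    also have "\<dots> = c\<^sup>2 * ((D k)\<^sup>2 * exp (c * D k))" by (simp add: power_mult_distrib)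
    also have "\<dots> \<le> K * ((D k)\<^sup>2 * exp (c * D k))" using K by (intro mult_right_mono) auto
    also have "\<dots> \<le> K * (\<epsilon> * min 1 (D k) + g (D k) ^ 4 / \<epsilon> ^ 3)"
      unfolding g_def using K e D c by (intro mult_left_mono square_exp_le_eps) auto
    also have "\<dots> \<le> K * (\<epsilon> * min 1 (D k) + g \<bar>x k\<bar> ^ 4 / \<epsilon> ^ 3)"
      using K gD by (intro mult_left_mono add_left_mono) auto
    finally show ?thesis using True by (simp add: A_def)
  next
    case False
    have "0 \<le> K * (g \<bar>x k\<bar> ^ 4 / \<epsilon> ^ 3)" using K e by simp
    then show ?thesis using False by (auto simp: A_def)
  qed
  let ?S = "\<Sum>k<N. g \<bar>x k\<bar> ^ 4"
  have "norm (\<Sum>k<N. q ^ Suc k * (B k * (cosh (\<mu> * osc x (Suc k)) - cosh \<mu>) -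
                    A k * (1 - cosh (\<mu> * (osc x (Suc k) - osc x k)))))
    \<le> (\<Sum>k<N. K * (\<epsilon> * of_bool (osc x k \<le> 1 \<and> osc x (Suc k) > 1) + g \<bar>x k\<bar> ^ 4 / \<epsilon> ^ 3) +
          K * (\<epsilon> * (of_bool (osc x k \<le> 1) * min 1 (D k)) + g \<bar>x k\<bar> ^ 4 / \<epsilon> ^ 3))"
  proof (rule sum_norm_le)
    fix k
    have "norm (q ^ Suc k) \<le> 1" unfolding norm_power using q by (intro power_le_one) auto
    then have "norm (q ^ Suc k * z) \<le> norm z" for z
      unfolding norm_mult by (intro mult_left_le_one_le) auto
    then show "norm (q ^ Suc k * (B k * (cosh (\<mu> * osc x (Suc k)) - cosh \<mu>) -
                    A k * (1 - cosh (\<mu> * (osc x (Suc k) - osc x k))))) \<le>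
        K * (\<epsilon> * of_bool (osc x k \<le> 1 \<and> osc x (Suc k) > 1) + g \<bar>x k\<bar> ^ 4 / \<epsilon> ^ 3) +
          K * (\<epsilon> * (of_bool (osc x k \<le> 1) * min 1 (D k)) + g \<bar>x k\<bar> ^ 4 / \<epsilon> ^ 3)"
      using norm_triangle_ineq4 term1[of k] term2[of k] by (smt (verit, ccfv_threshold))
  qed
  also have "\<dots> = K * (\<epsilon> * (\<Sum>k<N. of_bool (osc x k \<le> 1 \<and> osc x (Suc k) > 1)) +
      \<epsilon> * (\<Sum>k<N. of_bool (osc x k \<le> 1) * min 1 (D k)) + 2 / \<epsilon> ^ 3 * ?S)"
    by (simp add: sum.distrib sum_distrib_left sum_divide_distrib algebra_simps del: sum_of_bool_eq sum_mult_of_bool_eq sum_of_bool_mult_eq)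
  also have "\<dots> \<le> K * (\<epsilon> * 1 + \<epsilon> * 2 + 2 / \<epsilon> ^ 3 * ?S)"
  proof (intro mult_left_mono add_right_mono add_mono)
    show "(\<Sum>k<N. of_bool (osc x k \<le> 1 \<and> osc x (Suc k) > 1)) \<le> (1 :: real)"
      by (rule order_trans[OF sum_first_exceedance_le[of x N]]) simp
    show "(\<Sum>k<N. of_bool (osc x k \<le> 1) * min 1 (D k)) \<le> 2"
      using sum_osc_increments_le[of x N] by (simp add: D_def)
  qed (use e K in auto)
  finally have sum_bound: "norm (\<Sum>k<N. q ^ Suc k * (B k * (cosh (\<mu> * osc x (Suc k)) - cosh \<mu>) -
                    A k * (1 - cosh (\<mu> * (osc x (Suc k) - osc x k)))))
    \<le> K * (3 * \<epsilon> + 2 / \<epsilon> ^ 3 * ?S)" by simp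
  show ?thesis
    unfolding A_def B_def Y_def V_def osc_martingale_identity
    using norm_triangle_mono[OF end_term sum_bound]
    unfolding A_def B_def Y_def V_def K_def g_def c_def .
qed

subsection \<open>Gaussian walks\<close>

text \<open>Completing the square with the real part of \<mu> only: the shift by \<open>a\<close>
  stays on the real line and leaves the characteristic function of the normal law at
  \<open>b\<close>.\<close>

lemma std_normal_exp:
  fixes \<mu> :: complex
  shows "integrable lborel (\<lambda>x. std_normal_density x *\<^sub>R exp (\<mu> * x))" (is ?int)
    and "(LINT x|lborel. std_normal_density x *\<^sub>R exp (\<mu> * x)) = exp (\<mu>\<^sup>2 / 2)" (is ?eq)
proof -
  define a b where "a = Re \<mu>" and "b = Im \<mu>"
  have \<mu>: "\<mu> = complex_of_real a + \<i> * complex_of_real b" by (simp add: a_def b_def complex_eq)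
  have shift: "std_normal_density (a + 1 * y) *\<^sub>R exp (\<mu> * complex_of_real (a + 1 * y)) =
      exp (a\<^sup>2 / 2 + \<i> * a * b) * (std_normal_density y *\<^sub>R iexp (b * y))" for y
  proof -
    have "complex_of_real (std_normal_density (a + y)) * exp (\<mu> * complex_of_real (a + y)) =
      complex_of_real (1 / sqrt (2 * pi)) * (exp (complex_of_real (- (a + y)\<^sup>2 / 2)) * exp (\<mu> * complex_of_real (a + y)))"
      by (simp add: std_normal_density_def flip: exp_of_real)
    also have "exp (complex_of_real (- (a + y)\<^sup>2 / 2)) * exp (\<mu> * complex_of_real (a + y)) =
      exp (a\<^sup>2 / 2 + \<i> * a * b) * (exp (complex_of_real (- y\<^sup>2 / 2)) * iexp (b * y))"
      unfolding exp_add[symmetric] by (rule arg_cong[where f = exp]) (simp add: \<mu> field_simps power2_eq_square)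
    finally show ?thesis
      by (simp add: std_normal_density_def scaleR_conv_of_real flip: exp_of_real)
  qed
  have "integrable lborel (\<lambda>y. std_normal_density y *\<^sub>R iexp (b * y))"
    by (rule Bochner_Integration.integrable_bound[of _ std_normal_density]) auto
  then have int: "integrable lborel (\<lambda>y. exp (a\<^sup>2 / 2 + \<i> * a * b) * (std_normal_density y *\<^sub>R iexp (b * y)))"
    by (rule integrable_mult_right)
  have "(LINT y|lborel. std_normal_density y *\<^sub>R iexp (b * y)) = char std_normal_distribution b"
    unfolding char_def by (subst integral_density) auto
  then have val: "(LINT y|lborel. exp (a\<^sup>2 / 2 + \<i> * a * b) * (std_normal_density y *\<^sub>R iexp (b * y))) = 
      exp (a\<^sup>2 / 2 + \<i> * a * b) * exp (- (b\<^sup>2) / 2)"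
    by (subst integral_mult_right_zero) (simp add: char_std_normal_distribution flip: exp_of_real)
  show ?int
    using lborel_integrable_real_affine_iff[of 1 "\<lambda>x. std_normal_density x *\<^sub>R exp (\<mu> * complex_of_real x)" a] int
    unfolding shift by simp
  have "(LINT x|lborel. std_normal_density x *\<^sub>R exp (\<mu> * x)) = exp (a\<^sup>2 / 2 + \<i> * a * b) * exp (- (b\<^sup>2) / 2)"
    using lborel_integral_real_affine[of 1 "\<lambda>x. std_normal_density x *\<^sub>R exp (\<mu> * complex_of_real x)" a] val
    unfolding shift by simp
  also have "\<dots> = exp (\<mu>\<^sup>2 / 2)"
    unfolding exp_of_real[symmetric] exp_add[symmetric] by (rule arg_cong[where f = exp]) (simp add: \<mu> field_simps power2_eq_square)
  finally show ?eq .
qed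

context prob_space
begin

lemma normal_exp:
  fixes \<mu> :: complex
  assumes X: "distributed M lborel X (normal_density 0 \<sigma>)" and \<sigma>: "0 < \<sigma>"
  shows "integrable M (\<lambda>\<omega>. exp (\<mu> * X \<omega>))" and "expectation (\<lambda>\<omega>. exp (\<mu> * X \<omega>)) = exp (\<mu>\<^sup>2 * \<sigma>\<^sup>2 / 2)"
proof -
  have D: "distributed M lborel (\<lambda>\<omega>. X \<omega> / \<sigma>) std_normal_density"
    using X \<sigma> normal_standard_normal_convert[of \<sigma> X 0] by simp
  have m: "(\<lambda>\<omega>. X \<omega> / \<sigma>) \<in> borel_measurable M"
    using distributed_measurable[OF D] by simp
  have distr: "distr M lborel (\<lambda>\<omega>. X \<omega> / \<sigma>) = density lborel std_normal_density"
    by (rule distributed_distr_eq_density[OF D])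
  have eq: "exp (\<mu> * complex_of_real (X \<omega>)) = exp (\<mu> * \<sigma> * complex_of_real (X \<omega> / \<sigma>))" for \<omega>
    using \<sigma> by simp
  have "integrable (distr M lborel (\<lambda>\<omega>. X \<omega> / \<sigma>)) (\<lambda>x. exp (\<mu> * \<sigma> * complex_of_real x))"
    unfolding distr using std_normal_exp(1)[of "\<mu> * \<sigma>"] by (subst integrable_density) auto
  then show "integrable M (\<lambda>\<omega>. exp (\<mu> * X \<omega>))"
    unfolding eq using m by (subst (asm) integrable_distr_eq) auto
  have "expectation (\<lambda>\<omega>. exp (\<mu> * \<sigma> * complex_of_real (X \<omega> / \<sigma>))) =
      (LINT x|distr M lborel (\<lambda>\<omega>. X \<omega> / \<sigma>). exp (\<mu> * \<sigma> * complex_of_real x))"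
    using m by (subst integral_distr) auto
  also have "\<dots> = exp ((\<mu> * \<sigma>)\<^sup>2 / 2)"
    unfolding distr using std_normal_exp(2)[of "\<mu> * \<sigma>"] by (subst integral_density) auto
  finally show "expectation (\<lambda>\<omega>. exp (\<mu> * X \<omega>)) = exp (\<mu>\<^sup>2 * \<sigma>\<^sup>2 / 2)"
    unfolding eq by (simp add: power_mult_distrib)
qed

lemma normal_cosh_sinh:
  fixes \<mu> :: complex
  assumes X: "distributed M lborel X (normal_density 0 \<sigma>)" and \<sigma>: "0 < \<sigma>"
  shows "integrable M (\<lambda>\<omega>. cosh (\<mu> * X \<omega>))" "integrable M (\<lambda>\<omega>. sinh (\<mu> * X \<omega>))"
    and "expectation (\<lambda>\<omega>. cosh (\<mu> * X \<omega>)) = exp (\<mu>\<^sup>2 * \<sigma>\<^sup>2 / 2)"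
    and "expectation (\<lambda>\<omega>. sinh (\<mu> * X \<omega>)) = 0"
proof -
  note 1 = normal_exp[OF X \<sigma>, of \<mu>] and 2 = normal_exp[OF X \<sigma>, of "-\<mu>"]
  show "integrable M (\<lambda>\<omega>. cosh (\<mu> * X \<omega>))" "integrable M (\<lambda>\<omega>. sinh (\<mu> * X \<omega>))"
    using 1(1) 2(1) by (auto simp: cosh_def sinh_def)
  show "expectation (\<lambda>\<omega>. cosh (\<mu> * X \<omega>)) = exp (\<mu>\<^sup>2 * \<sigma>\<^sup>2 / 2)"
    "expectation (\<lambda>\<omega>. sinh (\<mu> * X \<omega>)) = 0"
    using 1 2 by (simp_all add: cosh_def sinh_def)
qed

end

section \<open>Weighted fourth moments of the steps\<close>

lemma std_normal_exp_abs_moment: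
  fixes c :: real
  assumes "0 \<le> c"
  shows "integrable lborel (\<lambda>x. std_normal_density x * (\<bar>x\<bar> * exp (c * \<bar>x\<bar>)) ^ 4)"
proof -
  have "integrable lborel (\<lambda>x. std_normal_density x * exp (a * x))" for a :: real
    using integrable_norm[OF std_normal_exp(1)[of "complex_of_real a"]] by simp
  from Bochner_Integration.integrable_add[OF this[of "4 * (c + 1)"] this[of "- (4 * (c + 1))"]]
  show ?thesis
  proof (rule Bochner_Integration.integrable_bound)
    have "(\<bar>x\<bar> * exp (c * \<bar>x\<bar>)) ^ 4 \<le> exp (4 * (c + 1) * x) + exp (- (4 * (c + 1)) * x)" for x
    proof -
      have "\<bar>x\<bar> \<le> exp \<bar>x\<bar>" using exp_ge_add_one_self[of "\<bar>x\<bar>"] by linarith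
      then have "(\<bar>x\<bar> * exp (c * \<bar>x\<bar>)) ^ 4 \<le> (exp \<bar>x\<bar> * exp (c * \<bar>x\<bar>)) ^ 4"
        by (intro power_mono mult_right_mono) auto
      also have "\<dots> = exp (4 * (c + 1) * \<bar>x\<bar>)"
        by (simp add: algebra_simps flip: exp_add exp_of_nat_mult)
      also have "exp (t * \<bar>x\<bar>) \<le> exp (t * x) + exp (- t * x)" for t
        by (cases "x \<ge> 0") auto
      finally show ?thesis .
    qed
    then have "std_normal_density x * (\<bar>x\<bar> * exp (c * \<bar>x\<bar>)) ^ 4 \<le>
        std_normal_density x * (exp (4 * (c + 1) * x) + exp (- (4 * (c + 1)) * x))" for x
      by (intro mult_left_mono) auto
    then show "AE x in lborel. norm (std_normal_density x * (\<bar>x\<bar> * exp (c * \<bar>x\<bar>)) ^ 4) \<le>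
        norm (std_normal_density x * exp (4 * (c + 1) * x) + std_normal_density x * exp (- (4 * (c + 1)) * x))"
      by (intro AE_I2) (simp add: distrib_left)
  qed measurable
qed

definition normal_weight :: "real \<Rightarrow> real" where
  "normal_weight c = (LINT x|lborel. std_normal_density x * (\<bar>x\<bar> * exp (c * \<bar>x\<bar>)) ^ 4)"

text \<open>Write X as sqrt h times a standard normal Z. Since h \<le> 1, the exponent can be
  bounded through |X| \<le> |Z|; the remaining factor (sqrt h)^4 = h^2 is the reason for taking
  fourth powers, as N steps then cost only N h^2.\<close>

lemma (in prob_space) normal_exp_abs_moment:
  fixes c :: real
  assumes X: "distributed M lborel X (normal_density 0 (sqrt h))" and h: "0 < h" "h \<le> 1" and c: "0 \<le> c"
  shows "integrable M (\<lambda>\<omega>. (\<bar>X \<omega>\<bar> * exp (c * \<bar>X \<omega>\<bar>)) ^ 4)"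
    and "expectation (\<lambda>\<omega>. (\<bar>X \<omega>\<bar> * exp (c * \<bar>X \<omega>\<bar>)) ^ 4) \<le> h\<^sup>2 * normal_weight c"
proof -
  define Z where "Z = (\<lambda>\<omega>. X \<omega> / sqrt h)"
  have D: "distributed M lborel Z std_normal_density"
    using X h normal_standard_normal_convert[of "sqrt h" X 0] by (simp add: Z_def)
  have m: "X \<in> borel_measurable M" using distributed_measurable[OF X] by simp
  have intZ: "integrable M (\<lambda>\<omega>. (\<bar>Z \<omega>\<bar> * exp (c * \<bar>Z \<omega>\<bar>)) ^ 4)"
    using distributed_integrable[OF D, of "\<lambda>x. (\<bar>x\<bar> * exp (c * \<bar>x\<bar>)) ^ 4"] std_normal_exp_abs_moment[OF c] by simp
  have EZ: "expectation (\<lambda>\<omega>. (\<bar>Z \<omega>\<bar> * exp (c * \<bar>Z \<omega>\<bar>)) ^ 4) = normal_weight c"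
    using distributed_integral[OF D, of "\<lambda>x. (\<bar>x\<bar> * exp (c * \<bar>x\<bar>)) ^ 4"] by (simp add: normal_weight_def)
  have le: "(\<bar>X \<omega>\<bar> * exp (c * \<bar>X \<omega>\<bar>)) ^ 4 \<le> h\<^sup>2 * (\<bar>Z \<omega>\<bar> * exp (c * \<bar>Z \<omega>\<bar>)) ^ 4" for \<omega>
  proof -
    have X: "\<bar>X \<omega>\<bar> = sqrt h * \<bar>Z \<omega>\<bar>" using h by (simp add: Z_def abs_mult)
    have "\<bar>X \<omega>\<bar> \<le> \<bar>Z \<omega>\<bar>" unfolding X using h by (intro mult_left_le_one_le) auto
    then have "\<bar>X \<omega>\<bar> * exp (c * \<bar>X \<omega>\<bar>) \<le> sqrt h * \<bar>Z \<omega>\<bar> * exp (c * \<bar>Z \<omega>\<bar>)"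
      using X c h by (intro mult_mono) (auto intro: mult_left_mono)
    then have "(\<bar>X \<omega>\<bar> * exp (c * \<bar>X \<omega>\<bar>)) ^ 4 \<le> (sqrt h * \<bar>Z \<omega>\<bar> * exp (c * \<bar>Z \<omega>\<bar>)) ^ 4"
      by (intro power_mono) auto
    also have "\<dots> = (sqrt h) ^ 4 * (\<bar>Z \<omega>\<bar> * exp (c * \<bar>Z \<omega>\<bar>)) ^ 4"
      by (simp add: power_mult_distrib)
    also have "(sqrt h) ^ 4 = h\<^sup>2" using h by (simp add: power4_eq_xxxx power2_eq_square)
    finally show ?thesis .
  qed
  show int: "integrable M (\<lambda>\<omega>. (\<bar>X \<omega>\<bar> * exp (c * \<bar>X \<omega>\<bar>)) ^ 4)"
    by (rule Bochner_Integration.integrable_bound[OF integrable_mult_right[OF intZ, of "h\<^sup>2"]])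
       (use m le in \<open>auto simp: abs_mult\<close>)
  have "expectation (\<lambda>\<omega>. (\<bar>X \<omega>\<bar> * exp (c * \<bar>X \<omega>\<bar>)) ^ 4) \<le> expectation (\<lambda>\<omega>. h\<^sup>2 * (\<bar>Z \<omega>\<bar> * exp (c * \<bar>Z \<omega>\<bar>)) ^ 4)"
    using le intZ int by (intro integral_mono) auto
  then show "expectation (\<lambda>\<omega>. (\<bar>X \<omega>\<bar> * exp (c * \<bar>X \<omega>\<bar>)) ^ 4) \<le> h\<^sup>2 * normal_weight c"
    by (simp add: EZ)
qed

section \<open>Independence of the past from the next step\<close>

lemma drawdown_cong: "(\<And>i. i < k \<Longrightarrow> x i = y i) \<Longrightarrow> drawdown x k = drawdown y k"
  by (induction k) auto

lemma borel_measurable_drawdown: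
  "(\<And>i. i < k \<Longrightarrow> (\<lambda>\<omega>. f \<omega> i) \<in> borel_measurable N) \<Longrightarrow> (\<lambda>\<omega>. drawdown (f \<omega>) k) \<in> borel_measurable N"
  by (induction k) auto

lemma borel_measurable_osc:
  "(\<And>i. i < k \<Longrightarrow> (\<lambda>\<omega>. f \<omega> i) \<in> borel_measurable N) \<Longrightarrow> (\<lambda>\<omega>. osc (f \<omega>) k) \<in> borel_measurable N"
  unfolding osc_def by (intro borel_measurable_add borel_measurable_drawdown) auto

text \<open>\<open>F_cong\<close> expresses that \<open>F\<close> reads only the first
  \<open>k\<close> coordinates, so it can be evaluated on the whole sequence although independence
  is available for restrictions.\<close>

lemma (in prob_space) indep_var_past_present:
  fixes \<xi> :: "nat \<Rightarrow> 'a \<Rightarrow> real"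
  assumes "indep_vars (\<lambda>_. borel) \<xi> {..<N}" "k < N"
    and F: "F \<in> borel_measurable (PiM {..<k} (\<lambda>_. borel))" and G: "G \<in> borel_measurable borel"
    and F_cong: "\<And>x. F (restrict x {..<k}) = F x"
  shows "indep_var borel (\<lambda>\<omega>. F (\<lambda>i. \<xi> i \<omega>)) borel (\<lambda>\<omega>. G (\<xi> k \<omega>))"
proof -
  have "indep_var borel (F \<circ> (\<lambda>\<omega>. \<lambda>i\<in>{..<k}. \<xi> i \<omega>)) borel ((\<lambda>x. G (x k)) \<circ> (\<lambda>\<omega>. \<lambda>i\<in>{k}. \<xi> i \<omega>))"
  proof (rule indep_var_compose[OF indep_var_restrict[OF assms(1), of "{..<k}" "{k}"]])
    show "(\<lambda>x. G (x k)) \<in> borel_measurable (PiM {k} (\<lambda>_. borel))"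
      by (rule measurable_compose[OF _ G], rule measurable_component_singleton) simp
  qed (use assms in auto)
  then show ?thesis by (simp add: comp_def F_cong)
qed

text \<open>The addition theorems separate past and present: the two \<open>cosh\<close> terms
  become \<open>P\<close> times \<open>cosh (\<mu> * \<xi> k)\<close> plus \<open>Q\<close> times
  \<open>sinh (\<mu> * \<xi> k)\<close>. The \<open>sinh\<close> has mean 0 by symmetry, and the
  mean of the \<open>cosh\<close> is the reciprocal of \<open>q\<close>. The indicator keeps both
  distances at most 1, so \<open>P\<close> and \<open>Q\<close> are bounded.\<close>

lemma (in prob_space) osc_martingale_increment:
  fixes \<mu> :: complex and \<xi> :: "nat \<Rightarrow> 'a \<Rightarrow> real"
  assumes indep: "indep_vars (\<lambda>_. borel) \<xi> {..<N}" and k: "k < N"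
    and X: "distributed M lborel (\<xi> k) (normal_density 0 (sqrt h))" and h: "0 < h"
  defines "Y \<equiv> \<lambda>\<omega>. drawdown (\<lambda>i. \<xi> i \<omega>) k" and "V \<equiv> \<lambda>\<omega>. drawdown (\<lambda>i. - \<xi> i \<omega>) k"
  defines "A \<equiv> \<lambda>\<omega>. of_bool (osc (\<lambda>i. \<xi> i \<omega>) k \<le> 1) :: complex"
  defines "q \<equiv> exp (- (\<mu>\<^sup>2 * h / 2))"
  defines "m \<equiv> \<lambda>\<omega>. A \<omega> * (q ^ Suc k * (cosh (\<mu> * (Y \<omega> - \<xi> k \<omega>)) + cosh (\<mu> * (V \<omega> + \<xi> k \<omega>))) -
                    q ^ k * (cosh (\<mu> * Y \<omega>) + cosh (\<mu> * V \<omega>)))"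
  shows "integrable M m" "expectation m = 0"
proof -
  define FA where "FA = (\<lambda>x. of_bool (osc x k \<le> 1) :: complex)"
  define P where "P = (\<lambda>x. FA x * (cosh (\<mu> * drawdown x k) + cosh (\<mu> * drawdown (\<lambda>i. - x i) k)))"
  define Q where "Q = (\<lambda>x. FA x * (sinh (\<mu> * drawdown (\<lambda>i. - x i) k) - sinh (\<mu> * drawdown x k)))"
  have comp: "(\<lambda>x. x i) \<in> borel_measurable (PiM {..<k} (\<lambda>_. borel :: real measure))" if "i < k" for i
    using that by (intro measurable_component_singleton) auto
  have [measurable]: "(\<lambda>x. drawdown x k) \<in> borel_measurable (PiM {..<k} (\<lambda>_. borel))"
      "(\<lambda>x. drawdown (\<lambda>i. - x i) k) \<in> borel_measurable (PiM {..<k} (\<lambda>_. borel))"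
      "(\<lambda>x. osc x k) \<in> borel_measurable (PiM {..<k} (\<lambda>_. borel))"
    by (auto intro!: borel_measurable_drawdown borel_measurable_osc comp)
  have [measurable]: "(\<lambda>z::complex. cosh z) \<in> borel_measurable borel" "(\<lambda>z::complex. sinh z) \<in> borel_measurable borel"
    by (auto intro!: borel_measurable_continuous_onI continuous_intros)
  have [measurable]: "P \<in> borel_measurable (PiM {..<k} (\<lambda>_. borel))" "Q \<in> borel_measurable (PiM {..<k} (\<lambda>_. borel))"
    unfolding P_def Q_def FA_def by measurable
  have cong: "drawdown (restrict x {..<k}) k = drawdown x k" 
    "drawdown (\<lambda>i. - restrict x {..<k} i) k = drawdown (\<lambda>i. - x i) k" for x
    by (auto intro: drawdown_cong)
  have P_cong: "P (restrict x {..<k}) = P x" and Q_cong: "Q (restrict x {..<k}) = Q x" for x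
    by (simp_all only: P_def Q_def FA_def osc_def cong)
  have bnd: "norm (P x) \<le> 2 * exp (norm \<mu>)" "norm (Q x) \<le> 2 * exp (norm \<mu>)" for x
  proof -
    have "norm (P x) \<le> 2 * exp (norm \<mu>) \<and> norm (Q x) \<le> 2 * exp (norm \<mu>)"
    proof (cases "osc x k \<le> 1")
      case True
      have 1: "norm (cosh (\<mu> * complex_of_real y)) \<le> exp (norm \<mu>)" "norm (sinh (\<mu> * complex_of_real y)) \<le> exp (norm \<mu>)"
        if "0 \<le> y" "y \<le> 1" for y
      proof -
        have "norm (\<mu> * complex_of_real y) \<le> norm \<mu>" using that by (simp add: norm_mult mult_left_le)
        then show "norm (cosh (\<mu> * complex_of_real y)) \<le> exp (norm \<mu>)" "norm (sinh (\<mu> * complex_of_real y)) \<le> exp (norm \<mu>)"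
          using norm_sinh_cosh_le by (meson exp_le_cancel_iff order_trans)+
      qed
      have "0 \<le> drawdown x k" "drawdown x k \<le> 1" "0 \<le> drawdown (\<lambda>i. - x i) k" "drawdown (\<lambda>i. - x i) k \<le> 1"
        using True drawdown_nonneg[of x k] drawdown_nonneg[of "\<lambda>i. - x i" k] by (auto simp: osc_def)
      note b = 1[OF this(1,2)] 1[OF this(3,4)]
      have "norm (sinh (\<mu> * drawdown (\<lambda>i. - x i) k) - sinh (\<mu> * drawdown x k)) \<le> 2 * exp (norm \<mu>)"
        by (rule order_trans[OF norm_triangle_ineq4]) (use b in linarith)
      then show ?thesis
        using True norm_triangle_mono[OF b(1) b(3)] by (auto simp: P_def Q_def FA_def)
    qed (auto simp: P_def Q_def FA_def)
    then show "norm (P x) \<le> 2 * exp (norm \<mu>)" "norm (Q x) \<le> 2 * exp (norm \<mu>)" by auto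
  qed
  have \<xi>m: "\<xi> i \<in> borel_measurable M" if "i < N" for i
    using indep that by (auto simp: indep_vars_def)
  have restr: "(\<lambda>\<omega>. \<lambda>i\<in>{..<k}. \<xi> i \<omega>) \<in> measurable M (PiM {..<k} (\<lambda>_. borel))"
    using \<xi>m k by (intro measurable_restrict) auto
  have meas: "(\<lambda>\<omega>. P (\<lambda>i. \<xi> i \<omega>)) \<in> borel_measurable M" "(\<lambda>\<omega>. Q (\<lambda>i. \<xi> i \<omega>)) \<in> borel_measurable M"
    using measurable_compose[OF restr, of P borel] measurable_compose[OF restr, of Q borel] by (auto simp: P_cong Q_cong)
  have intP: "integrable M (\<lambda>\<omega>. P (\<lambda>i. \<xi> i \<omega>))" and intQ: "integrable M (\<lambda>\<omega>. Q (\<lambda>i. \<xi> i \<omega>))"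
    by (rule integrable_const_bound[of _ "2 * exp (norm \<mu>)"]; use meas bnd in auto)+
  have s: "0 < sqrt h" using h by simp
  note CS = normal_cosh_sinh[OF X s, of \<mu>]
  have iPC: "indep_var borel (\<lambda>\<omega>. P (\<lambda>i. \<xi> i \<omega>)) borel (\<lambda>\<omega>. cosh (\<mu> * \<xi> k \<omega>))"
    by (rule indep_var_past_present[where F = P and G = "\<lambda>x. cosh (\<mu> * complex_of_real x)", OF indep k _ _ P_cong]; measurable)
  have iQS: "indep_var borel (\<lambda>\<omega>. Q (\<lambda>i. \<xi> i \<omega>)) borel (\<lambda>\<omega>. sinh (\<mu> * \<xi> k \<omega>))"
    by (rule indep_var_past_present[where F = Q and G = "\<lambda>x. sinh (\<mu> * complex_of_real x)", OF indep k _ _ Q_cong]; measurable)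
  have m_eq: "m = (\<lambda>\<omega>. q ^ Suc k * (P (\<lambda>i. \<xi> i \<omega>) * cosh (\<mu> * \<xi> k \<omega>) + Q (\<lambda>i. \<xi> i \<omega>) * sinh (\<mu> * \<xi> k \<omega>)) - q ^ k * P (\<lambda>i. \<xi> i \<omega>))"
    by (rule ext) (simp add: m_def P_def Q_def FA_def A_def Y_def V_def algebra_simps cosh_diff cosh_add)
  have iq: "q * exp (\<mu>\<^sup>2 * h / 2) = 1" unfolding q_def exp_add[symmetric] by simp
  show "integrable M m"
    unfolding m_eq
    by (intro Bochner_Integration.integrable_diff integrable_mult_right Bochner_Integration.integrable_add
        indep_var_integrable[OF iPC intP CS(1)] indep_var_integrable[OF iQS intQ CS(2)] intP)
  have "expectation m = q ^ Suc k * (expectation (\<lambda>\<omega>. P (\<lambda>i. \<xi> i \<omega>)) * exp (\<mu>\<^sup>2 * h / 2)) - q ^ k * expectation (\<lambda>\<omega>. P (\<lambda>i. \<xi> i \<omega>))"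
    unfolding m_eq
    using indep_var_integrable[OF iPC intP CS(1)] indep_var_integrable[OF iQS intQ CS(2)] intP
      indep_var_lebesgue_integral[OF iPC intP CS(1)] indep_var_lebesgue_integral[OF iQS intQ CS(2)] CS(3,4) h
    by simp
  also have "\<dots> = q ^ k * expectation (\<lambda>\<omega>. P (\<lambda>i. \<xi> i \<omega>)) * (q * exp (\<mu>\<^sup>2 * h / 2) - 1)"
    by (simp add: algebra_simps)
  finally show "expectation m = 0" by (simp add: iq)
qed

text \<open>\<open>L\<close> is \<open>q\<close> to the power of the first exceedance index if that
  is at most \<open>N\<close>, and 0 otherwise: a discrete version of the discounted escape time.
  Integrating the pathwise bound kills the martingale increments and leaves the cost of stopping at
  the horizon, the \<epsilon> terms and the fourth moments.\<close>

lemma (in prob_space) gaussian_walk_osc_transform: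
  fixes \<mu> :: complex and \<xi> :: "nat \<Rightarrow> 'a \<Rightarrow> real"
  assumes indep: "indep_vars (\<lambda>_. borel) \<xi> {..<N}"
    and X: "\<And>k. k < N \<Longrightarrow> distributed M lborel (\<xi> k) (normal_density 0 (sqrt h))" and h: "0 < h" "h \<le> 1"
    and \<mu>: "0 \<le> Re (\<mu>\<^sup>2)" and e: "0 < \<epsilon>" "\<epsilon> \<le> 1"
  defines "q \<equiv> exp (- (\<mu>\<^sup>2 * h / 2))"
  defines "L \<equiv> \<lambda>\<omega>. \<Sum>k<N. q ^ Suc k * of_bool (osc (\<lambda>i. \<xi> i \<omega>) k \<le> 1 \<and> osc (\<lambda>i. \<xi> i \<omega>) (Suc k) > 1)"
  shows "norm (2 - (1 + cosh \<mu>) * expectation L) \<le>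
    2 * exp (norm \<mu>) * exp (- (Re (\<mu>\<^sup>2) * (real N * h) / 2)) +
    (1 + norm \<mu>)\<^sup>2 * exp (norm \<mu>) * (3 * \<epsilon> + 2 / \<epsilon> ^ 3 * (real N * h\<^sup>2 * normal_weight (norm \<mu>)))"
proof -
  define m where "m = (\<lambda>k \<omega>. of_bool (osc (\<lambda>i. \<xi> i \<omega>) k \<le> 1) * (q ^ Suc k * (cosh (\<mu> * (drawdown (\<lambda>i. \<xi> i \<omega>) k - \<xi> k \<omega>)) + 
     cosh (\<mu> * (drawdown (\<lambda>i. - \<xi> i \<omega>) k + \<xi> k \<omega>))) -
       q ^ k * (cosh (\<mu> * drawdown (\<lambda>i. \<xi> i \<omega>) k) + cosh (\<mu> * drawdown (\<lambda>i. - \<xi> i \<omega>) k))))"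
  define g where "g = (\<lambda>k \<omega>. (\<bar>\<xi> k \<omega>\<bar> * exp (norm \<mu> * \<bar>\<xi> k \<omega>\<bar>)) ^ 4)"
  define U where "U = (\<lambda>\<omega>. 2 - (1 + cosh \<mu>) * L \<omega> + (\<Sum>k<N. m k \<omega>))"
  define RHS where "RHS = (\<lambda>\<omega>. 2 * exp (norm \<mu>) * norm q ^ N + (1 + norm \<mu>)\<^sup>2 * exp (norm \<mu>) *
       (3 * \<epsilon> + 2 / \<epsilon> ^ 3 * (\<Sum>k<N. g k \<omega>)))"
  have nq: "norm q = exp (- (Re (\<mu>\<^sup>2) * h / 2))" by (simp add: q_def del: Re_power2)
  then have q: "norm q \<le> 1" using \<mu> h by (simp del: Re_power2)
  have bnd: "norm (U \<omega>) \<le> RHS \<omega>" for \<omega>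
    unfolding U_def RHS_def L_def m_def g_def by (rule osc_martingale_bound[OF q e])
  have \<xi>m: "\<xi> i \<in> borel_measurable M" if "i < N" for i
    using indep that by (auto simp: indep_vars_def)
  have Lm: "L \<in> borel_measurable M" unfolding L_def
  proof (intro borel_measurable_sum borel_measurable_times borel_measurable_const)
    fix k assume "k \<in> {..<N}"
    then have [measurable]: "(\<lambda>\<omega>. osc (\<lambda>i. \<xi> i \<omega>) k) \<in> borel_measurable M"
      "(\<lambda>\<omega>. osc (\<lambda>i. \<xi> i \<omega>) (Suc k)) \<in> borel_measurable M"
      by (auto intro!: borel_measurable_osc \<xi>m)
    show "(\<lambda>\<omega>. of_bool (osc (\<lambda>i. \<xi> i \<omega>) k \<le> 1 \<and> osc (\<lambda>i. \<xi> i \<omega>) (Suc k) > 1) :: complex) \<in> borel_measurable M"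
      by measurable
  qed
  have Lint: "integrable M L"
  proof (rule integrable_const_bound[of _ "real N"])
    have "norm (L \<omega>) \<le> (\<Sum>k<N. 1)" for \<omega>
      unfolding L_def
    proof (rule sum_norm_le)
      fix k
      have "norm (q ^ Suc k) \<le> 1" unfolding norm_power using q by (intro power_le_one) auto
      then show "norm (q ^ Suc k * of_bool (osc (\<lambda>i. \<xi> i \<omega>) k \<le> 1 \<and> osc (\<lambda>i. \<xi> i \<omega>) (Suc k) > 1)) \<le> 1"
        by (auto simp del: power_Suc)
    qed
    then show "AE \<omega> in M. norm (L \<omega>) \<le> real N" by simp
  qed (rule Lm)
  have mint: "integrable M (m k)" "expectation (m k) = 0" if "k < N" for k
    unfolding m_def q_def using osc_martingale_increment[OF indep that X[OF that] h(1), of \<mu>] by auto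
  have gint: "integrable M (g k)" "expectation (g k) \<le> h\<^sup>2 * normal_weight (norm \<mu>)" if "k < N" for k
    unfolding g_def using normal_exp_abs_moment[OF X[OF that] h] by auto
  have Uint: "integrable M U" unfolding U_def
    by (intro Bochner_Integration.integrable_add Bochner_Integration.integrable_diff integrable_const
        integrable_mult_right Lint Bochner_Integration.integrable_sum mint(1)) auto
  have Rint: "integrable M RHS" unfolding RHS_def
    by (intro Bochner_Integration.integrable_add integrable_const
        integrable_mult_right Bochner_Integration.integrable_sum gint(1)) auto
  have "expectation U = 2 - (1 + cosh \<mu>) * expectation L"
  proof -
    have 1: "integrable M (\<lambda>\<omega>. (1 + cosh \<mu>) * L \<omega>)" "expectation (\<lambda>\<omega>. (1 + cosh \<mu>) * L \<omega>) = (1 + cosh \<mu>) * expectation L"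
      by (rule integrable_mult_right[OF Lint], rule integral_mult_right_zero)
    have 2: "integrable M (\<lambda>\<omega>. \<Sum>k<N. m k \<omega>)" "expectation (\<lambda>\<omega>. \<Sum>k<N. m k \<omega>) = 0"
      using mint by (auto simp: Bochner_Integration.integral_sum)
    have 3: "integrable M (\<lambda>\<omega>. 2 :: complex)" by simp
    show ?thesis
      unfolding U_def
      by (subst Bochner_Integration.integral_add[OF Bochner_Integration.integrable_diff[OF 3 1(1)] 2(1)],
          subst Bochner_Integration.integral_diff[OF 3 1(1)]) (simp add: 1 2 prob_space)
  qed
  then have "norm (2 - (1 + cosh \<mu>) * expectation L) \<le> expectation (\<lambda>\<omega>. norm (U \<omega>))"
    by (metis integral_norm_bound)
  also have "\<dots> \<le> expectation RHS"
    using Uint Rint bnd by (intro integral_mono) auto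
  also have "\<dots> = 2 * exp (norm \<mu>) * norm q ^ N + (1 + norm \<mu>)\<^sup>2 * exp (norm \<mu>) *
       (3 * \<epsilon> + 2 / \<epsilon> ^ 3 * (\<Sum>k<N. expectation (g k)))"
  proof -
    have affine: "expectation (\<lambda>\<omega>. a + b * (d + e * S \<omega>)) = a + b * (d + e * expectation S)"
      if "integrable M S" for a b d e :: real and S
      using that by (simp add: prob_space)
    show ?thesis
      unfolding RHS_def using gint
      by (subst affine) (auto simp: Bochner_Integration.integral_sum)
  qed
  also have "\<dots> \<le> 2 * exp (norm \<mu>) * norm q ^ N + (1 + norm \<mu>)\<^sup>2 * exp (norm \<mu>) *
       (3 * \<epsilon> + 2 / \<epsilon> ^ 3 * (\<Sum>k<N. h\<^sup>2 * normal_weight (norm \<mu>)))"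
    using gint e by (intro add_left_mono mult_left_mono sum_mono) auto
  also have "norm q ^ N = exp (- (Re (\<mu>\<^sup>2) * (real N * h) / 2))"
    unfolding nq exp_of_nat_mult[symmetric] by (rule arg_cong[where f = exp]) (simp add: algebra_simps del: Re_power2)
  finally show ?thesis by (simp add: mult.assoc)
qed

subsection \<open>Escape times of continuous paths\<close>

text \<open>Restricting to rational times makes the escape time a measurable function of the path; on
  continuous paths nothing is lost.\<close>

definition escape_time :: "(real \<Rightarrow> 'b::metric_space) \<Rightarrow> ennreal" where
  "escape_time w = (INF (p, q) \<in> (\<rat> \<inter> {0..}) \<times> (\<rat> \<inter> {0..}).
     if dist (w p) (w q) > 1 then ennreal (max p q) else \<top>)"

lemma dist_gt_stable:
  fixes w :: "real \<Rightarrow> 'b::metric_space"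
  assumes w: "continuous_on {0..} w" and s: "0 \<le> s" "0 \<le> s'" "dist (w s) (w s') > r"
  obtains \<delta> where "0 < \<delta>" "\<And>p q. \<lbrakk>0 \<le> p; 0 \<le> q; \<bar>p - s\<bar> < \<delta>; \<bar>q - s'\<bar> < \<delta>\<rbrakk> \<Longrightarrow> dist (w p) (w q) > r"
proof -
  define e where "e = (dist (w s) (w s') - r) / 2"
  have e: "0 < e" using s by (simp add: e_def)
  obtain d where d: "0 < d" "\<And>p. 0 \<le> p \<Longrightarrow> \<bar>p - s\<bar> < d \<Longrightarrow> dist (w p) (w s) < e"
    using w s(1) e unfolding continuous_on_iff dist_real_def by (metis atLeast_iff)
  obtain d' where d': "0 < d'" "\<And>p. 0 \<le> p \<Longrightarrow> \<bar>p - s'\<bar> < d' \<Longrightarrow> dist (w p) (w s') < e"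
    using w s(2) e unfolding continuous_on_iff dist_real_def by (metis atLeast_iff)
  show ?thesis
  proof (rule that[of "min d d'"])
    fix p q assume pq: "0 \<le> p" "0 \<le> q" "\<bar>p - s\<bar> < min d d'" "\<bar>q - s'\<bar> < min d d'"
    have "dist (w s) (w s') \<le> dist (w p) (w s) + dist (w p) (w q) + dist (w q) (w s')"
      by (smt (verit) dist_triangle dist_commute)
    moreover have "dist (w p) (w s) < e" "dist (w q) (w s') < e" using pq d(2)[of p] d'(2)[of q] by auto
    ultimately show "dist (w p) (w q) > r" unfolding e_def by argo
  qed (use d d' in auto)
qed

lemma dist_gt_rational:
  fixes w :: "real \<Rightarrow> 'b::metric_space"
  assumes w: "continuous_on {0..} w" and s: "0 \<le> s" "s < t" "0 \<le> s'" "s' < t" "dist (w s) (w s') > r"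
  shows "\<exists>p\<in>\<rat> \<inter> {0..<t}. \<exists>q\<in>\<rat> \<inter> {0..<t}. dist (w p) (w q) > r"
proof -
  obtain \<delta> where \<delta>: "0 < \<delta>" "\<And>p q. \<lbrakk>0 \<le> p; 0 \<le> q; \<bar>p - s\<bar> < \<delta>; \<bar>q - s'\<bar> < \<delta>\<rbrakk> \<Longrightarrow> dist (w p) (w q) > r"
    using dist_gt_stable[OF w s(1,3,5)] by auto
  obtain p where p: "p \<in> \<rat>" "s < p" "p < min t (s + \<delta>)"
    using Rats_dense_in_real[of s "min t (s + \<delta>)"] s \<delta> by auto
  obtain q where q: "q \<in> \<rat>" "s' < q" "q < min t (s' + \<delta>)"
    using Rats_dense_in_real[of s' "min t (s' + \<delta>)"] s \<delta> by auto
  have "dist (w p) (w q) > r" using p q s by (intro \<delta>) auto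
  then show ?thesis using p q s by (intro bexI[of _ p] bexI[of _ q]) auto
qed

text \<open>The times on the right are strictly below \<open>t\<close>, which leaves room to move
  them to rational times without losing the distance.\<close>

lemma escape_time_less_iff:
  fixes w :: "real \<Rightarrow> 'b::metric_space"
  assumes w: "continuous_on {0..} w"
  shows "escape_time w < ennreal t \<longleftrightarrow>
    (\<exists>s s'. 0 \<le> s \<and> s < t \<and> 0 \<le> s' \<and> s' < t \<and> dist (w s) (w s') > 1)"
proof
  assume "escape_time w < ennreal t"
  then obtain p q where pq: "p \<in> \<rat> \<inter> {0..}" "q \<in> \<rat> \<inter> {0..}"
    "(if dist (w p) (w q) > 1 then ennreal (max p q) else \<top>) < ennreal t"
    unfolding escape_time_def INF_less_iff by auto
  then have "dist (w p) (w q) > 1" "max p q < t"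
    by (auto split: if_splits simp: ennreal_less_iff)
  then show "\<exists>s s'. 0 \<le> s \<and> s < t \<and> 0 \<le> s' \<and> s' < t \<and> dist (w s) (w s') > 1"
    using pq by auto
next
  assume "\<exists>s s'. 0 \<le> s \<and> s < t \<and> 0 \<le> s' \<and> s' < t \<and> dist (w s) (w s') > 1"
  then obtain p q where pq: "p \<in> \<rat> \<inter> {0..<t}" "q \<in> \<rat> \<inter> {0..<t}" "dist (w p) (w q) > 1"
    using dist_gt_rational[OF w] by blast
  then have "escape_time w \<le> ennreal (max p q)"
    unfolding escape_time_def by (intro INF_lower2[of "(p, q)"]) auto
  also have "\<dots> < ennreal t" using pq by (simp add: ennreal_less_iff le_max_iff_disj)
  finally show "escape_time w < ennreal t" .
qed

lemma le_ennrealI: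
  assumes "0 \<le> a" "\<And>t. a < t \<Longrightarrow> x < ennreal t"
  shows "x \<le> ennreal a"
proof (rule ccontr)
  assume "\<not> x \<le> ennreal a"
  then obtain r where r: "ennreal a < r" "r < x" using dense by (meson not_le)
  then obtain t where "r = ennreal t" "0 \<le> t" by (cases r) auto
  then have "x < ennreal t" using r assms by (simp add: ennreal_less_iff)
  then show False using r \<open>r = ennreal t\<close> by auto
qed

text \<open>Stated for any \<open>f\<close> that exceeds 1 exactly when two path points are more
  than 1 apart, so that it covers the range of a coordinate and the diameter of the hull
  alike.\<close>

lemma exceedance_time_eq_escape_time:
  fixes w :: "real \<Rightarrow> 'b::metric_space"
  assumes w: "continuous_on {0..} w"
    and f: "\<And>t. 0 \<le> t \<Longrightarrow> f t > 1 \<longleftrightarrow> (\<exists>s\<in>{0..t}. \<exists>s'\<in>{0..t}. dist (w s) (w s') > 1)"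
  shows "exceedance_time f = escape_time w"
proof (rule antisym)
  show "exceedance_time f \<le> escape_time w"
    unfolding escape_time_def
  proof (rule INF_greatest, clarify)
    fix p q :: real assume pq: "p \<in> \<rat>" "0 \<le> p" "q \<in> \<rat>" "0 \<le> q"
    show "exceedance_time f \<le> (if 1 < dist (w p) (w q) then ennreal (max p q) else \<top>)"
    proof (cases "dist (w p) (w q) > 1")
      case True
      then have "\<exists>s\<in>{0..max p q}. \<exists>s'\<in>{0..max p q}. dist (w s) (w s') > 1" using pq
        by (intro bexI[of _ p] bexI[of _ q]) auto
      then have "f (max p q) > 1" using f[of "max p q"] pq by auto
      then show ?thesis using True pq unfolding exceedance_time_def
        by (auto intro!: Inf_lower simp: le_max_iff_disj)
    qed simp
  qed
  show "escape_time w \<le> exceedance_time f"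
    unfolding exceedance_time_def
  proof (rule Inf_greatest, clarify)
    fix t :: real assume t: "0 \<le> t" "f t > 1"
    show "escape_time w \<le> ennreal t"
    proof (rule le_ennrealI[OF t(1)])
      fix t' assume "t < t'"
      then show "escape_time w < ennreal t'"
        unfolding escape_time_less_iff[OF w] using f[OF t(1)] t(2)
        by auto (meson order_le_less_trans)
    qed
  qed
qed

lemma range_process_gt_iff:
  assumes b: "continuous_on {0..} b" and t: "0 \<le> t"
  shows "range_process b t > a \<longleftrightarrow> (\<exists>s\<in>{0..t}. \<exists>s'\<in>{0..t}. b s - b s' > a)"
proof -
  have cont: "continuous_on {0..t} b" using b by (rule continuous_on_subset) auto
  obtain x where x: "x \<in> {0..t}" "\<And>y. y \<in> {0..t} \<Longrightarrow> b y \<le> b x"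
    using continuous_attains_sup[OF _ _ cont] t by (auto; blast)
  obtain y where y: "y \<in> {0..t}" "\<And>z. z \<in> {0..t} \<Longrightarrow> b y \<le> b z"
    using continuous_attains_inf[OF _ _ cont] t by (auto; blast)
  have "(SUP s\<in>{0..t}. b s) = b x" using x by (intro cSup_eq_maximum) auto
  moreover have "(INF s\<in>{0..t}. b s) = b y" using y by (intro cInf_eq_minimum) auto
  ultimately have R: "range_process b t = b x - b y" by (simp add: range_process_def)
  show ?thesis
  proof
    assume "\<exists>s\<in>{0..t}. \<exists>s'\<in>{0..t}. b s - b s' > a"
    then obtain s s' where "s\<in>{0..t}" "s'\<in>{0..t}" "b s - b s' > a" by auto
    then show "range_process b t > a" unfolding R using x(2)[of s] y(2)[of s'] by linarith
  next
    assume "range_process b t > a"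
    then have "b x - b y > a" by (simp add: R)
    then show "\<exists>s\<in>{0..t}. \<exists>s'\<in>{0..t}. b s - b s' > a" using x(1) y(1) by blast
  qed
qed

lemma exceedance_time_range_process:
  assumes b: "continuous_on {0..} b"
  shows "exceedance_time (range_process b) = escape_time b"
proof (rule exceedance_time_eq_escape_time[OF b])
  fix t :: real assume t: "0 \<le> t"
  have "(\<exists>s\<in>{0..t}. \<exists>s'\<in>{0..t}. b s - b s' > 1) \<longleftrightarrow> (\<exists>s\<in>{0..t}. \<exists>s'\<in>{0..t}. dist (b s) (b s') > 1)"
    unfolding dist_real_def by (smt (verit))
  then show "(1 < range_process b t) = (\<exists>s\<in>{0..t}. \<exists>s'\<in>{0..t}. 1 < dist (b s) (b s'))"
    using range_process_gt_iff[OF b t] by simp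
qed

text \<open>Taking the hull does not enlarge the diameter because balls are convex: a ball around a
  point that contains the set contains its hull. The argument is applied twice, to one of the two
  points at a time.\<close>

lemma diameter_convex_hull_gt_iff:
  fixes S :: "'b::euclidean_space set"
  assumes "bounded S" "S \<noteq> {}" "0 \<le> a"
  shows "diameter (convex hull S) > a \<longleftrightarrow> (\<exists>x\<in>S. \<exists>y\<in>S. dist x y > a)"
proof
  assume "\<exists>x\<in>S. \<exists>y\<in>S. dist x y > a"
  then obtain x y where xy: "x \<in> convex hull S" "y \<in> convex hull S" "dist x y > a"
    by (meson hull_inc)
  have "dist x y \<le> diameter (convex hull S)"
    using xy assms by (intro diameter_bounded_bound bounded_convex_hull)
  then show "diameter (convex hull S) > a" using xy by simp
next
  assume gt: "diameter (convex hull S) > a"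
  show "\<exists>x\<in>S. \<exists>y\<in>S. dist x y > a"
  proof (rule ccontr)
    assume "\<not> (\<exists>x\<in>S. \<exists>y\<in>S. dist x y > a)"
    then have S: "dist x y \<le> a" if "x \<in> S" "y \<in> S" for x y using that by force
    have 1: "dist x y \<le> a" if "x \<in> S" "y \<in> convex hull S" for x y
    proof -
      have "convex hull S \<subseteq> cball x a" using S that by (intro hull_minimal) auto
      then show ?thesis using that by auto
    qed
    have 2: "dist x y \<le> a" if "x \<in> convex hull S" "y \<in> convex hull S" for x y
    proof -
      have "convex hull S \<subseteq> cball x a" using 1 that by (intro hull_minimal) (auto simp: dist_commute)
      then show ?thesis using that by auto
    qed
    have "diameter (convex hull S) \<le> a" using assms 2 by (intro diameter_le) (auto simp: dist_norm)
    then show False using gt by simp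
  qed
qed

lemma exceedance_time_diameter_process:
  assumes w: "continuous_on {0..} w"
  shows "exceedance_time (diameter_process w) = escape_time w"
proof (rule exceedance_time_eq_escape_time[OF w])
  fix t :: real assume t: "0 \<le> t"
  have "continuous_on {0..t} w" using w by (rule continuous_on_subset) auto
  then have "bounded (w ` {0..t})" by (intro compact_imp_bounded compact_continuous_image) auto
  then show "(1 < diameter_process w t) = (\<exists>s\<in>{0..t}. \<exists>s'\<in>{0..t}. 1 < dist (w s) (w s'))"
    unfolding diameter_process_def hull_process_def using t
    by (subst diameter_convex_hull_gt_iff) auto
qed

lemma escape_time_mono:
  assumes "\<And>s s'. \<lbrakk>0 \<le> s; 0 \<le> s'; dist (v s) (v s') > 1\<rbrakk> \<Longrightarrow> dist (w s) (w s') > 1"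
  shows "escape_time w \<le> escape_time v"
  unfolding escape_time_def
proof (rule INF_mono, clarify)
  fix p q :: real assume "p \<in> \<rat>" "0 \<le> p" "q \<in> \<rat>" "0 \<le> q"
  then show "\<exists>n\<in>(\<rat> \<inter> {0..}) \<times> (\<rat> \<inter> {0..}).
      (case n of (p, q) \<Rightarrow> if 1 < dist (w p) (w q) then ennreal (max p q) else \<top>)
        \<le> (if 1 < dist (v p) (v q) then ennreal (max p q) else \<top>)"
    using assms[of p q] by (intro bexI[of _ "(p, q)"]) auto
qed

lemma borel_measurable_escape_time:
  fixes W :: "real \<Rightarrow> 'a \<Rightarrow> 'b::{metric_space, second_countable_topology}"
  assumes "\<And>p. p \<in> \<rat> \<Longrightarrow> 0 \<le> p \<Longrightarrow> W p \<in> borel_measurable N"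
  shows "(\<lambda>\<omega>. escape_time (\<lambda>t. W t \<omega>)) \<in> borel_measurable N"
  unfolding escape_time_def
proof (rule borel_measurable_INF)
  show "countable ((\<rat> \<inter> {0..}) \<times> (\<rat> \<inter> {0..}) :: (real \<times> real) set)"
    by (intro countable_SIGMA countable_Int1 countable_rat)
  fix x :: "real \<times> real" assume "x \<in> (\<rat> \<inter> {0..}) \<times> (\<rat> \<inter> {0..})"
  then obtain p q where x: "x = (p, q)" "p \<in> \<rat>" "0 \<le> p" "q \<in> \<rat>" "0 \<le> q" by auto
  have [measurable]: "W p \<in> borel_measurable N" "W q \<in> borel_measurable N" using assms x by auto
  show "(\<lambda>\<omega>. case x of (p, q) \<Rightarrow> if 1 < dist (W p \<omega>) (W q \<omega>) then ennreal (max p q) else \<top>) \<in> borel_measurable N"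
    unfolding x by simp
qed

text \<open>The value at \<top> is the limit of exp (- z t) for Re z > 0, whereas
  \<open>enn2real \<top> = 0\<close> would give 1. Paths that never escape thus contribute nothing,
  and almost sure finiteness can be deduced from the transform.\<close>

definition exp_time :: "complex \<Rightarrow> ennreal \<Rightarrow> complex" where
  "exp_time z \<theta> = (if \<theta> = \<top> then 0 else exp (- (z * enn2real \<theta>)))"

text \<open>Only the summand with \<open>Suc k = \<kappa>\<close> survives; \<open>\<kappa>\<close>
  is positive because the range starts at 0.\<close>

lemma sum_first_exceedance:
  fixes q :: complex
  assumes "osc x \<kappa> > 1" "\<And>k. k < \<kappa> \<Longrightarrow> osc x k \<le> 1" "\<kappa> \<le> N"
  shows "(\<Sum>k<N. q ^ Suc k * of_bool (osc x k \<le> 1 \<and> osc x (Suc k) > 1)) = q ^ \<kappa>"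
proof -
  have iff: "osc x k \<le> 1 \<longleftrightarrow> k < \<kappa>" for k
    using assms osc_mono[of \<kappa> k x] by (meson leI less_le_trans not_le)
  have pos: "\<kappa> > 0" using assms(1) by (cases \<kappa>) auto
  have "(\<Sum>k<N. q ^ Suc k * of_bool (osc x k \<le> 1 \<and> osc x (Suc k) > 1)) = (\<Sum>k<N. if k = \<kappa> - 1 then q ^ \<kappa> else 0)"
  proof (rule sum.cong[OF refl])
    fix k
    have "osc x (Suc k) > 1 \<longleftrightarrow> \<not> Suc k < \<kappa>" using iff[of "Suc k"] by linarith
    then have "osc x k \<le> 1 \<and> osc x (Suc k) > 1 \<longleftrightarrow> Suc k = \<kappa>" using iff[of k] by auto
    then show "q ^ Suc k * of_bool (osc x k \<le> 1 \<and> osc x (Suc k) > 1) = (if k = \<kappa> - 1 then q ^ \<kappa> else 0)"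
      using pos by auto
  qed
  also have "\<dots> = q ^ \<kappa>" using pos assms(3) by (simp add: sum.delta')
  finally show ?thesis .
qed

text \<open>A grid pair is a pair of real times, so the first exceedance on the grid never precedes
  the escape time. Conversely a pair at distance above 1 survives a small shift onto the grid, so
  the grid is not late by more than any given \<open>e\<close>. Without escape all sums are 0, in
  agreement with \<open>exp_time\<close>.\<close>

lemma grid_exceedance_tendsto:
  fixes b :: "real \<Rightarrow> real" and z :: complex
  assumes b: "continuous_on {0..} b"
  defines "h \<equiv> \<lambda>m. 1 / real (Suc m) ^ 5"
  defines "x \<equiv> \<lambda>m i. b (real (Suc i) * h m) - b (real i * h m)"
  shows "(\<lambda>m. \<Sum>k<Suc m ^ 6. exp (- (z * h m)) ^ Suc k * of_bool (osc (x m) k \<le> 1 \<and> osc (x m) (Suc k) > 1))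
    \<longlonglongrightarrow> exp_time z (escape_time b)"
proof -
  have h: "0 < h m" for m by (simp add: h_def)
  have osc: "osc (x m) k > 1 \<longleftrightarrow> (\<exists>i\<le>k. \<exists>j\<le>k. b (real i * h m) - b (real j * h m) > 1)" for m k
    unfolding x_def using osc_gt_iff[of 1 "\<lambda>i. b (real i * h m)" k] .
  have late: "escape_time b \<le> ennreal (real k * h m)" if "osc (x m) k > 1" for m k
  proof -
    obtain i j where ij: "i \<le> k" "j \<le> k" "b (real i * h m) - b (real j * h m) > 1"
      using \<open>osc (x m) k > 1\<close> unfolding osc by auto
    have "escape_time b < ennreal t" if "real k * h m < t" for t
    proof -
      have "real i * h m \<le> real k * h m" "real j * h m \<le> real k * h m" using ij h[of m] by auto
      then have "real i * h m < t" "real j * h m < t" using that by linarith+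
      moreover have "dist (b (real i * h m)) (b (real j * h m)) > 1" using ij by (simp add: dist_real_def)
      moreover have "0 \<le> real i * h m" "0 \<le> real j * h m" using h[of m] by auto
      ultimately show ?thesis unfolding escape_time_less_iff[OF b] by blast
    qed
    then show ?thesis
      using h[of m] by (intro le_ennrealI) auto
  qed
  show ?thesis
  proof (cases "escape_time b")
    case top
    then have "\<not> osc (x m) k > 1" for m k using late[of m k] by (auto simp: top_unique)
    then show ?thesis using top by (simp add: exp_time_def)
  next
    case (real \<tau>)
    have close: "\<forall>\<^sub>F m in sequentially. \<exists>k\<le>Suc m ^ 6. osc (x m) k > 1 \<and> real k * h m < \<tau> + e" if e: "0 < e" for e
    proof -
      have "escape_time b < ennreal (\<tau> + e)" using real e by (simp add: ennreal_less_iff)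
      then obtain s s' where s: "0 \<le> s" "s < \<tau> + e" "0 \<le> s'" "s' < \<tau> + e" "dist (b s) (b s') > 1"
        unfolding escape_time_less_iff[OF b] by auto
      obtain \<delta> where \<delta>: "0 < \<delta>" "\<And>p q. \<lbrakk>0 \<le> p; 0 \<le> q; \<bar>p - s\<bar> < \<delta>; \<bar>q - s'\<bar> < \<delta>\<rbrakk> \<Longrightarrow> dist (b p) (b q) > 1"
        using dist_gt_stable[OF b s(1,3,5)] by auto
      \<comment> \<open>Rounding \<open>s\<close> and \<open>s'\<close> up to the grid by less than
        this keeps the distance above 1 and both times below \<open>\<tau> + e\<close>.\<close>
      define \<eta> where "\<eta> = min \<delta> (min (\<tau> + e - s) (\<tau> + e - s'))"
      have \<eta>: "0 < \<eta>" using \<delta> s by (simp add: \<eta>_def)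
      have "h \<longlonglongrightarrow> 0"
        unfolding h_def by real_asymp
      then have "\<forall>\<^sub>F m in sequentially. h m < \<eta>" using \<eta> by (rule order_tendstoD)
      moreover have "\<forall>\<^sub>F m in sequentially. \<tau> + e < real (Suc m)" by real_asymp
      ultimately show ?thesis
      proof eventually_elim
        case (elim m)
        have grid: "\<exists>i::nat. r \<le> real i * h m \<and> real i * h m < r + \<eta>" if "0 \<le> r" for r
        proof (intro exI conjI)
          have 1: "real (nat \<lceil>r / h m\<rceil>) = of_int \<lceil>r / h m\<rceil>" using that h[of m] by (simp add: le_ceiling_iff order_less_le_trans[of "-1" 0])
          have "r / h m \<le> real (nat \<lceil>r / h m\<rceil>)" unfolding 1 by (rule le_of_int_ceiling)
          then show "r \<le> real (nat \<lceil>r / h m\<rceil>) * h m" using h[of m] by (simp add: pos_divide_le_eq)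
          have "real (nat \<lceil>r / h m\<rceil>) < r / h m + 1" unfolding 1 by linarith
          then have "real (nat \<lceil>r / h m\<rceil>) * h m < (r / h m + 1) * h m" using h[of m] by (intro mult_strict_right_mono)
          also have "\<dots> = r + h m" using h[of m] by (simp add: field_simps)
          finally show "real (nat \<lceil>r / h m\<rceil>) * h m < r + \<eta>" using elim by simp
        qed
        obtain i where i: "s \<le> real i * h m" "real i * h m < s + \<eta>" using grid[OF s(1)] by auto
        obtain j where j: "s' \<le> real j * h m" "real j * h m < s' + \<eta>" using grid[OF s(3)] by auto
        have "dist (b (real i * h m)) (b (real j * h m)) > 1"
          using i j s by (intro \<delta>) (auto simp: \<eta>_def)
        then have o: "osc (x m) (max i j) > 1"
          unfolding osc dist_real_def by (smt (verit) max.cobounded1 max.cobounded2)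
        have k: "real (max i j) * h m < \<tau> + e" using i j by (auto simp: max_def \<eta>_def)
        \<comment> \<open>Times below the horizon n = N h have a grid index below N = n^6, so the
          exceedance is seen within the sum.\<close>
        have "real (max i j) * h m < real (Suc m)" using k elim by simp
        then have "real (max i j) < real (Suc m) / h m" using h[of m] by (simp add: pos_less_divide_eq)
        also have "\<dots> = real (Suc m ^ 6)" by (simp add: h_def flip: power_Suc)
        finally have "max i j < Suc m ^ 6" by linarith
        then show ?case using o k by (intro exI[of _ "max i j"]) auto
      qed
    qed
    define \<kappa> where "\<kappa> = (\<lambda>m. LEAST k. osc (x m) k > 1)"
    have \<kappa>: "osc (x m) (\<kappa> m) > 1" "\<kappa> m \<le> k" if "osc (x m) k > 1" for m k
      using that unfolding \<kappa>_def by (auto intro: LeastI Least_le)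
    have "(\<lambda>m. real (\<kappa> m) * h m) \<longlonglongrightarrow> \<tau>"
    proof (rule tendstoI)
      fix e :: real assume "0 < e"
      from close[OF this] show "\<forall>\<^sub>F m in sequentially. dist (real (\<kappa> m) * h m) \<tau> < e"
      proof eventually_elim
        case (elim m)
        then obtain k where k: "osc (x m) k > 1" "real k * h m < \<tau> + e" by auto
        have "real (\<kappa> m) * h m \<le> real k * h m" using \<kappa>(2)[OF k(1)] h[of m] by simp
        moreover have "\<tau> \<le> real (\<kappa> m) * h m"
          using late[OF \<kappa>(1)[OF k(1)]] real h[of m] by (simp add: ennreal_le_iff)
        ultimately show ?case using k by (simp add: dist_real_def)
      qed
    qed
    then have "(\<lambda>m. exp (- (z * complex_of_real (real (\<kappa> m) * h m)))) \<longlonglongrightarrow> exp (- (z * complex_of_real \<tau>))"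
      by (intro tendsto_intros)
    moreover have "\<forall>\<^sub>F m in sequentially. exp (- (z * complex_of_real (real (\<kappa> m) * h m))) =
      (\<Sum>k<Suc m ^ 6. exp (- (z * h m)) ^ Suc k * of_bool (osc (x m) k \<le> 1 \<and> osc (x m) (Suc k) > 1))"
      using close[OF zero_less_one]
    proof eventually_elim
      case (elim m)
      then obtain k where k: "k \<le> Suc m ^ 6" "osc (x m) k > 1" by auto
      have "osc (x m) j \<le> 1" if "j < \<kappa> m" for j
        using not_less_Least that unfolding \<kappa>_def by (metis not_le)
      then have "(\<Sum>k<Suc m ^ 6. exp (- (z * h m)) ^ Suc k * of_bool (osc (x m) k \<le> 1 \<and> osc (x m) (Suc k) > 1))
          = exp (- (z * h m)) ^ \<kappa> m"
        using \<kappa>[OF k(2)] k(1) by (intro sum_first_exceedance) auto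
      also have "\<dots> = exp (- (z * complex_of_real (real (\<kappa> m) * h m)))"
        by (simp add: mult_ac flip: exp_of_nat_mult)
      finally show ?case by simp
    qed
    ultimately have "(\<lambda>m. \<Sum>k<Suc m ^ 6. exp (- (z * h m)) ^ Suc k * of_bool (osc (x m) k \<le> 1 \<and> osc (x m) (Suc k) > 1))
      \<longlonglongrightarrow> exp (- (z * complex_of_real \<tau>))"
      by (rule Lim_transform_eventually)
    then show ?thesis using real by (simp add: exp_time_def)
  qed
qed

subsection \<open>The transform of the escape time of Brownian motion\<close>

lemma norm_exp_time_le:
  assumes "0 \<le> Re z"
  shows "norm (exp_time z \<theta>) \<le> 1"
  using assms by (simp add: exp_time_def)

lemma borel_measurable_exp_time [measurable]: "exp_time z \<in> borel_measurable borel"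
  unfolding exp_time_def[abs_def] by measurable

lemma standard_brownian_motionD:
  assumes "standard_brownian_motion M B"
  shows "prob_space M" "0 \<le> t \<Longrightarrow> B t \<in> borel_measurable M"
    "AE \<omega> in M. continuous_on {0..} (\<lambda>t. B t \<omega>)"
  using assms by (auto simp: standard_brownian_motion_def)

lemma borel_measurable_escape_time_bm:
  assumes "standard_brownian_motion M B"
  shows "(\<lambda>\<omega>. escape_time (\<lambda>t. B t \<omega>)) \<in> borel_measurable M"
  by (rule borel_measurable_escape_time) (rule standard_brownian_motionD(2)[OF assms])

lemma one_plus_cosh: "1 + cosh \<mu> = 2 * cosh (\<mu> / 2) ^ 2" for \<mu> :: complex
proof -
  have "cosh \<mu> = cosh (2 * (\<mu> / 2))" by simp
  also have "\<dots> = 2 * cosh (\<mu> / 2) ^ 2 - 1" unfolding cosh_double sinh_square_eq by simp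
  finally show ?thesis by simp
qed

text \<open>Step size \<open>h = n\<^sup>-\<^sup>5\<close> and \<open>N = n\<^sup>6\<close> steps make the time horizon \<open>N h = n\<close> grow while
  \<open>N h\<^sup>2 / \<epsilon>\<^sup>3 = 1 / n\<close> for \<open>\<epsilon> = 1 / n\<close>.\<close>

lemma bm_escape_time_transform_interior:
  fixes \<mu> :: complex
  assumes bm: "standard_brownian_motion M B" and \<mu>: "0 < Re (\<mu>\<^sup>2)"
  shows "(LINT \<omega>|M. exp_time (\<mu>\<^sup>2 / 2) (escape_time (\<lambda>t. B t \<omega>))) * cosh (\<mu> / 2) ^ 2 = 1"
proof -
  interpret prob_space M by (rule standard_brownian_motionD[OF bm])
  define h where "h = (\<lambda>m. 1 / real (Suc m) ^ 5)"
  define \<xi> where "\<xi> = (\<lambda>m i \<omega>. B (real (Suc i) * h m) \<omega> - B (real i * h m) \<omega>)"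
  define q where "q = (\<lambda>m. exp (- (\<mu>\<^sup>2 * h m / 2)))"
  define L where "L = (\<lambda>m \<omega>. \<Sum>k<Suc m ^ 6. q m ^ Suc k *
      of_bool (osc (\<lambda>i. \<xi> m i \<omega>) k \<le> 1 \<and> osc (\<lambda>i. \<xi> m i \<omega>) (Suc k) > 1))"
  define E where "E = (LINT \<omega>|M. exp_time (\<mu>\<^sup>2 / 2) (escape_time (\<lambda>t. B t \<omega>)))"
  have h: "0 < h m" "h m \<le> 1" for m by (simp_all add: h_def)
  have q: "q m = exp (- (\<mu>\<^sup>2 / 2 * h m))" for m by (simp add: q_def)
  have q1: "norm (q m) \<le> 1" for m using \<mu> h[of m] by (simp add: q_def del: Re_power2)
  have indep: "indep_vars (\<lambda>_. borel) (\<xi> m) {..<N}" for m N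
  proof -
    have "0 \<le> real 0 * h m \<and> (\<forall>i<N. real i * h m \<le> real (Suc i) * h m)" using h[of m] by auto
    moreover have "\<forall>n (\<tau> :: nat \<Rightarrow> real). 0 \<le> \<tau> 0 \<and> (\<forall>i<n. \<tau> i \<le> \<tau> (Suc i)) \<longrightarrow>
        indep_vars (\<lambda>_. borel) (\<lambda>i \<omega>. B (\<tau> (Suc i)) \<omega> - B (\<tau> i) \<omega>) {..<n}"
      using bm unfolding standard_brownian_motion_def by blast
    ultimately show ?thesis unfolding \<xi>_def by (elim allE[of _ N] allE[of _ "\<lambda>i. real i * h m"]) blast
  qed
  have dist: "distributed M lborel (\<xi> m k) (normal_density 0 (sqrt (h m)))" for m k
  proof -
    have "0 \<le> real k * h m \<and> real k * h m < real (Suc k) * h m" using h[of m] by auto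
    with bm have "distributed M lborel (\<xi> m k) (normal_density 0 (sqrt (real (Suc k) * h m - real k * h m)))"
      unfolding standard_brownian_motion_def \<xi>_def by blast
    then show ?thesis by (simp add: algebra_simps)
  qed
  have \<xi>m: "\<xi> m i \<in> borel_measurable M" for m i
    using distributed_measurable[OF dist[of m i]] by simp
  have Lm: "L m \<in> borel_measurable M" for m unfolding L_def
  proof (intro borel_measurable_sum borel_measurable_times borel_measurable_const)
    fix k
    have [measurable]: "(\<lambda>\<omega>. osc (\<lambda>i. \<xi> m i \<omega>) k) \<in> borel_measurable M"
      "(\<lambda>\<omega>. osc (\<lambda>i. \<xi> m i \<omega>) (Suc k)) \<in> borel_measurable M"
      by (auto intro!: borel_measurable_osc \<xi>m)
    show "(\<lambda>\<omega>. of_bool (osc (\<lambda>i. \<xi> m i \<omega>) k \<le> 1 \<and> osc (\<lambda>i. \<xi> m i \<omega>) (Suc k) > 1) :: complex) \<in> borel_measurable M"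
      by measurable
  qed
  \<comment> \<open>At most one summand is nonzero, so the bound is uniform in \<open>m\<close>, as
    dominated convergence requires.\<close>
  have L1: "norm (L m \<omega>) \<le> 1" for m \<omega>
  proof -
    have "norm (L m \<omega>) \<le> (\<Sum>k<Suc m ^ 6. of_bool (osc (\<lambda>i. \<xi> m i \<omega>) k \<le> 1 \<and> osc (\<lambda>i. \<xi> m i \<omega>) (Suc k) > 1))"
      unfolding L_def
    proof (rule sum_norm_le)
      fix k
      have "norm (q m ^ Suc k) \<le> 1" unfolding norm_power using q1 by (intro power_le_one) auto
      then show "norm (q m ^ Suc k * of_bool (osc (\<lambda>i. \<xi> m i \<omega>) k \<le> 1 \<and> osc (\<lambda>i. \<xi> m i \<omega>) (Suc k) > 1)) \<le>
          of_bool (osc (\<lambda>i. \<xi> m i \<omega>) k \<le> 1 \<and> osc (\<lambda>i. \<xi> m i \<omega>) (Suc k) > 1)"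
        by (auto simp del: power_Suc)
    qed
    also have "\<dots> \<le> 1"
      by (rule order_trans[OF sum_first_exceedance_le]) simp
    finally show ?thesis .
  qed
  have "(\<lambda>m. expectation (L m)) \<longlonglongrightarrow> E"
    unfolding E_def
  proof (rule integral_dominated_convergence[where w = "\<lambda>_. 1"])
    show "AE \<omega> in M. (\<lambda>m. L m \<omega>) \<longlonglongrightarrow> exp_time (\<mu>\<^sup>2 / 2) (escape_time (\<lambda>t. B t \<omega>))"
      using standard_brownian_motionD(3)[OF bm]
    proof eventually_elim
      case (elim \<omega>)
      from grid_exceedance_tendsto[OF this, of "\<mu>\<^sup>2 / 2"] show ?case
        by (simp only: L_def \<xi>_def q h_def)
    qed
    show "(\<lambda>\<omega>. exp_time (\<mu>\<^sup>2 / 2) (escape_time (\<lambda>t. B t \<omega>))) \<in> borel_measurable M"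
      using borel_measurable_escape_time_bm[OF bm] by measurable
  qed (use Lm L1 in auto)
  then have lim1: "(\<lambda>m. norm (2 - (1 + cosh \<mu>) * expectation (L m))) \<longlonglongrightarrow> norm (2 - (1 + cosh \<mu>) * E)"
    by (intro tendsto_intros)
  define w where "w = normal_weight (norm \<mu>)"
  define K where "K = (1 + norm \<mu>)\<^sup>2 * exp (norm \<mu>)"
  define r where "r = Re (\<mu>\<^sup>2)"
  have bound: "norm (2 - (1 + cosh \<mu>) * expectation (L m)) \<le>
      2 * exp (norm \<mu>) * exp (- (r * real (Suc m) / 2)) + K * (3 + 2 * w) * (1 / real (Suc m))" for m
  proof -
    let ?n = "real (Suc m)"
    have "norm (2 - (1 + cosh \<mu>) * expectation (L m)) \<le>
      2 * exp (norm \<mu>) * exp (- (Re (\<mu>\<^sup>2) * (real (Suc m ^ 6) * h m) / 2)) +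
      (1 + norm \<mu>)\<^sup>2 * exp (norm \<mu>) * (3 * (1 / ?n) + 2 / (1 / ?n) ^ 3 * (real (Suc m ^ 6) * (h m)\<^sup>2 * normal_weight (norm \<mu>)))"
      unfolding L_def q_def
      by (rule gaussian_walk_osc_transform[OF indep dist h]) (use \<mu> in auto)
    also have "real (Suc m ^ 6) * h m = ?n"
      by (simp add: h_def field_simps flip: power_Suc)
    also have "2 / (1 / ?n) ^ 3 * (real (Suc m ^ 6) * (h m)\<^sup>2 * normal_weight (norm \<mu>)) = 2 * w * (1 / ?n)"
    proof -
      have "?n ^ 10 = ?n ^ 9 * ?n" by (simp add: numeral_eq_Suc)
      moreover have "?n ^ 3 * ?n ^ 6 = ?n ^ 9" by (simp flip: power_add)
      moreover have "?n > 0" by simp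
      ultimately show ?thesis by (simp add: h_def w_def power_divide field_simps flip: power_mult del: of_nat_Suc)
    qed
    finally show ?thesis by (simp add: r_def K_def algebra_simps del: Re_power2)
  qed
  have "0 < r" using \<mu> by (simp add: r_def)
  then have lim2: "(\<lambda>m. 2 * exp (norm \<mu>) * exp (- (r * real (Suc m) / 2)) + K * (3 + 2 * w) * (1 / real (Suc m))) \<longlonglongrightarrow> 0"
    by real_asymp
  have "norm (2 - (1 + cosh \<mu>) * E) \<le> 0"
    by (rule LIMSEQ_le[OF lim1 lim2]) (use bound in auto)
  then have "(1 + cosh \<mu>) * E = 2" by simp
  then show ?thesis unfolding one_plus_cosh E_def[symmetric] by (simp add: mult.commute)
qed

text \<open>As \<mu> tends to 0 through positive reals, the discount tends to 1 where the escape
  time is finite and is 0 elsewhere, while \<open>cosh\<close> tends to 1. The transform identity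
  becomes the statement that finiteness has probability 1.\<close>

lemma bm_escape_time_finite:
  assumes bm: "standard_brownian_motion M B"
  shows "AE \<omega> in M. escape_time (\<lambda>t. B t \<omega>) < \<top>"
proof -
  interpret prob_space M by (rule standard_brownian_motionD[OF bm])
  define \<Theta> where "\<Theta> = (\<lambda>\<omega>. escape_time (\<lambda>t. B t \<omega>))"
  have [measurable]: "\<Theta> \<in> borel_measurable M"
    unfolding \<Theta>_def by (rule borel_measurable_escape_time_bm[OF bm])
  define \<mu> where "\<mu> = (\<lambda>n. complex_of_real (1 / real (Suc n)))"
  have "\<mu> \<longlonglongrightarrow> of_real 0" unfolding \<mu>_def by (rule tendsto_of_real, real_asymp)
  then have \<mu>: "\<mu> \<longlonglongrightarrow> 0" by simp
  have \<mu>2: "0 < Re ((\<mu> n)\<^sup>2)" for n by (simp add: \<mu>_def)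
  have cosh_lim: "(\<lambda>n. cosh (\<mu> n / 2) ^ 2) \<longlonglongrightarrow> cosh (0 / 2) ^ 2"
    by (intro tendsto_intros \<mu>) simp
  have "(\<lambda>n. LINT \<omega>|M. exp_time ((\<mu> n)\<^sup>2 / 2) (\<Theta> \<omega>)) \<longlonglongrightarrow> (LINT \<omega>|M. of_bool (\<Theta> \<omega> < \<top>))"
  proof (rule integral_dominated_convergence[where w = "\<lambda>_. 1"])
    show "AE \<omega> in M. (\<lambda>n. exp_time ((\<mu> n)\<^sup>2 / 2) (\<Theta> \<omega>)) \<longlonglongrightarrow> of_bool (\<Theta> \<omega> < \<top>)"
    proof (rule AE_I2)
      fix \<omega>
      have "(\<lambda>n. exp (- ((\<mu> n)\<^sup>2 / 2 * complex_of_real (enn2real (\<Theta> \<omega>))))) \<longlonglongrightarrow> exp (- (0\<^sup>2 / 2 * complex_of_real (enn2real (\<Theta> \<omega>))))"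
        by (intro tendsto_intros \<mu>) auto
      then show "(\<lambda>n. exp_time ((\<mu> n)\<^sup>2 / 2) (\<Theta> \<omega>)) \<longlonglongrightarrow> of_bool (\<Theta> \<omega> < \<top>)"
        by (cases "\<Theta> \<omega> = \<top>") (auto simp: exp_time_def simp flip: less_top)
    qed
    show "AE \<omega> in M. norm (exp_time ((\<mu> n)\<^sup>2 / 2) (\<Theta> \<omega>)) \<le> 1" for n
      using \<mu>2[of n] by (intro AE_I2 norm_exp_time_le) (simp del: Re_power2)
  qed auto
  from tendsto_mult[OF this cosh_lim]
  have "(\<lambda>n. (LINT \<omega>|M. exp_time ((\<mu> n)\<^sup>2 / 2) (\<Theta> \<omega>)) * cosh (\<mu> n / 2) ^ 2) \<longlonglongrightarrow>
      (LINT \<omega>|M. of_bool (\<Theta> \<omega> < \<top>)) * cosh (0 / 2) ^ 2" .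
  moreover have "(LINT \<omega>|M. exp_time ((\<mu> n)\<^sup>2 / 2) (\<Theta> \<omega>)) * cosh (\<mu> n / 2) ^ 2 = 1" for n
    unfolding \<Theta>_def by (rule bm_escape_time_transform_interior[OF bm \<mu>2])
  ultimately have "(LINT \<omega>|M. of_bool (\<Theta> \<omega> < \<top>)) = (1 :: complex)"
    by (simp add: LIMSEQ_const_iff)
  moreover have "(LINT \<omega>|M. of_bool (\<Theta> \<omega> < \<top>)) = complex_of_real (prob {\<omega> \<in> space M. \<Theta> \<omega> < \<top>})"
  proof -
    have "(LINT \<omega>|M. of_bool (\<Theta> \<omega> < \<top>)) = (LINT \<omega>|M. complex_of_real (indicator {\<omega> \<in> space M. \<Theta> \<omega> < \<top>} \<omega>))"
      by (intro Bochner_Integration.integral_cong) (auto simp: indicator_def)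
    then show ?thesis by simp
  qed
  ultimately have "prob {\<omega> \<in> space M. \<Theta> \<omega> < \<top>} = 1" by simp
  then show ?thesis
    by (subst (asm) prob_Collect_eq_1, measurable) (simp add: \<Theta>_def)
qed

lemma bm_escape_time_pos:
  assumes bm: "standard_brownian_motion M B"
  shows "AE \<omega> in M. 0 < escape_time (\<lambda>t. B t \<omega>)"
  using standard_brownian_motionD(3)[OF bm]
proof eventually_elim
  case (elim \<omega>)
  obtain d where d: "0 < d" "\<And>s. 0 \<le> s \<Longrightarrow> s < d \<Longrightarrow> dist (B s \<omega>) (B 0 \<omega>) < 1 / 2"
  proof -
    have "\<exists>d>0. \<forall>s\<in>{0..}. dist s 0 < d \<longrightarrow> dist (B s \<omega>) (B 0 \<omega>) < 1 / 2"
      using elim[unfolded continuous_on_iff, rule_format, of 0 "1 / 2"] by auto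
    then show ?thesis using that by (auto simp: dist_real_def)
  qed
  have "\<not> escape_time (\<lambda>t. B t \<omega>) < ennreal d"
  proof
    assume "escape_time (\<lambda>t. B t \<omega>) < ennreal d"
    then obtain s s' where "0 \<le> s" "s < d" "0 \<le> s'" "s' < d" "dist (B s \<omega>) (B s' \<omega>) > 1"
      unfolding escape_time_less_iff[OF elim] by auto
    then show False using d(2)[of s] d(2)[of s'] dist_triangle2[of "B s \<omega>" "B s' \<omega>" "B 0 \<omega>"] by linarith
  qed
  then show ?case using d(1) by (meson ennreal_less_zero_iff less_le_trans not_le)
qed

definition escape_real :: "(real \<Rightarrow> 'a \<Rightarrow> 'b::metric_space) \<Rightarrow> 'a \<Rightarrow> real" where
  "escape_real B \<omega> = enn2real (escape_time (\<lambda>t. B t \<omega>))"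

lemma escape_real_nonneg: "0 \<le> escape_real B \<omega>"
  by (simp add: escape_real_def)

lemma borel_measurable_escape_real:
  assumes "standard_brownian_motion M B"
  shows "escape_real B \<in> borel_measurable M"
  unfolding escape_real_def[abs_def] using borel_measurable_escape_time_bm[OF assms] by measurable

lemma AE_escape_real:
  assumes bm: "standard_brownian_motion M B"
  shows "AE \<omega> in M. escape_time (\<lambda>t. B t \<omega>) = ennreal (escape_real B \<omega>) \<and> 0 < escape_real B \<omega>"
  using bm_escape_time_finite[OF bm] bm_escape_time_pos[OF bm]
  by eventually_elim (auto simp: escape_real_def enn2real_positive_iff)

text \<open>Passes to the boundary of the sector. Adding a positive real to \<mu> moves it into the
  interior, and the discount is bounded by 1 along the way. The product form also shows that
  \<open>cosh (\<mu> / 2)\<close> has no zero there.\<close>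

lemma bm_escape_transform:
  fixes \<mu> :: complex
  assumes bm: "standard_brownian_motion M B" and \<mu>: "\<bar>Im \<mu>\<bar> \<le> Re \<mu>"
  shows "(LINT \<omega>|M. exp (- (\<mu>\<^sup>2 / 2 * escape_real B \<omega>))) * cosh (\<mu> / 2) ^ 2 = 1"
proof -
  interpret prob_space M by (rule standard_brownian_motionD[OF bm])
  have [measurable]: "escape_real B \<in> borel_measurable M"
    by (rule borel_measurable_escape_real[OF bm])
  define \<nu> where "\<nu> = (\<lambda>n. \<mu> + complex_of_real (1 / real (Suc n)))"
  have "\<nu> \<longlonglongrightarrow> \<mu> + of_real 0" unfolding \<nu>_def by (rule tendsto_add[OF tendsto_const tendsto_of_real], real_asymp)
  then have \<nu>: "\<nu> \<longlonglongrightarrow> \<mu>" by simp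
  have \<nu>2: "0 < Re ((\<nu> n)\<^sup>2)" for n
  proof -
    have "\<bar>Im (\<nu> n)\<bar> < Re (\<nu> n)"
    proof -
      have "0 < 1 / real (Suc n)" by simp
      moreover have "Im (\<nu> n) = Im \<mu>" "Re (\<nu> n) = Re \<mu> + 1 / real (Suc n)"
        unfolding \<nu>_def plus_complex.sel Re_complex_of_real Im_complex_of_real by simp_all
      ultimately show ?thesis using \<mu> by linarith
    qed
    then have "(Im (\<nu> n))\<^sup>2 < (Re (\<nu> n))\<^sup>2" by (simp add: abs_le_square_iff[symmetric] flip: not_le)
    then show ?thesis by (simp add: Re_power2)
  qed
  have "(\<lambda>n. LINT \<omega>|M. exp (- ((\<nu> n)\<^sup>2 / 2 * escape_real B \<omega>))) \<longlonglongrightarrow> (LINT \<omega>|M. exp (- (\<mu>\<^sup>2 / 2 * escape_real B \<omega>)))"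
  proof (rule integral_dominated_convergence[where w = "\<lambda>_. 1"])
    show "AE \<omega> in M. (\<lambda>n. exp (- ((\<nu> n)\<^sup>2 / 2 * escape_real B \<omega>))) \<longlonglongrightarrow> exp (- (\<mu>\<^sup>2 / 2 * escape_real B \<omega>))"
      by (intro AE_I2 tendsto_intros \<nu>) auto
    have "norm (exp (- ((\<nu> n)\<^sup>2 / 2 * escape_real B \<omega>))) \<le> 1" for n \<omega>
      using \<nu>2[of n] escape_real_nonneg[of B \<omega>] by (simp del: Re_power2)
    then show "AE \<omega> in M. norm (exp (- ((\<nu> n)\<^sup>2 / 2 * escape_real B \<omega>))) \<le> 1" for n by simp
  qed auto
  then have "(\<lambda>n. (LINT \<omega>|M. exp (- ((\<nu> n)\<^sup>2 / 2 * escape_real B \<omega>))) * cosh (\<nu> n / 2) ^ 2) \<longlonglongrightarrow>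
      (LINT \<omega>|M. exp (- (\<mu>\<^sup>2 / 2 * escape_real B \<omega>))) * cosh (\<mu> / 2) ^ 2"
    by (intro tendsto_intros \<nu>) auto
  moreover have "(LINT \<omega>|M. exp (- ((\<nu> n)\<^sup>2 / 2 * escape_real B \<omega>))) * cosh (\<nu> n / 2) ^ 2 = 1" for n
  proof -
    have "(LINT \<omega>|M. exp (- ((\<nu> n)\<^sup>2 / 2 * escape_real B \<omega>))) = (LINT \<omega>|M. exp_time ((\<nu> n)\<^sup>2 / 2) (escape_time (\<lambda>t. B t \<omega>)))"
    proof (rule integral_cong_AE)
      show "(\<lambda>\<omega>. exp_time ((\<nu> n)\<^sup>2 / 2) (escape_time (\<lambda>t. B t \<omega>))) \<in> borel_measurable M"
        using borel_measurable_escape_time_bm[OF bm] by measurable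
      show "AE \<omega> in M. exp (- ((\<nu> n)\<^sup>2 / 2 * escape_real B \<omega>)) = exp_time ((\<nu> n)\<^sup>2 / 2) (escape_time (\<lambda>t. B t \<omega>))"
        using bm_escape_time_finite[OF bm] by eventually_elim (auto simp: exp_time_def escape_real_def)
    qed measurable
    then show ?thesis using bm_escape_time_transform_interior[OF bm \<nu>2] by simp
  qed
  ultimately show ?thesis by (simp add: LIMSEQ_const_iff)
qed

lemma bm_escape_char:
  assumes bm: "standard_brownian_motion M B" and \<mu>: "\<bar>Im \<mu>\<bar> = Re \<mu>" "\<mu>\<^sup>2 / 2 = - \<i> * complex_of_real u"
  shows "char (distr M borel (escape_real B)) u = 1 / cosh (\<mu> / 2) ^ 2"
proof -
  have [measurable]: "escape_real B \<in> borel_measurable M"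
    by (rule borel_measurable_escape_real[OF bm])
  have "char (distr M borel (escape_real B)) u = (LINT \<omega>|M. exp (- (\<mu>\<^sup>2 / 2 * escape_real B \<omega>)))"
    unfolding char_def \<mu>(2) by (subst integral_distr) (auto simp: mult.assoc)
  then show ?thesis
    using bm_escape_transform[OF bm, of \<mu>] \<mu>(1) by (metis divide_eq_eq mult_zero_right order_refl zero_neq_one nonzero_eq_divide_eq)
qed

text \<open>The root is (1 - i) sqrt u for u \<ge> 0 and (1 + i) sqrt (-u) otherwise, since (1 -
  i)^2 = -2 i and (1 + i)^2 = 2 i.\<close>

lemma char_root_exists: "\<exists>\<mu>. \<bar>Im \<mu>\<bar> = Re \<mu> \<and> \<mu>\<^sup>2 / 2 = - \<i> * complex_of_real u"
proof (cases "u \<ge> 0")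
  case True
  then have "complex_of_real (sqrt u) ^ 2 = complex_of_real u" by (simp flip: of_real_power)
  with True show ?thesis
    by (intro exI[of _ "Complex (sqrt u) (- sqrt u)"]) (auto simp: complex_eq_iff power2_eq_square)
next
  case False
  with False show ?thesis
    by (intro exI[of _ "Complex (sqrt (-u)) (sqrt (-u))"]) (auto simp: complex_eq_iff power2_eq_square)
qed

text \<open>Will be applied to a Brownian motion and its rescaled version.\<close>

lemma bm_escape_law_unique:
  assumes bm: "standard_brownian_motion M B" and bm': "standard_brownian_motion M' B'"
  shows "distr M borel (escape_real B) = distr M' borel (escape_real B')"
proof (rule Levy_uniqueness)
  show "real_distribution (distr M borel (escape_real B))"
    using prob_space.real_distribution_distr[OF standard_brownian_motionD(1)[OF bm]] borel_measurable_escape_real[OF bm] by auto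
  show "real_distribution (distr M' borel (escape_real B'))"
    using prob_space.real_distribution_distr[OF standard_brownian_motionD(1)[OF bm']] borel_measurable_escape_real[OF bm'] by auto
  show "char (distr M borel (escape_real B)) = char (distr M' borel (escape_real B'))"
  proof
    fix u
    obtain \<mu> where "\<bar>Im \<mu>\<bar> = Re \<mu>" "\<mu>\<^sup>2 / 2 = - \<i> * complex_of_real u" using char_root_exists by blast
    then show "char (distr M borel (escape_real B)) u = char (distr M' borel (escape_real B')) u"
      using bm_escape_char bm bm' by metis
  qed
qed

lemma bm_escape_laplace:
  assumes bm: "standard_brownian_motion M B" and x: "0 \<le> x"
  shows "(LINT \<omega>|M. exp (- (2 * x\<^sup>2 * escape_real B \<omega>))) = 1 / cosh x ^ 2"
proof -
  have "(LINT \<omega>|M. exp (- ((complex_of_real (2 * x))\<^sup>2 / 2 * escape_real B \<omega>))) * cosh (complex_of_real (2 * x) / 2) ^ 2 = 1"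
    using x by (intro bm_escape_transform[OF bm]) auto
  moreover have "exp (- ((complex_of_real (2 * x))\<^sup>2 / 2 * escape_real B \<omega>)) = complex_of_real (exp (- (2 * x\<^sup>2 * escape_real B \<omega>)))" for \<omega>
    by (simp add: power_mult_distrib flip: exp_of_real)
  moreover have "cosh (complex_of_real (2 * x) / 2) = complex_of_real (cosh x)"
    by (simp add: cosh_def scaleR_conv_of_real flip: exp_of_real)
  ultimately have "complex_of_real ((LINT \<omega>|M. exp (- (2 * x\<^sup>2 * escape_real B \<omega>))) * cosh x ^ 2) = 1"
    by simp
  then have "(LINT \<omega>|M. exp (- (2 * x\<^sup>2 * escape_real B \<omega>))) * cosh x ^ 2 = 1"
    by (metis of_real_eq_1_iff)
  then show ?thesis by (simp add: nonzero_eq_divide_eq)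
qed

subsection \<open>Moments and scaling\<close>

lemma (in prob_space) laplace_bounded_integrable:
  fixes T :: "'a \<Rightarrow> real"
  assumes [measurable]: "T \<in> borel_measurable M" and "\<And>\<omega>. 0 \<le> T \<omega>" "0 \<le> s"
  shows "integrable M (\<lambda>\<omega>. exp (- (s * T \<omega>)))"
proof (rule integrable_const_bound[of _ 1])
  show "AE \<omega> in M. norm (exp (- (s * T \<omega>))) \<le> 1" using assms by (auto intro!: AE_I2 mult_nonneg_nonneg)
qed measurable

text \<open>The difference quotients of the Laplace transform at 0: \<open>g n\<close> stays below
  the identity and converges to it, so monotonicity gives one inequality and Fatou's lemma the
  other. The limit 1/2 comes from 1 - 1 / cosh x ^ 2 being x^2 to leading order, divided by 2
  x^2.\<close>

lemma bm_escape_mean: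
  assumes bm: "standard_brownian_motion M B"
  shows "(\<integral>\<^sup>+\<omega>. ennreal (escape_real B \<omega>) \<partial>M) = ennreal (1 / 2)"
proof -
  interpret prob_space M by (rule standard_brownian_motionD[OF bm])
  have [measurable]: "escape_real B \<in> borel_measurable M"
    by (rule borel_measurable_escape_real[OF bm])
  define x where "x = (\<lambda>n. 1 / real (Suc n))"
  have x: "0 < x n" for n by (simp add: x_def)
  define g where "g = (\<lambda>n \<tau>. (1 - exp (- (2 * (x n)\<^sup>2 * \<tau>))) / (2 * (x n)\<^sup>2))"
  have [measurable]: "g n \<in> borel_measurable borel" for n unfolding g_def by measurable
  have g_nonneg: "0 \<le> g n \<tau>" and g_le: "g n \<tau> \<le> \<tau>" if "0 \<le> \<tau>" for n \<tau>
  proof -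
    show "0 \<le> g n \<tau>" using that x[of n] by (simp add: g_def)
    have "1 - exp (- (2 * (x n)\<^sup>2 * \<tau>)) \<le> 2 * (x n)\<^sup>2 * \<tau>"
      using exp_ge_add_one_self[of "- (2 * (x n)\<^sup>2 * \<tau>)"] by simp
    then show "g n \<tau> \<le> \<tau>" using x[of n] by (simp add: g_def pos_divide_le_eq mult.commute)
  qed
  have g_lim: "(\<lambda>n. g n \<tau>) \<longlonglongrightarrow> \<tau>" if "0 \<le> \<tau>" for \<tau>
  proof (cases "\<tau> = 0")
    case False
    then have "0 < \<tau>" using that by simp
    then show ?thesis unfolding g_def x_def by real_asymp
  qed (simp add: g_def)
  define e where "e = (\<lambda>n. (1 - 1 / cosh (x n) ^ 2) / (2 * (x n)\<^sup>2))"
  have e_lim: "e \<longlonglongrightarrow> 1 / 2" unfolding e_def x_def by real_asymp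
  have e: "(\<integral>\<^sup>+\<omega>. ennreal (g n (escape_real B \<omega>)) \<partial>M) = ennreal (e n)" for n
  proof -
    have int: "integrable M (\<lambda>\<omega>. exp (- (2 * (x n)\<^sup>2 * escape_real B \<omega>)))"
      by (rule laplace_bounded_integrable) (simp_all add: escape_real_nonneg)
    then have "integrable M (\<lambda>\<omega>. g n (escape_real B \<omega>))" unfolding g_def by simp
    moreover have "expectation (\<lambda>\<omega>. g n (escape_real B \<omega>)) = e n"
      unfolding g_def e_def using int bm_escape_laplace[OF bm, of "x n"] x[of n] by (simp add: prob_space)
    ultimately show ?thesis
      by (subst nn_integral_eq_integral) (auto simp: g_nonneg escape_real_nonneg)
  qed
  show ?thesis
  proof (rule antisym)
    have "(\<integral>\<^sup>+\<omega>. ennreal (escape_real B \<omega>) \<partial>M) = (\<integral>\<^sup>+\<omega>. liminf (\<lambda>n. ennreal (g n (escape_real B \<omega>))) \<partial>M)"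
    proof (rule nn_integral_cong)
      fix \<omega>
      have "(\<lambda>n. ennreal (g n (escape_real B \<omega>))) \<longlonglongrightarrow> ennreal (escape_real B \<omega>)"
        by (intro tendsto_ennrealI g_lim escape_real_nonneg)
      then show "ennreal (escape_real B \<omega>) = liminf (\<lambda>n. ennreal (g n (escape_real B \<omega>)))"
        by (simp add: lim_imp_Liminf)
    qed
    also have "\<dots> \<le> liminf (\<lambda>n. \<integral>\<^sup>+\<omega>. ennreal (g n (escape_real B \<omega>)) \<partial>M)"
      by (rule nn_integral_liminf) measurable
    also have "\<dots> = ennreal (1 / 2)"
      unfolding e by (rule lim_imp_Liminf[OF _ tendsto_ennrealI[OF e_lim]]) simp
    finally show "(\<integral>\<^sup>+\<omega>. ennreal (escape_real B \<omega>) \<partial>M) \<le> ennreal (1 / 2)" .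
    show "ennreal (1 / 2) \<le> (\<integral>\<^sup>+\<omega>. ennreal (escape_real B \<omega>) \<partial>M)"
    proof (rule LIMSEQ_le_const2[OF tendsto_ennrealI[OF e_lim]], intro exI allI impI)
      show "ennreal (e n) \<le> (\<integral>\<^sup>+\<omega>. ennreal (escape_real B \<omega>) \<partial>M)" for n
        unfolding e[symmetric] by (intro nn_integral_mono ennreal_leI g_le escape_real_nonneg)
    qed
  qed
qed

text \<open>This is the integral of exp (- s \<tau>) over s \<ge> 0 after s = 2 u^2, the
  parametrisation in which \<open>bm_escape_laplace\<close> has the value 1 / cosh u ^ 2.\<close>

lemma nn_integral_inverse_Laplace:
  fixes \<tau> :: real
  assumes "0 < \<tau>"
  shows "(\<integral>\<^sup>+u. ennreal (4 * u * exp (- (2 * u\<^sup>2 * \<tau>))) * indicator {0..} u \<partial>lborel) = ennreal (1 / \<tau>)"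
proof -
  have "(\<integral>\<^sup>+u. ennreal (4 * u * exp (- (2 * u\<^sup>2 * \<tau>))) * indicator {0..} u \<partial>lborel) = ennreal (0 - (- exp (- (2 * 0\<^sup>2 * \<tau>)) / \<tau>))"
  proof (rule nn_integral_FTC_atLeast[where F = "\<lambda>u. - exp (- (2 * u\<^sup>2 * \<tau>)) / \<tau>"])
    show "((\<lambda>u. - exp (- (2 * u\<^sup>2 * \<tau>)) / \<tau>) has_real_derivative 4 * x * exp (- (2 * x\<^sup>2 * \<tau>))) (at x)" for x
      using assms by (auto intro!: derivative_eq_intros simp: field_simps)
    show "((\<lambda>u. - exp (- (2 * u\<^sup>2 * \<tau>)) / \<tau>) \<longlongrightarrow> 0) at_top"
      using assms by real_asymp
  qed (use assms in auto)
  then show ?thesis by simp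
qed

text \<open>Integration by parts gives the antiderivative. The constant arises at infinity, where ln
  (cosh u) is u - ln 2 up to a vanishing term and u * tanh u is u.\<close>

lemma nn_integral_sech_square:
  "(\<integral>\<^sup>+u. ennreal (4 * u * (1 / cosh u ^ 2)) * indicator {0..} u \<partial>lborel) = ennreal (4 * ln 2)"
proof -
  define F :: "real \<Rightarrow> real" where "F = (\<lambda>u. 4 * (u * tanh u - ln (cosh u)))"
  have "(\<integral>\<^sup>+u. ennreal (4 * u * (1 / cosh u ^ 2)) * indicator {0..} u \<partial>lborel) = ennreal (4 * ln 2 - F 0)"
  proof (rule nn_integral_FTC_atLeast)
    have "(\<lambda>u::real. 4 * u * (1 / cosh u ^ 2)) \<in> borel_measurable borel"
      by (intro borel_measurable_continuous_onI continuous_intros) auto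
    then show "(\<lambda>u::real. 4 * u * (1 / cosh u ^ 2)) \<in> borel_measurable borel" .
    show "(F has_real_derivative 4 * x * (1 / cosh x ^ 2)) (at x)" for x
    proof -
      have "1 - tanh x ^ 2 = 1 / cosh x ^ 2"
        by (simp add: tanh_def power_divide field_simps sinh_square_eq)
      moreover have "(F has_real_derivative 4 * ((tanh x + x * (1 - tanh x ^ 2)) - tanh x)) (at x)"
        unfolding F_def by (auto intro!: derivative_eq_intros simp flip: tanh_def)
      ultimately show ?thesis by simp
    qed
    have "F = (\<lambda>u. 4 * (u * ((1 - exp (- 2 * u)) / (1 + exp (- 2 * u))) - ln ((exp u + exp (- u)) / 2)))"
      by (rule ext) (simp add: F_def tanh_real_altdef cosh_def)
    then show "(F \<longlongrightarrow> 4 * ln 2) at_top" by (simp only:) (real_asymp, simp add: ln_div)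
  qed auto
  then show ?thesis by (simp add: F_def)
qed

lemma bm_escape_inverse_mean:
  assumes bm: "standard_brownian_motion M B"
  shows "(\<integral>\<^sup>+\<omega>. ennreal (1 / escape_real B \<omega>) \<partial>M) = ennreal (4 * ln 2)"
proof -
  interpret prob_space M by (rule standard_brownian_motionD[OF bm])
  interpret pair_sigma_finite M lborel ..
  have [measurable]: "escape_real B \<in> borel_measurable M"
    by (rule borel_measurable_escape_real[OF bm])
  have "(\<integral>\<^sup>+\<omega>. ennreal (1 / escape_real B \<omega>) \<partial>M) =
    (\<integral>\<^sup>+\<omega>. \<integral>\<^sup>+u. ennreal (4 * u * exp (- (2 * u\<^sup>2 * escape_real B \<omega>))) * indicator {0..} u \<partial>lborel \<partial>M)"
    by (rule nn_integral_cong_AE)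
       (use AE_escape_real[OF bm] in eventually_elim, simp add: nn_integral_inverse_Laplace)
  also have "\<dots> = (\<integral>\<^sup>+u. \<integral>\<^sup>+\<omega>. ennreal (4 * u * exp (- (2 * u\<^sup>2 * escape_real B \<omega>))) * indicator {0..} u \<partial>M \<partial>lborel)"
    by (rule Fubini'[symmetric]) measurable
  also have "\<dots> = (\<integral>\<^sup>+u. ennreal (4 * u * (1 / cosh u ^ 2)) * indicator {0..} u \<partial>lborel)"
  proof (rule nn_integral_cong)
    fix u :: real
    show "(\<integral>\<^sup>+\<omega>. ennreal (4 * u * exp (- (2 * u\<^sup>2 * escape_real B \<omega>))) * indicator {0..} u \<partial>M) =
        ennreal (4 * u * (1 / cosh u ^ 2)) * indicator {0..} u"
    proof (cases "0 \<le> u")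
      case True
      have int: "integrable M (\<lambda>\<omega>. exp (- (2 * u\<^sup>2 * escape_real B \<omega>)))"
        by (rule laplace_bounded_integrable) (simp_all add: escape_real_nonneg)
      then show ?thesis
        using True bm_escape_laplace[OF bm True] by (simp add: nn_integral_eq_integral)
    qed simp
  qed
  also have "\<dots> = ennreal (4 * ln 2)" by (rule nn_integral_sech_square)
  finally show ?thesis .
qed

lemma standard_brownian_motion_scale:
  assumes bm: "standard_brownian_motion M B" and c: "0 < c"
  shows "standard_brownian_motion M (\<lambda>s \<omega>. B (c * s) \<omega> / sqrt c)"
proof -
  interpret prob_space M by (rule standard_brownian_motionD[OF bm])
  have meas: "\<forall>t\<ge>0. (\<lambda>\<omega>. B (c * t) \<omega> / sqrt c) \<in> borel_measurable M"
    using standard_brownian_motionD(2)[OF bm] c by auto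
  have zero: "AE \<omega> in M. B (c * 0) \<omega> / sqrt c = 0"
    using bm c by (auto simp: standard_brownian_motion_def)
  have indep: "indep_vars (\<lambda>_. borel) (\<lambda>i \<omega>. B (c * \<tau> (Suc i)) \<omega> / sqrt c - B (c * \<tau> i) \<omega> / sqrt c) {..<n}"
    if \<tau>: "0 \<le> \<tau> 0 \<and> (\<forall>i<n. \<tau> i \<le> \<tau> (Suc i))" for n \<tau>
  proof -
    have "\<forall>n (\<tau> :: nat \<Rightarrow> real). 0 \<le> \<tau> 0 \<and> (\<forall>i<n. \<tau> i \<le> \<tau> (Suc i)) \<longrightarrow>
        indep_vars (\<lambda>_. borel) (\<lambda>i \<omega>. B (\<tau> (Suc i)) \<omega> - B (\<tau> i) \<omega>) {..<n}"
      using bm unfolding standard_brownian_motion_def by blast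
    moreover have "0 \<le> c * \<tau> 0 \<and> (\<forall>i<n. c * \<tau> i \<le> c * \<tau> (Suc i))" using \<tau> c by simp
    ultimately have "indep_vars (\<lambda>_. borel) (\<lambda>i \<omega>. B (c * \<tau> (Suc i)) \<omega> - B (c * \<tau> i) \<omega>) {..<n}"
      by (elim allE[of _ n] allE[of _ "\<lambda>i. c * \<tau> i"]) blast
    then have "indep_vars (\<lambda>_. borel) (\<lambda>i \<omega>. (B (c * \<tau> (Suc i)) \<omega> - B (c * \<tau> i) \<omega>) / sqrt c) {..<n}"
      by (rule indep_vars_compose2[where Y = "\<lambda>i x. x / sqrt c"]) measurable
    then show ?thesis by (simp add: diff_divide_distrib)
  qed
  have dist: "distributed M lborel (\<lambda>\<omega>. B (c * t) \<omega> / sqrt c - B (c * s) \<omega> / sqrt c) (normal_density 0 (sqrt (t - s)))"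
    if st: "0 \<le> s \<and> s < t" for s t
  proof -
    have cst: "0 \<le> c * s \<and> c * s < c * t" using c st by simp
    have "distributed M lborel (\<lambda>\<omega>. B (c * t) \<omega> - B (c * s) \<omega>) (normal_density 0 (sqrt (c * t - c * s)))"
      using bm cst unfolding standard_brownian_motion_def by blast
    from normal_density_affine[OF this, of "1 / sqrt c" 0] cst c
    have "distributed M lborel (\<lambda>\<omega>. (B (c * t) \<omega> - B (c * s) \<omega>) / sqrt c) (normal_density 0 (sqrt (c * t - c * s) / sqrt c))"
      by simp
    moreover have "sqrt (c * t - c * s) / sqrt c = sqrt (t - s)"
      using c by (simp flip: real_sqrt_divide right_diff_distrib)
    ultimately show ?thesis by (simp add: diff_divide_distrib)
  qed
  have cont: "AE \<omega> in M. continuous_on {0..} (\<lambda>t. B (c * t) \<omega> / sqrt c)"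
    using standard_brownian_motionD(3)[OF bm]
  proof eventually_elim
    case (elim \<omega>)
    have "continuous_on {0..} (\<lambda>t. B (c * t) \<omega>)"
      by (rule continuous_on_compose2[OF elim]) (use c in \<open>auto intro!: continuous_intros\<close>)
    then show ?case using c by (auto intro!: continuous_intros)
  qed
  show ?thesis
    unfolding standard_brownian_motion_def using meas zero indep dist cont prob_space_axioms by blast
qed

text \<open>The substitution v = t^2 leaves half the integral of (1 - cos (v D)) / v^2, and
  integration by parts reduces that to the sine integral; \<open>F\<close> is the resulting
  antiderivative. The square in the argument is inherited from \<mu> = (1 + i) t, for which \<mu>^2
  / 2 = i t^2.\<close>

lemma nn_integral_one_minus_cos_cube:
  fixes D :: real
  shows "(\<integral>\<^sup>+t. ennreal ((1 - cos (t\<^sup>2 * D)) / t ^ 3) * indicator {0<..} t \<partial>lborel) = ennreal (pi / 4 * \<bar>D\<bar>)"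
proof (cases "D = 0")
  case False
  define d where "d = \<bar>D\<bar>"
  have d: "0 < d" using False by (simp add: d_def)
  define f where "f = (\<lambda>t. (1 - cos (t\<^sup>2 * d)) / t ^ 3)"
  define F where "F = (\<lambda>t. d / 2 * (Si (d * t\<^sup>2) - (1 - cos (d * t\<^sup>2)) / (d * t\<^sup>2)))"
  have cos_eq: "cos (t\<^sup>2 * D) = cos (t\<^sup>2 * d)" for t
    by (cases "D \<ge> 0") (simp_all add: d_def)
  have f_nonneg: "0 \<le> f t" if "0 < t" for t
    using that by (simp add: f_def)
  have deriv: "(F has_real_derivative f t) (at t)" if t: "0 < t" for t
  proof -
    have "(Si has_real_derivative sin (d * t\<^sup>2) / (d * t\<^sup>2)) (at (d * t\<^sup>2))"
      using DERIV_Si[of "d * t\<^sup>2"] t d by simp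
    then have Si: "((\<lambda>t. Si (d * t\<^sup>2)) has_real_derivative sin (d * t\<^sup>2) / (d * t\<^sup>2) * (d * (2 * t))) (at t)"
      by (rule DERIV_chain2) (auto intro!: derivative_eq_intros)
    have "((\<lambda>t. (1 - cos (d * t\<^sup>2)) / (d * t\<^sup>2)) has_real_derivative
        (sin (d * t\<^sup>2) * (d * (2 * t)) * (d * t\<^sup>2) - (1 - cos (d * t\<^sup>2)) * (d * (2 * t))) / (d * t\<^sup>2 * (d * t\<^sup>2))) (at t)"
      by (rule DERIV_divide) (use t d in \<open>auto intro!: derivative_eq_intros\<close>)
    note D = DERIV_cmult[OF DERIV_diff[OF Si this], of "d / 2"]
    define s c where "s = sin (d * t\<^sup>2)" and "c = cos (d * t\<^sup>2)"
    have "f t = (1 - c) / t ^ 3" by (simp add: f_def c_def mult.commute)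
    also have "\<dots> = d / 2 * (s / (d * t\<^sup>2) * (d * (2 * t)) - (s * (d * (2 * t)) * (d * t\<^sup>2) -
          (1 - c) * (d * (2 * t))) / (d * t\<^sup>2 * (d * t\<^sup>2)))"
      using t d by (simp add: field_simps power2_eq_square power3_eq_cube)
    finally have "f t = \<dots>" .
    then show ?thesis using D unfolding F_def s_def c_def by (simp only:)
  qed
  have Si0: "Si 0 = 0" by (simp add: Si_def zero_ereal_def)
  have lim0: "(F \<longlongrightarrow> 0) (at_right 0)"
  proof -
    have 1: "((\<lambda>t. Si (d * t\<^sup>2)) \<longlongrightarrow> Si (d * 0\<^sup>2)) (at_right 0)"
      by (intro isCont_tendsto_compose[OF isCont_Si] tendsto_intros)
    have 2: "((\<lambda>t. (1 - cos (d * t\<^sup>2)) / (d * t\<^sup>2)) \<longlongrightarrow> 0) (at_right 0)"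
      using d by real_asymp
    have "(F \<longlongrightarrow> d / 2 * (Si (d * 0\<^sup>2) - 0)) (at_right 0)"
      unfolding F_def by (intro tendsto_intros 1 2)
    then show ?thesis by (simp add: Si0)
  qed
  have lim1: "(F \<longlongrightarrow> d / 2 * (pi / 2 - 0)) at_top"
  proof -
    have top: "filterlim (\<lambda>t. d * t\<^sup>2) at_top at_top" using d by real_asymp
    have 1: "((\<lambda>t. Si (d * t\<^sup>2)) \<longlongrightarrow> pi / 2) at_top"
      by (rule filterlim_compose[OF Si_at_top top])
    have 2: "((\<lambda>t. (1 - cos (d * t\<^sup>2)) / (d * t\<^sup>2)) \<longlongrightarrow> 0) at_top"
    proof (rule tendsto_sandwich)
      show "\<forall>\<^sub>F t in at_top. 0 \<le> (1 - cos (d * t\<^sup>2)) / (d * t\<^sup>2)"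
        using d by (intro always_eventually) simp
      have "(1 - cos (d * t\<^sup>2)) / (d * t\<^sup>2) \<le> 2 / (d * t\<^sup>2)" for t
      proof (intro divide_right_mono)
        show "1 - cos (d * t\<^sup>2) \<le> 2" using cos_ge_minus_one[of "d * t\<^sup>2"] by linarith
      qed (use d in simp)
      then show "\<forall>\<^sub>F t in at_top. (1 - cos (d * t\<^sup>2)) / (d * t\<^sup>2) \<le> 2 / (d * t\<^sup>2)"
        by simp
      show "((\<lambda>t. 2 / (d * t\<^sup>2)) \<longlongrightarrow> 0) at_top" using d by real_asymp
    qed simp
    show ?thesis unfolding F_def by (intro tendsto_intros 1 2)
  qed
  note FTC = interval_integral_FTC_nonneg[of 0 \<infinity> F f 0 "d / 2 * (pi / 2 - 0)"]
  have lims: "((F \<circ> real_of_ereal) \<longlongrightarrow> 0) (at_right 0)"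
    "((F \<circ> real_of_ereal) \<longlongrightarrow> d / 2 * (pi / 2 - 0)) (at_left \<infinity>)"
    using lim0 lim1 unfolding zero_ereal_def by (simp_all add: ereal_tendsto_simps)
  have cont: "isCont f t" if "0 < t" for t
    using that unfolding f_def by (auto intro!: continuous_intros)
  have "set_integrable lborel (einterval 0 \<infinity>) f" "(LBINT t=0..\<infinity>. f t) = d / 2 * (pi / 2 - 0) - 0"
    by (rule FTC; use deriv f_nonneg lims cont in \<open>auto simp: einterval_def\<close>)+
  moreover have ein: "einterval 0 \<infinity> = {0<..}" using einterval_eq_Ici[of 0] by (simp add: zero_ereal_def)
  ultimately have int: "integrable lborel (\<lambda>t. indicator {0<..} t * f t)" "(LINT t|lborel. indicator {0<..} t * f t) = pi / 4 * d"
    by (simp_all add: interval_lebesgue_integral_0_infty set_integrable_def set_lebesgue_integral_def ein)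
  have "(\<integral>\<^sup>+t. ennreal ((1 - cos (t\<^sup>2 * D)) / t ^ 3) * indicator {0<..} t \<partial>lborel) = (\<integral>\<^sup>+t. ennreal (indicator {0<..} t * f t) \<partial>lborel)"
    by (intro nn_integral_cong) (auto simp: f_def cos_eq indicator_def)
  also have "\<dots> = ennreal (pi / 4 * d)"
    unfolding int(2)[symmetric]
    by (rule nn_integral_eq_integral[OF int(1)]) (use f_nonneg in \<open>auto simp: indicator_def\<close>)
  finally show ?thesis by (simp add: d_def)
qed simp

text \<open>The times are strictly below \<open>t\<close> to fit the strict inequalities of
  \<open>escape_time_less_iff\<close>, and rational to make it a measurable function of the
  path.\<close>

definition path_diameter :: "(real \<Rightarrow> 'b::metric_space) \<Rightarrow> real \<Rightarrow> ennreal" where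
  "path_diameter w t = (SUP (p, q) \<in> (\<rat> \<inter> {0..<t}) \<times> (\<rat> \<inter> {0..<t}). ennreal (dist (w p) (w q)))"

lemma path_diameter_gt_iff:
  fixes w :: "real \<Rightarrow> 'b::metric_space"
  assumes w: "continuous_on {0..} w" and r: "0 \<le> r"
  shows "ennreal r < path_diameter w t \<longleftrightarrow>
    (\<exists>s s'. 0 \<le> s \<and> s < t \<and> 0 \<le> s' \<and> s' < t \<and> dist (w s) (w s') > r)"
proof
  assume "ennreal r < path_diameter w t"
  then obtain p q where pq: "p \<in> \<rat> \<inter> {0..<t}" "q \<in> \<rat> \<inter> {0..<t}" "ennreal r < ennreal (dist (w p) (w q))"
    unfolding path_diameter_def less_SUP_iff by auto
  then show "\<exists>s s'. 0 \<le> s \<and> s < t \<and> 0 \<le> s' \<and> s' < t \<and> dist (w s) (w s') > r"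
    using r by (intro exI[of _ p] exI[of _ q]) (auto simp: ennreal_less_iff)
next
  assume "\<exists>s s'. 0 \<le> s \<and> s < t \<and> 0 \<le> s' \<and> s' < t \<and> dist (w s) (w s') > r"
  then obtain p q where pq: "p \<in> \<rat> \<inter> {0..<t}" "q \<in> \<rat> \<inter> {0..<t}" "dist (w p) (w q) > r"
    using dist_gt_rational[OF w] by blast
  then have "ennreal r < ennreal (dist (w p) (w q))" using r by (simp add: ennreal_less_iff)
  also have "\<dots> \<le> path_diameter w t"
    unfolding path_diameter_def using pq by (intro SUP_upper2[of "(p, q)"]) auto
  finally show "ennreal r < path_diameter w t" .
qed

lemma path_diameter_finite:
  fixes w :: "real \<Rightarrow> 'b::metric_space"
  assumes w: "continuous_on {0..} w"
  shows "path_diameter w t < \<top>"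
proof -
  have "continuous_on {0..t} w" using w by (rule continuous_on_subset) auto
  then have "bounded (w ` {0..t})" by (intro compact_imp_bounded compact_continuous_image) auto
  then have "dist (w p) (w q) \<le> diameter (w ` {0..t})" if "p \<in> {0..t}" "q \<in> {0..t}" for p q
    using that by (intro diameter_bounded_bound) auto
  then have "path_diameter w t \<le> ennreal (diameter (w ` {0..t}))"
    unfolding path_diameter_def by (intro SUP_least) (auto intro!: ennreal_leI)
  then show ?thesis using ennreal_less_top order_le_less_trans by blast
qed

text \<open>Scaling path by path: in the rescaled path time runs u times as fast and space shrinks
  by sqrt u, so a displacement above sqrt u before t becomes one above 1 before t / u.\<close>

lemma path_diameter_gt_sqrt_iff:
  fixes b :: "real \<Rightarrow> real"
  assumes b: "continuous_on {0..} b" and u: "0 < u"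
  shows "ennreal (sqrt u) < path_diameter b t \<longleftrightarrow> escape_time (\<lambda>s. b (u * s) / sqrt u) < ennreal (t / u)"
proof -
  have cont: "continuous_on {0..} (\<lambda>s. b (u * s) / sqrt u)"
    using u by (intro continuous_intros continuous_on_compose2[OF b]) auto
  have dist: "dist (b x / sqrt u) (b y / sqrt u) > 1 \<longleftrightarrow> dist (b x) (b y) > sqrt u" for x y
    using u by (simp add: dist_real_def abs_divide flip: diff_divide_distrib)
  have "ennreal (sqrt u) < path_diameter b t \<longleftrightarrow>
      (\<exists>s s'. 0 \<le> s \<and> s < t \<and> 0 \<le> s' \<and> s' < t \<and> dist (b s) (b s') > sqrt u)"
    using u by (intro path_diameter_gt_iff[OF b]) auto
  also have "\<dots> \<longleftrightarrow> (\<exists>s s'. 0 \<le> s \<and> s < t / u \<and> 0 \<le> s' \<and> s' < t / u \<and> dist (b (u * s)) (b (u * s')) > sqrt u)"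
  proof safe
    fix s s' assume "0 \<le> s" "s < t" "0 \<le> s'" "s' < t" "dist (b s) (b s') > sqrt u"
    then show "\<exists>s s'. 0 \<le> s \<and> s < t / u \<and> 0 \<le> s' \<and> s' < t / u \<and> dist (b (u * s)) (b (u * s')) > sqrt u"
      using u by (intro exI[of _ "s / u"] exI[of _ "s' / u"]) (auto simp: divide_strict_right_mono)
  next
    fix s s' assume "0 \<le> s" "s < t / u" "0 \<le> s'" "s' < t / u" "dist (b (u * s)) (b (u * s')) > sqrt u"
    then show "\<exists>s s'. 0 \<le> s \<and> s < t \<and> 0 \<le> s' \<and> s' < t \<and> dist (b s) (b s') > sqrt u"
      using u by (intro exI[of _ "u * s"] exI[of _ "u * s'"]) (auto simp: field_simps)
  qed
  also have "\<dots> \<longleftrightarrow> escape_time (\<lambda>s. b (u * s) / sqrt u) < ennreal (t / u)"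
    unfolding escape_time_less_iff[OF cont] dist ..
  finally show ?thesis .
qed

lemma borel_measurable_path_diameter:
  fixes W :: "real \<Rightarrow> 'a \<Rightarrow> 'b::{metric_space, second_countable_topology}"
  assumes "\<And>p. p \<in> \<rat> \<Longrightarrow> 0 \<le> p \<Longrightarrow> W p \<in> borel_measurable N"
  shows "(\<lambda>\<omega>. path_diameter (\<lambda>t. W t \<omega>) t) \<in> borel_measurable N"
  unfolding path_diameter_def
proof (rule borel_measurable_SUP)
  show "countable ((\<rat> \<inter> {0..<t}) \<times> (\<rat> \<inter> {0..<t}))"
    by (intro countable_SIGMA countable_Int1 countable_rat)
  fix x assume "x \<in> (\<rat> \<inter> {0..<t}) \<times> (\<rat> \<inter> {0..<t})"
  then obtain p q where x: "x = (p, q)" "p \<in> \<rat>" "0 \<le> p" "q \<in> \<rat>" "0 \<le> q" by auto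
  have [measurable]: "W p \<in> borel_measurable N" "W q \<in> borel_measurable N" using assms x by auto
  show "(\<lambda>\<omega>. case x of (p, q) \<Rightarrow> ennreal (dist (W p \<omega>) (W q \<omega>))) \<in> borel_measurable N"
    unfolding x by simp
qed

definition path_diameter_square :: "(real \<Rightarrow> 'a \<Rightarrow> 'b::metric_space) \<Rightarrow> real \<Rightarrow> 'a \<Rightarrow> real" where
  "path_diameter_square B t \<omega> = (enn2real (path_diameter (\<lambda>s. B s \<omega>) t))\<^sup>2"

text \<open>Scaling compares the tails at positive levels only. Right continuity of the distribution
  functions supplies the level 0, and nonnegativity the negative levels.\<close>

lemma (in prob_space) distr_eqI_upper_tails:
  assumes [measurable]: "X \<in> borel_measurable M" "Y \<in> borel_measurable M"
    and nonneg: "\<And>\<omega>. 0 \<le> X \<omega>" "\<And>\<omega>. 0 \<le> Y \<omega>"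
    and tails: "\<And>u. 0 < u \<Longrightarrow> prob {\<omega> \<in> space M. X \<omega> > u} = prob {\<omega> \<in> space M. Y \<omega> > u}"
  shows "distr M borel X = distr M borel (Y :: 'a \<Rightarrow> real)"
proof (rule cdf_unique)
  show RX: "real_distribution (distr M borel X)" and RY: "real_distribution (distr M borel Y)"
    by (auto intro: real_distribution_distr)
  have cdf: "cdf (distr M borel Z) x = prob {\<omega> \<in> space M. Z \<omega> \<le> x}"
    if [measurable]: "Z \<in> borel_measurable M" for Z x
    unfolding cdf_def by (subst measure_distr) (auto intro!: arg_cong[where f = prob])
  have pos: "cdf (distr M borel X) x = cdf (distr M borel Y) x" if "0 < x" for x
  proof -
    have "prob {\<omega> \<in> space M. Z \<omega> \<le> x} = 1 - prob {\<omega> \<in> space M. Z \<omega> > x}"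
      if [measurable]: "Z \<in> borel_measurable M" for Z :: "'a \<Rightarrow> real"
      by (subst prob_compl[symmetric]) (auto intro!: arg_cong[where f = prob])
    then show ?thesis using tails[OF that] by (simp add: cdf)
  qed
  have zero: "cdf (distr M borel X) 0 = cdf (distr M borel Y) 0"
  proof (rule tendsto_unique)
    interpret X: finite_borel_measure "distr M borel X" by (rule real_distribution.finite_borel_measure_M[OF RX])
    interpret Y: finite_borel_measure "distr M borel Y" by (rule real_distribution.finite_borel_measure_M[OF RY])
    show "(cdf (distr M borel X) \<longlongrightarrow> cdf (distr M borel X) 0) (at_right 0)"
      using X.cdf_is_right_cont[of 0] by (simp add: continuous_within)
    have "(cdf (distr M borel Y) \<longlongrightarrow> cdf (distr M borel Y) 0) (at_right 0)"
      using Y.cdf_is_right_cont[of 0] by (simp add: continuous_within)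
    then show "(cdf (distr M borel X) \<longlongrightarrow> cdf (distr M borel Y) 0) (at_right 0)"
      by (rule Lim_transform_eventually) (auto simp: eventually_at_right_less pos eventually_at_filter)
  qed simp
  show "cdf (distr M borel X) = cdf (distr M borel Y)"
  proof
    fix x :: real
    consider "x < 0" | "x = 0" | "0 < x" by linarith
    then show "cdf (distr M borel X) x = cdf (distr M borel Y) x"
    proof cases
      case 1
      then have "{\<omega> \<in> space M. X \<omega> \<le> x} = {}" "{\<omega> \<in> space M. Y \<omega> \<le> x} = {}"
        using nonneg by (auto simp: not_le intro: less_le_trans)
      then show ?thesis unfolding cdf[OF assms(1)] cdf[OF assms(2)] by (simp only:)
    qed (use zero pos in auto)
  qed
qed

lemma borel_measurable_path_diameter_square:
  assumes "standard_brownian_motion M B"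
  shows "path_diameter_square B t \<in> borel_measurable M"
proof -
  have [measurable]: "(\<lambda>\<omega>. path_diameter (\<lambda>s. B s \<omega>) t) \<in> borel_measurable M"
    by (rule borel_measurable_path_diameter) (rule standard_brownian_motionD(2)[OF assms])
  show ?thesis unfolding path_diameter_square_def[abs_def] by measurable
qed

text \<open>Brownian scaling together with the uniqueness of the law of the escape time turns
  \<open>R(t)\<^sup>2 > u\<close> into \<open>\<Theta> < t / u\<close>.\<close>

lemma path_diameter_square_law:
  assumes bm: "standard_brownian_motion M B" and t: "0 \<le> t"
  shows "distr M borel (path_diameter_square B t) = distr M borel (\<lambda>\<omega>. t / escape_real B \<omega>)"
proof -
  interpret prob_space M by (rule standard_brownian_motionD[OF bm])
  have [measurable]: "escape_real B \<in> borel_measurable M"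
    by (rule borel_measurable_escape_real[OF bm])
  have [measurable]: "path_diameter_square B t \<in> borel_measurable M"
    by (rule borel_measurable_path_diameter_square[OF bm])
  show ?thesis
  proof (rule distr_eqI_upper_tails)
    fix u :: real assume u: "0 < u"
    define B' where "B' = (\<lambda>s \<omega>. B (u * s) \<omega> / sqrt u)"
    have bm': "standard_brownian_motion M B'"
      unfolding B'_def by (rule standard_brownian_motion_scale[OF bm u])
    have [measurable]: "escape_real B' \<in> borel_measurable M"
      by (rule borel_measurable_escape_real[OF bm'])
    have "prob {\<omega> \<in> space M. path_diameter_square B t \<omega> > u} = prob {\<omega> \<in> space M. escape_real B' \<omega> < t / u}"
    proof (rule measure_eq_AE)
      show "AE \<omega> in M. \<omega> \<in> {\<omega> \<in> space M. path_diameter_square B t \<omega> > u} \<longleftrightarrow> \<omega> \<in> {\<omega> \<in> space M. escape_real B' \<omega> < t / u}"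
        using standard_brownian_motionD(3)[OF bm] AE_escape_real[OF bm']
      proof eventually_elim
        case (elim \<omega>)
        define d where "d = enn2real (path_diameter (\<lambda>s. B s \<omega>) t)"
        have d: "path_diameter (\<lambda>s. B s \<omega>) t = ennreal d" "0 \<le> d"
          using path_diameter_finite[OF elim(1), of t] by (auto simp: d_def)
        have "path_diameter_square B t \<omega> > u \<longleftrightarrow> d\<^sup>2 > u" by (simp add: path_diameter_square_def d_def)
        also have "\<dots> \<longleftrightarrow> sqrt u < d" using d(2) by (metis real_less_rsqrt real_sqrt_less_iff real_sqrt_unique sqrt_le_D not_le real_sqrt_abs abs_of_nonneg)
        also have "\<dots> \<longleftrightarrow> ennreal (sqrt u) < path_diameter (\<lambda>s. B s \<omega>) t"
          unfolding d(1) using u by (simp add: ennreal_less_iff)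
        also have "\<dots> \<longleftrightarrow> escape_time (\<lambda>s. B' s \<omega>) < ennreal (t / u)"
          unfolding B'_def by (rule path_diameter_gt_sqrt_iff[OF elim(1) u])
        also have "\<dots> \<longleftrightarrow> escape_real B' \<omega> < t / u"
          using elim(2) by (simp add: ennreal_less_iff escape_real_nonneg)
        finally show ?case by simp
      qed
    qed measurable
    also have "\<dots> = measure (distr M borel (escape_real B')) {..< t / u}"
      by (subst measure_distr) (auto intro!: arg_cong[where f = prob])
    also have "\<dots> = measure (distr M borel (escape_real B)) {..< t / u}"
      by (simp only: bm_escape_law_unique[OF bm' bm])
    also have "\<dots> = prob {\<omega> \<in> space M. escape_real B \<omega> < t / u}"
      by (subst measure_distr) (auto intro!: arg_cong[where f = prob])
    also have "\<dots> = prob {\<omega> \<in> space M. t / escape_real B \<omega> > u}"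
    proof (rule measure_eq_AE)
      show "AE \<omega> in M. \<omega> \<in> {\<omega> \<in> space M. escape_real B \<omega> < t / u} \<longleftrightarrow> \<omega> \<in> {\<omega> \<in> space M. t / escape_real B \<omega> > u}"
        using AE_escape_real[OF bm] by eventually_elim (use u in \<open>simp add: field_simps\<close>)
    qed measurable
    finally show "prob {\<omega> \<in> space M. path_diameter_square B t \<omega> > u} = prob {\<omega> \<in> space M. t / escape_real B \<omega> > u}" .
  qed (use t in \<open>auto simp: path_diameter_square_def escape_real_nonneg\<close>)
qed

text \<open>Under independence the joint law is the product of the marginals, so equal marginals
  give equal laws of the sum.\<close>

lemma (in prob_space) indep_var_prob_sum_le:
  fixes X Y X' Y' :: "'a \<Rightarrow> real"
  assumes ind: "indep_var borel X borel Y" "indep_var borel X' borel Y'"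
    and law: "distr M borel X = distr M borel X'" "distr M borel Y = distr M borel Y'"
  shows "prob {\<omega> \<in> space M. X \<omega> + Y \<omega> \<le> a} = prob {\<omega> \<in> space M. X' \<omega> + Y' \<omega> \<le> a}"
proof -
  have rv [measurable]: "X \<in> borel_measurable M" "Y \<in> borel_measurable M" "X' \<in> borel_measurable M" "Y' \<in> borel_measurable M"
    using ind by (auto dest: indep_var_rv1 indep_var_rv2)
  have "prob {\<omega> \<in> space M. U \<omega> + V \<omega> \<le> a} = measure (distr M borel U \<Otimes>\<^sub>M distr M borel V) {(x, y). x + y \<le> a}"
    if ind: "indep_var borel U borel V" for U V :: "'a \<Rightarrow> real"
  proof -
    have [measurable]: "U \<in> borel_measurable M" "V \<in> borel_measurable M"
      using ind by (auto dest: indep_var_rv1 indep_var_rv2)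
    have [measurable]: "{(x, y). x + y \<le> a} \<in> sets (borel \<Otimes>\<^sub>M borel :: (real \<times> real) measure)"
    proof -
      have "{p \<in> space (borel \<Otimes>\<^sub>M borel). fst p + snd p \<le> a} \<in> sets (borel \<Otimes>\<^sub>M borel :: (real \<times> real) measure)"
        by measurable
      then show ?thesis by (simp add: space_pair_measure case_prod_unfold)
    qed
    have "distr M borel U \<Otimes>\<^sub>M distr M borel V = distr M (borel \<Otimes>\<^sub>M borel) (\<lambda>x. (U x, V x))"
      using ind unfolding indep_var_distribution_eq by simp
    then show ?thesis
      by (simp add: measure_distr) (auto intro!: arg_cong[where f = prob])
  qed
  from this[OF ind(1)] this[OF ind(2)] law show ?thesis by simp
qed

subsection \<open>Two independent Brownian motions\<close>

text \<open>Product-to-sum formula: the two arguments add up to t and differ by i t, which is how a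
  hyperbolic and a trigonometric cosine come to stand side by side in \<open>frak_r\<close>.\<close>

lemma cosh_mult_cosh_cnj:
  "cosh (Complex t t / 2) * cosh (Complex t (- t) / 2) = complex_of_real ((cos t + cosh t) / 2)"
proof -
  define a b where "a = Complex t t / 2" and "b = Complex t (- t) / 2"
  have "cosh (a + b) + cosh (a - b) = 2 * (cosh a * cosh b)"
    by (simp add: cosh_add cosh_diff)
  moreover have "a + b = complex_of_real t" "a - b = \<i> * complex_of_real t"
    by (simp_all add: a_def b_def complex_eq_iff)
  moreover have "cosh (complex_of_real t) = complex_of_real (cosh t)"
    by (simp add: cosh_def scaleR_conv_of_real flip: exp_of_real)
  moreover have "cosh (\<i> * complex_of_real t) = complex_of_real (cos t)"
    by (simp add: cosh_conv_cos cos_of_real flip: mult.assoc)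
  ultimately have "complex_of_real (cosh t) + complex_of_real (cos t) = 2 * (cosh a * cosh b)" by simp
  then show ?thesis unfolding a_def b_def by (simp add: algebra_simps)
qed

locale independent_brownian_pair = prob_space +
  fixes B1 B2 :: "real \<Rightarrow> 'a \<Rightarrow> real"
  assumes bm1: "standard_brownian_motion M B1" and bm2: "standard_brownian_motion M B2"
    and indep_paths: "indep_var (PiM {0..} (\<lambda>_. borel)) (\<lambda>\<omega>. \<lambda>t\<in>{0..}. B1 t \<omega>)
       (PiM {0..} (\<lambda>_. borel)) (\<lambda>\<omega>. \<lambda>t\<in>{0..}. B2 t \<omega>)"
begin

abbreviation "T1 \<equiv> escape_real B1"
abbreviation "T2 \<equiv> escape_real B2"

lemma T_measurable [measurable]: "T1 \<in> borel_measurable M" "T2 \<in> borel_measurable M"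
  by (rule borel_measurable_escape_real[OF bm1] borel_measurable_escape_real[OF bm2])+

text \<open>\<open>restr\<close> says that \<open>F\<close> does not look at negative times, where
  the path variables of \<open>indep_paths\<close> are \<open>undefined\<close>.\<close>

lemma indep_path_functionals:
  assumes F: "F \<in> borel_measurable (PiM {0..} (\<lambda>_. borel))"
    and restr: "\<And>w. F (restrict w {0..}) = F w"
  shows "indep_var borel (\<lambda>\<omega>. F (\<lambda>t. B1 t \<omega>)) borel (\<lambda>\<omega>. F (\<lambda>t. B2 t \<omega>))"
  using indep_var_compose[OF indep_paths F F] by (simp add: comp_def restr)

lemma indep_T: "indep_var borel T1 borel T2"
proof -
  have "(\<lambda>w. escape_time (\<lambda>t. w t)) \<in> borel_measurable (PiM {0..} (\<lambda>_. borel :: real measure))"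
    by (rule borel_measurable_escape_time) (rule measurable_component_singleton, simp)
  then have "(\<lambda>w. enn2real (escape_time w)) \<in> borel_measurable (PiM {0..} (\<lambda>_. borel :: real measure))"
    by measurable
  moreover have "escape_time (restrict w {0..}) = escape_time w" for w :: "real \<Rightarrow> real"
    unfolding escape_time_def by (rule INF_cong) auto
  ultimately show ?thesis
    using indep_path_functionals[of "\<lambda>w. enn2real (escape_time w)"]
    by (simp add: escape_real_def[abs_def])
qed

lemma indep_path_diameter_square:
  "indep_var borel (path_diameter_square B1 t) borel (path_diameter_square B2 t)"
proof -
  have "(\<lambda>w. path_diameter (\<lambda>t. w t) t) \<in> borel_measurable (PiM {0..} (\<lambda>_. borel :: real measure))"
    by (rule borel_measurable_path_diameter) (rule measurable_component_singleton, simp)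
  then have "(\<lambda>w. (enn2real (path_diameter w t))\<^sup>2) \<in> borel_measurable (PiM {0..} (\<lambda>_. borel :: real measure))"
    by measurable
  moreover have "path_diameter (restrict w {0..}) t = path_diameter w t" for w :: "real \<Rightarrow> real"
    unfolding path_diameter_def by (rule SUP_cong) auto
  ultimately show ?thesis
    using indep_path_functionals[of "\<lambda>w. (enn2real (path_diameter w t))\<^sup>2"]
    by (simp add: path_diameter_square_def[abs_def])
qed

text \<open>\<open>f\<close> and \<open>g\<close> are characters at the frequencies -t^2 and t^2,
  obtained from the conjugate boundary points t + i t and t - i t of the sector. Independence
  factors the mean of their product, whose real part is the cosine.\<close>

lemma expectation_cos_difference:
  assumes t: "0 < t"
  shows "expectation (\<lambda>\<omega>. cos (t\<^sup>2 * (T1 \<omega> - T2 \<omega>))) = 4 / (cos t + cosh t)\<^sup>2"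
proof -
  define f where "f = (\<lambda>x::real. exp (- ((Complex t t)\<^sup>2 / 2 * complex_of_real x)))"
  define g where "g = (\<lambda>x::real. exp (- ((Complex t (- t))\<^sup>2 / 2 * complex_of_real x)))"
  have sq: "(Complex t t)\<^sup>2 / 2 = \<i> * complex_of_real (t\<^sup>2)" "(Complex t (- t))\<^sup>2 / 2 = - \<i> * complex_of_real (t\<^sup>2)"
    by (simp_all add: complex_eq_iff power2_eq_square)
  have [measurable]: "f \<in> borel_measurable borel" "g \<in> borel_measurable borel"
    unfolding f_def g_def by measurable
  have ind: "indep_var borel (\<lambda>\<omega>. f (T1 \<omega>)) borel (\<lambda>\<omega>. g (T2 \<omega>))"
    using indep_var_compose[OF indep_T, of f borel g borel] by (simp add: comp_def)
  have norm_le: "norm (f x) \<le> 1" "norm (g x) \<le> 1" for x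
    unfolding f_def g_def sq by simp_all
  have int: "integrable M (\<lambda>\<omega>. f (T1 \<omega>))" "integrable M (\<lambda>\<omega>. g (T2 \<omega>))"
    by (rule integrable_const_bound[of _ 1]; use norm_le in simp)+
  have prod: "f x * g y = exp (\<i> * complex_of_real (t\<^sup>2 * (y - x)))" for x y
    unfolding f_def g_def sq exp_add[symmetric]
    by (rule arg_cong[where f = exp]) (simp add: algebra_simps)
  have Re_prod: "Re (f x * g y) = cos (t\<^sup>2 * (x - y))" for x y
  proof -
    have "Re (f x * g y) = cos (t\<^sup>2 * (y - x))" unfolding prod by (simp add: Re_exp)
    also have "\<dots> = cos (t\<^sup>2 * (x - y))" by (metis cos_minus minus_diff_eq mult_minus_right)
    finally show ?thesis .
  qed
  let ?c = "complex_of_real ((cos t + cosh t) / 2)"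
  have "expectation (\<lambda>\<omega>. f (T1 \<omega>)) * cosh (Complex t t / 2) ^ 2 = 1"
    unfolding f_def using t by (intro bm_escape_transform[OF bm1]) auto
  moreover have "expectation (\<lambda>\<omega>. g (T2 \<omega>)) * cosh (Complex t (- t) / 2) ^ 2 = 1"
    unfolding g_def using t by (intro bm_escape_transform[OF bm2]) auto
  ultimately have "expectation (\<lambda>\<omega>. f (T1 \<omega>)) * expectation (\<lambda>\<omega>. g (T2 \<omega>)) *
      (cosh (Complex t t / 2) * cosh (Complex t (- t) / 2)) ^ 2 = 1"
    by (metis mult.assoc mult.left_commute mult_1 power_mult_distrib)
  then have "expectation (\<lambda>\<omega>. f (T1 \<omega>) * g (T2 \<omega>)) * ?c\<^sup>2 = 1"
    unfolding cosh_mult_cosh_cnj indep_var_lebesgue_integral[OF ind int] .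
  then have "expectation (\<lambda>\<omega>. f (T1 \<omega>) * g (T2 \<omega>)) = 1 / ?c\<^sup>2"
    by (metis mult_zero_right nonzero_eq_divide_eq zero_neq_one)
  then have E: "expectation (\<lambda>\<omega>. f (T1 \<omega>) * g (T2 \<omega>)) = complex_of_real (4 / (cos t + cosh t)\<^sup>2)"
    by (simp add: power_divide)
  have "expectation (\<lambda>\<omega>. cos (t\<^sup>2 * (T1 \<omega> - T2 \<omega>))) = Re (expectation (\<lambda>\<omega>. f (T1 \<omega>) * g (T2 \<omega>)))"
    unfolding Re_prod[symmetric] by (rule integral_Re[OF indep_var_integrable[OF ind int]])
  then show ?thesis unfolding E by (simp only: Re_complex_of_real)
qed

lemma integrable_T: "integrable M T1" "integrable M T2"
  and expectation_T: "expectation T1 = 1 / 2" "expectation T2 = 1 / 2"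
proof -
  have "integrable M T" "expectation T = 1 / 2"
    if bm: "standard_brownian_motion M B" and T: "T = escape_real B" for B :: "real \<Rightarrow> 'a \<Rightarrow> real" and T
  proof -
    have [measurable]: "T \<in> borel_measurable M" unfolding T by (rule borel_measurable_escape_real[OF bm])
    have "(\<integral>\<^sup>+\<omega>. ennreal (T \<omega>) \<partial>M) < \<infinity>" unfolding T bm_escape_mean[OF bm] infinity_ennreal_def by (rule ennreal_less_top)
    then show "integrable M T"
      by (intro integrableI_nonneg) (simp_all add: T escape_real_nonneg borel_measurable_escape_real[OF bm])
    have "expectation T = enn2real (\<integral>\<^sup>+\<omega>. ennreal (T \<omega>) \<partial>M)"
      by (rule integral_eq_nn_integral) (simp_all add: T escape_real_nonneg borel_measurable_escape_real[OF bm])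
    also have "\<dots> = 1 / 2" unfolding T bm_escape_mean[OF bm] by (rule enn2real_ennreal) simp
    finally show "expectation T = 1 / 2" .
  qed
  then show "integrable M T1" "integrable M T2" "expectation T1 = 1 / 2" "expectation T2 = 1 / 2"
    using bm1 bm2 by blast+
qed

text \<open>The integrand is the mean of the nonnegative quantity (1 - cos (t^2 (T1 - T2))) / t^3.
  Tonelli's theorem therefore allows integrating over t first, where
  \<open>nn_integral_one_minus_cos_cube\<close> applies.\<close>

lemma expectation_abs_difference:
  "(LINT t:{0<..}|lborel. (1 - 4 / (cos t + cosh t)\<^sup>2) * (1 / t ^ 3)) = pi / 4 * expectation (\<lambda>\<omega>. \<bar>T1 \<omega> - T2 \<omega>\<bar>)"
proof -
  interpret P: pair_sigma_finite M lborel ..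
  define g where "g = (\<lambda>t::real. indicator {0<..} t * ((1 - 4 / (cos t + cosh t)\<^sup>2) * (1 / t ^ 3)))"
  have [measurable]: "(\<lambda>t::real. cosh t) \<in> borel_measurable borel"
    by (auto intro!: borel_measurable_continuous_onI continuous_intros)
  have [measurable]: "g \<in> borel_measurable lborel" unfolding g_def by measurable
  have int_cos: "integrable M (\<lambda>\<omega>. cos (t\<^sup>2 * (T1 \<omega> - T2 \<omega>)))" for t
    by (rule integrable_const_bound[of _ 1]) auto
  have inner: "(\<integral>\<^sup>+\<omega>. ennreal ((1 - cos (t\<^sup>2 * (T1 \<omega> - T2 \<omega>))) / t ^ 3) * indicator {0<..} t \<partial>M) = ennreal (g t)"
    and g_nonneg: "0 \<le> g t" for t
  proof -
    have E: "expectation (\<lambda>\<omega>. (1 - cos (t\<^sup>2 * (T1 \<omega> - T2 \<omega>))) / t ^ 3) = g t" if "0 < t"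
      using that int_cos expectation_cos_difference[OF that] by (simp add: g_def prob_space)
    show "0 \<le> g t"
    proof (cases "0 < t")
      case True
      then show ?thesis unfolding E[OF True, symmetric] by (intro integral_nonneg_AE AE_I2) simp
    qed (simp add: g_def)
    show "(\<integral>\<^sup>+\<omega>. ennreal ((1 - cos (t\<^sup>2 * (T1 \<omega> - T2 \<omega>))) / t ^ 3) * indicator {0<..} t \<partial>M) = ennreal (g t)"
    proof (cases "0 < t")
      case True
      then have "(\<integral>\<^sup>+\<omega>. ennreal ((1 - cos (t\<^sup>2 * (T1 \<omega> - T2 \<omega>))) / t ^ 3) \<partial>M) = ennreal (g t)"
        unfolding E[OF True, symmetric] using int_cos by (intro nn_integral_eq_integral) auto
      then show ?thesis using True by simp
    qed (simp add: g_def)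
  qed
  have "(\<integral>\<^sup>+t. ennreal (g t) \<partial>lborel) =
      (\<integral>\<^sup>+\<omega>. \<integral>\<^sup>+t. ennreal ((1 - cos (t\<^sup>2 * (T1 \<omega> - T2 \<omega>))) / t ^ 3) * indicator {0<..} t \<partial>lborel \<partial>M)"
    unfolding inner[symmetric] by (rule P.Fubini') measurable
  also have "\<dots> = (\<integral>\<^sup>+\<omega>. ennreal (pi / 4 * \<bar>T1 \<omega> - T2 \<omega>\<bar>) \<partial>M)"
    unfolding nn_integral_one_minus_cos_cube ..
  also have "\<dots> = ennreal (pi / 4 * expectation (\<lambda>\<omega>. \<bar>T1 \<omega> - T2 \<omega>\<bar>))"
    using integrable_T by (subst nn_integral_eq_integral) auto
  finally have "enn2real (\<integral>\<^sup>+t. ennreal (g t) \<partial>lborel) = pi / 4 * expectation (\<lambda>\<omega>. \<bar>T1 \<omega> - T2 \<omega>\<bar>)"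
    by simp
  moreover have "integral\<^sup>L lborel g = enn2real (\<integral>\<^sup>+t. ennreal (g t) \<partial>lborel)"
    by (rule integral_eq_nn_integral) (auto simp: g_nonneg)
  ultimately show ?thesis by (simp add: set_lebesgue_integral_def g_def)
qed

text \<open>From min a b = (a + b - |a - b|) / 2: the means 1/2 give the leading 1/2, and 2 / pi
  times pi / 4 is the factor 1/2 of the absolute difference.\<close>

lemma expectation_min: "(\<integral>\<^sup>+\<omega>. ennreal (min (T1 \<omega>) (T2 \<omega>)) \<partial>M) = ennreal frak_r"
proof -
  have "(\<integral>\<^sup>+\<omega>. ennreal (min (T1 \<omega>) (T2 \<omega>)) \<partial>M) = ennreal (expectation (\<lambda>\<omega>. min (T1 \<omega>) (T2 \<omega>)))"
    using integrable_T by (intro nn_integral_eq_integral integrable_min) (auto simp: escape_real_nonneg)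
  also have "expectation (\<lambda>\<omega>. min (T1 \<omega>) (T2 \<omega>)) = expectation (\<lambda>\<omega>. (T1 \<omega> + T2 \<omega> - \<bar>T1 \<omega> - T2 \<omega>\<bar>) / 2)"
    by (intro Bochner_Integration.integral_cong) (auto simp: min_def)
  also have "\<dots> = frak_r"
    unfolding frak_r_def expectation_abs_difference
    using integrable_T by (simp add: expectation_T field_simps)
  finally show ?thesis .
qed

text \<open>Jensen's inequality for \<open>1 / V\<close> with \<open>V = 1 / T1 + 1 / T2\<close>, in the tangent form
  \<open>1 / V + c\<^sup>2 V \<ge> 2 c\<close>.\<close>

lemma expectation_harmonic_ge:
  "ennreal (1 / (8 * ln 2)) \<le> (\<integral>\<^sup>+\<omega>. ennreal (1 / (1 / T1 \<omega> + 1 / T2 \<omega>)) \<partial>M)"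
proof -
  \<comment> \<open>The tangent is taken at the mean of \<open>V\<close>, which is 4 ln 2 + 4 ln 2 =
    1 / c.\<close>
  define c :: real where "c = 1 / (8 * ln 2)"
  have c: "0 < c" by (simp add: c_def)
  define V where "V = (\<lambda>\<omega>. 1 / T1 \<omega> + 1 / T2 \<omega>)"
  have [measurable]: "V \<in> borel_measurable M" unfolding V_def by measurable
  have "(\<integral>\<^sup>+\<omega>. ennreal (V \<omega>) \<partial>M) = (\<integral>\<^sup>+\<omega>. ennreal (1 / T1 \<omega>) + ennreal (1 / T2 \<omega>) \<partial>M)"
    by (intro nn_integral_cong) (simp add: V_def ennreal_plus escape_real_nonneg)
  also have "\<dots> = ennreal (4 * ln 2) + ennreal (4 * ln 2)"
    by (subst nn_integral_add) (auto simp: bm_escape_inverse_mean[OF bm1] bm_escape_inverse_mean[OF bm2])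
  also have "\<dots> = ennreal (1 / c)" by (simp add: c_def flip: ennreal_plus)
  finally have EV: "(\<integral>\<^sup>+\<omega>. ennreal (V \<omega>) \<partial>M) = ennreal (1 / c)" .
  have "ennreal (2 * c) = (\<integral>\<^sup>+\<omega>. ennreal (2 * c) \<partial>M)"
    by (simp add: emeasure_space_1)
  also have "\<dots> \<le> (\<integral>\<^sup>+\<omega>. ennreal (1 / V \<omega>) + ennreal (c\<^sup>2) * ennreal (V \<omega>) \<partial>M)"
  proof (rule nn_integral_mono_AE)
    show "AE \<omega> in M. ennreal (2 * c) \<le> ennreal (1 / V \<omega>) + ennreal (c\<^sup>2) * ennreal (V \<omega>)"
      using AE_escape_real[OF bm1] AE_escape_real[OF bm2]
    proof eventually_elim
      case (elim \<omega>)
      then have V: "0 < V \<omega>" by (simp add: V_def add_pos_pos)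
      have "0 \<le> (1 - c * V \<omega>)\<^sup>2 / V \<omega>" using V by simp
      also have "(1 - c * V \<omega>)\<^sup>2 / V \<omega> = 1 / V \<omega> + c\<^sup>2 * V \<omega> - 2 * c"
        using V by (simp add: field_simps power2_eq_square)
      finally have "ennreal (2 * c) \<le> ennreal (1 / V \<omega> + c\<^sup>2 * V \<omega>)" by (intro ennreal_leI) simp
      then show ?case using V c by (simp add: ennreal_plus ennreal_mult)
    qed
  qed
  also have "\<dots> = (\<integral>\<^sup>+\<omega>. ennreal (1 / V \<omega>) \<partial>M) + ennreal (c\<^sup>2) * ennreal (1 / c)"
    by (subst nn_integral_add) (auto simp: nn_integral_cmult EV)
  also have "ennreal (c\<^sup>2) * ennreal (1 / c) = ennreal c"
    using c by (simp add: power2_eq_square flip: ennreal_mult)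
  finally have le: "ennreal (2 * c) \<le> (\<integral>\<^sup>+\<omega>. ennreal (1 / V \<omega>) \<partial>M) + ennreal c" .
  have "ennreal c \<le> (\<integral>\<^sup>+\<omega>. ennreal (1 / V \<omega>) \<partial>M)"
  proof (cases "\<integral>\<^sup>+\<omega>. ennreal (1 / V \<omega>) \<partial>M")
    case (real r)
    then show ?thesis using le c by (simp flip: ennreal_plus)
  qed simp
  then show ?thesis by (simp only: c_def V_def)
qed

text \<open>For a fixed \<open>t\<close> the two squared ranges are replaced by the independent pair
  t / T1, t / T2, and t (1 / T1 + 1 / T2) \<le> 1 is then solved for t. The result is used for one
  \<open>t\<close> at a time, inside a tail integral.\<close>

lemma prob_path_diameter_square:
  assumes t: "0 < t"
  shows "prob {\<omega> \<in> space M. path_diameter_square B1 t \<omega> + path_diameter_square B2 t \<omega> \<le> 1} =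
    prob {\<omega> \<in> space M. t \<le> 1 / (1 / T1 \<omega> + 1 / T2 \<omega>)}"
proof -
  have "indep_var borel (\<lambda>\<omega>. t / T1 \<omega>) borel (\<lambda>\<omega>. t / T2 \<omega>)"
    using indep_var_compose[OF indep_T, of "\<lambda>x. t / x" borel "\<lambda>x. t / x" borel] by (simp add: comp_def)
  then have "prob {\<omega> \<in> space M. path_diameter_square B1 t \<omega> + path_diameter_square B2 t \<omega> \<le> 1} =
      prob {\<omega> \<in> space M. t / T1 \<omega> + t / T2 \<omega> \<le> 1}"
    using t by (intro indep_var_prob_sum_le indep_path_diameter_square path_diameter_square_law bm1 bm2) auto
  also have "\<dots> = prob {\<omega> \<in> space M. t \<le> 1 / (1 / T1 \<omega> + 1 / T2 \<omega>)}"
  proof (rule measure_eq_AE)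
    show "AE \<omega> in M. \<omega> \<in> {\<omega> \<in> space M. t / T1 \<omega> + t / T2 \<omega> \<le> 1} \<longleftrightarrow>
        \<omega> \<in> {\<omega> \<in> space M. t \<le> 1 / (1 / T1 \<omega> + 1 / T2 \<omega>)}"
      using AE_escape_real[OF bm1] AE_escape_real[OF bm2]
    proof eventually_elim
      case (elim \<omega>)
      then have "0 < 1 / T1 \<omega> + 1 / T2 \<omega>" by (simp add: add_pos_pos)
      then have "t \<le> 1 / (1 / T1 \<omega> + 1 / T2 \<omega>) \<longleftrightarrow> t * (1 / T1 \<omega> + 1 / T2 \<omega>) \<le> 1"
        by (simp only: pos_le_divide_eq)
      then show ?case by (simp add: distrib_left)
    qed
  qed measurable
  finally show ?thesis .
qed

text \<open>Both expectations are integrals over t of the probability of lasting at least until t.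
  For each t, small squared ranges force \<Theta> to last that long, and by
  \<open>prob_path_diameter_square\<close> they are as likely as t \<le> \<open>H\<close>.\<close>

lemma layer_cake_lower_bound:
  assumes \<Theta> [measurable]: "\<Theta> \<in> borel_measurable M"
    and late: "\<And>t. 0 < t \<Longrightarrow> AE \<omega> in M. path_diameter_square B1 t \<omega> + path_diameter_square B2 t \<omega> \<le> 1 \<longrightarrow> ennreal t \<le> \<Theta> \<omega>"
  shows "ennreal (1 / (8 * ln 2)) \<le> (\<integral>\<^sup>+\<omega>. \<Theta> \<omega> \<partial>M)"
proof -
  interpret P: pair_sigma_finite M lborel ..
  define H where "H = (\<lambda>\<omega>. 1 / (1 / T1 \<omega> + 1 / T2 \<omega>))"
  have [measurable]: "H \<in> borel_measurable M" unfolding H_def by measurable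
  have [measurable]: "path_diameter_square B1 t \<in> borel_measurable M" "path_diameter_square B2 t \<in> borel_measurable M" for t
    by (rule borel_measurable_path_diameter_square[OF bm1] borel_measurable_path_diameter_square[OF bm2])+
  have "(\<integral>\<^sup>+\<omega>. ennreal (H \<omega>) \<partial>M) = (\<integral>\<^sup>+\<omega>. \<integral>\<^sup>+t. (if 0 < t \<and> t \<le> H \<omega> then 1 else 0) \<partial>lborel \<partial>M)"
  proof (rule nn_integral_cong)
    fix \<omega>
    have "0 \<le> H \<omega>" by (simp add: H_def escape_real_nonneg)
    have "(\<integral>\<^sup>+t. (if 0 < t \<and> t \<le> H \<omega> then 1 else 0) \<partial>lborel) = (\<integral>\<^sup>+t. indicator {0<..H \<omega>} t \<partial>lborel)"
      by (intro nn_integral_cong) (auto simp: indicator_def)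
    then show "ennreal (H \<omega>) = (\<integral>\<^sup>+t. (if 0 < t \<and> t \<le> H \<omega> then 1 else 0) \<partial>lborel)"
      using \<open>0 \<le> H \<omega>\<close> by simp
  qed
  also have "\<dots> = (\<integral>\<^sup>+t. \<integral>\<^sup>+\<omega>. (if 0 < t \<and> t \<le> H \<omega> then 1 else 0) \<partial>M \<partial>lborel)"
    by (rule P.Fubini'[symmetric]) measurable
  also have "\<dots> \<le> (\<integral>\<^sup>+t. \<integral>\<^sup>+\<omega>. (if 0 < t \<and> ennreal t \<le> \<Theta> \<omega> then 1 else 0) \<partial>M \<partial>lborel)"
  proof (rule nn_integral_mono)
    fix t :: real
    show "(\<integral>\<^sup>+\<omega>. (if 0 < t \<and> t \<le> H \<omega> then 1 else 0) \<partial>M) \<le> (\<integral>\<^sup>+\<omega>. (if 0 < t \<and> ennreal t \<le> \<Theta> \<omega> then 1 else 0) \<partial>M)"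
    proof (cases "0 < t")
      case True
      have "(\<integral>\<^sup>+\<omega>. (if 0 < t \<and> t \<le> H \<omega> then 1 else 0) \<partial>M) = (\<integral>\<^sup>+\<omega>. indicator {\<omega> \<in> space M. t \<le> H \<omega>} \<omega> \<partial>M)"
        using True by (intro nn_integral_cong) (auto simp: indicator_def)
      also have "\<dots> = emeasure M {\<omega> \<in> space M. t \<le> H \<omega>}" by simp
      also have "\<dots> = emeasure M {\<omega> \<in> space M. path_diameter_square B1 t \<omega> + path_diameter_square B2 t \<omega> \<le> 1}"
        using prob_path_diameter_square[OF True] by (simp add: emeasure_eq_measure H_def)
      also have "\<dots> = (\<integral>\<^sup>+\<omega>. indicator {\<omega> \<in> space M. path_diameter_square B1 t \<omega> + path_diameter_square B2 t \<omega> \<le> 1} \<omega> \<partial>M)"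
        by simp
      also have "\<dots> \<le> (\<integral>\<^sup>+\<omega>. (if 0 < t \<and> ennreal t \<le> \<Theta> \<omega> then 1 else 0) \<partial>M)"
      proof (rule nn_integral_mono_AE)
        show "AE \<omega> in M. indicator {\<omega> \<in> space M. path_diameter_square B1 t \<omega> + path_diameter_square B2 t \<omega> \<le> 1} \<omega> \<le>
            (if 0 < t \<and> ennreal t \<le> \<Theta> \<omega> then 1 else 0 :: ennreal)"
          using late[OF True] by eventually_elim (use True in \<open>auto simp: indicator_def\<close>)
      qed
      finally show ?thesis .
    qed simp
  qed
  also have "\<dots> = (\<integral>\<^sup>+\<omega>. \<integral>\<^sup>+t. (if 0 < t \<and> ennreal t \<le> \<Theta> \<omega> then 1 else 0) \<partial>lborel \<partial>M)"
    by (rule P.Fubini') measurable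
  also have "\<dots> \<le> (\<integral>\<^sup>+\<omega>. \<Theta> \<omega> \<partial>M)"
  proof (rule nn_integral_mono)
    fix \<omega>
    show "(\<integral>\<^sup>+t. (if 0 < t \<and> ennreal t \<le> \<Theta> \<omega> then 1 else 0) \<partial>lborel) \<le> \<Theta> \<omega>"
    proof (cases "\<Theta> \<omega>")
      case (real r)
      have "(\<integral>\<^sup>+t. (if 0 < t \<and> ennreal t \<le> \<Theta> \<omega> then 1 else 0) \<partial>lborel) = (\<integral>\<^sup>+t. indicator {0<..r} t \<partial>lborel)"
        using real by (intro nn_integral_cong) (auto simp: indicator_def)
      then show ?thesis using real by simp
    qed simp
  qed
  finally show ?thesis using expectation_harmonic_ge by (simp add: H_def)
qed

end

section \<open>The planar process\<close>

lemma dist_vec2_square: "(dist x y)\<^sup>2 = (dist (x $ 1) (y $ 1))\<^sup>2 + (dist (x $ 2) (y $ 2))\<^sup>2"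
  for x y :: "real ^ 2"
  by (simp add: dist_vec_def L2_set_def UNIV_2)

theorem proposition1p9:
  fixes M :: "'a measure" and W :: "real \<Rightarrow> 'a \<Rightarrow> real ^ 2"
  assumes "standard_planar_brownian_motion M W"
  shows "ennreal (1 / (8 * ln 2)) \<le> (\<integral>\<^sup>+ \<omega>. Theta_D W \<omega> \<partial>M) \<and>
         (\<integral>\<^sup>+ \<omega>. Theta_D W \<omega> \<partial>M) \<le> ennreal frak_r \<and>
         ennreal frak_r = (\<integral>\<^sup>+ \<omega>. min (Theta_R W 1 \<omega>) (Theta_R W 2 \<omega>) \<partial>M)"
proof -
  define B where "B = (\<lambda>i t \<omega>. W t \<omega> $ i)"
  have bm: "standard_brownian_motion M (B i)" for i
    using assms by (simp add: standard_planar_brownian_motion_def B_def)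
  interpret prob_space M by (rule standard_brownian_motionD[OF bm])
  interpret independent_brownian_pair M "B 1" "B 2"
    by unfold_locales (use assms bm in \<open>auto simp: standard_planar_brownian_motion_def B_def\<close>)
  define \<Theta> where "\<Theta> = (\<lambda>\<omega>. escape_time (\<lambda>t. W t \<omega>))"
  have cont: "AE \<omega> in M. continuous_on {0..} (\<lambda>t. W t \<omega>) \<and> (\<forall>i. continuous_on {0..} (\<lambda>t. B i t \<omega>))"
    using standard_brownian_motionD(3)[OF bm[of 1]] standard_brownian_motionD(3)[OF bm[of 2]]
  proof eventually_elim
    case (elim \<omega>)
    then have "\<forall>i. continuous_on {0..} (\<lambda>t. B i t \<omega>)" by (simp add: forall_2)
    moreover from this have "continuous_on {0..} (\<lambda>t. \<chi> i. B i t \<omega>)"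
      by (intro continuous_on_vec_lambda) auto
    ultimately show ?case by (simp add: B_def)
  qed
  have D: "AE \<omega> in M. Theta_D W \<omega> = \<Theta> \<omega>"
    using cont by eventually_elim (simp add: Theta_D_def \<Theta>_def exceedance_time_diameter_process)
  have R: "AE \<omega> in M. min (Theta_R W 1 \<omega>) (Theta_R W 2 \<omega>) = ennreal (min (T1 \<omega>) (T2 \<omega>))"
    using cont AE_escape_real[OF bm1] AE_escape_real[OF bm2]
  proof eventually_elim
    case (elim \<omega>)
    have "Theta_R W i \<omega> = escape_time (\<lambda>t. B i t \<omega>)" for i
      using elim(1) by (simp add: Theta_R_def B_def exceedance_time_range_process)
    then show ?case using elim(2,3) by (simp add: min_def)
  qed
  have "W p \<in> borel_measurable M" if "0 \<le> p" for p
  proof -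
    have "(\<lambda>\<omega>. W p \<omega> \<bullet> i) \<in> borel_measurable M" if i: "i \<in> Basis" for i
    proof -
      obtain j where "i = axis j 1" using i by (auto simp: Basis_vec_def)
      then show ?thesis using standard_brownian_motionD(2)[OF bm[of j] \<open>0 \<le> p\<close>]
        by (simp add: inner_axis B_def)
    qed
    then show ?thesis by (subst borel_measurable_euclidean_space) auto
  qed
  then have \<Theta>_meas: "\<Theta> \<in> borel_measurable M"
    unfolding \<Theta>_def by (rule borel_measurable_escape_time)
  have lower: "ennreal (1 / (8 * ln 2)) \<le> (\<integral>\<^sup>+ \<omega>. \<Theta> \<omega> \<partial>M)"
  proof (rule layer_cake_lower_bound[OF \<Theta>_meas])
    fix t :: real assume t: "0 < t"
    show "AE \<omega> in M. path_diameter_square (B 1) t \<omega> + path_diameter_square (B 2) t \<omega> \<le> 1 \<longrightarrow> ennreal t \<le> \<Theta> \<omega>"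
      using cont
    proof eventually_elim
      case (elim \<omega>)
      show ?case
      \<comment> \<open>A planar displacement above 1 before \<open>t\<close> has coordinate
        displacements bounded by the two ranges, so Pythagoras would make the sum of the squared
        ranges exceed 1.\<close>
      proof (rule impI, rule ccontr)
        assume le: "path_diameter_square (B 1) t \<omega> + path_diameter_square (B 2) t \<omega> \<le> 1"
          and "\<not> ennreal t \<le> \<Theta> \<omega>"
        then obtain s s' where s: "0 \<le> s" "s < t" "0 \<le> s'" "s' < t" "dist (W s \<omega>) (W s' \<omega>) > 1"
          unfolding \<Theta>_def not_le using escape_time_less_iff[of "\<lambda>t. W t \<omega>" t] elim by blast
        have "(dist (B i s \<omega>) (B i s' \<omega>))\<^sup>2 \<le> path_diameter_square (B i) t \<omega>" for i
          unfolding path_diameter_square_def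
        proof (rule power_mono[OF _ zero_le_dist], rule ccontr)
          let ?d = "path_diameter (\<lambda>s. B i s \<omega>) t"
          assume "\<not> dist (B i s \<omega>) (B i s' \<omega>) \<le> enn2real ?d"
          \<comment> \<open>Only an infinite value lies above its own \<open>enn2real\<close>, and
            the diameter of a continuous path up to \<open>t\<close> is finite.\<close>
          then have "ennreal (enn2real ?d) < ?d"
            using elim s by (subst path_diameter_gt_iff) (auto simp: not_le)
          then show False using path_diameter_finite[of "\<lambda>s. B i s \<omega>" t] elim by auto
        qed
        from add_mono[OF this[of 1] this[of 2]] le have "(dist (W s \<omega>) (W s' \<omega>))\<^sup>2 \<le> 1"
          unfolding dist_vec2_square B_def by linarith
        then show False using s(5) by (simp add: power2_le_iff_abs_le abs_square_le_1)
      qed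
    qed
  qed
  have upper: "(\<integral>\<^sup>+ \<omega>. \<Theta> \<omega> \<partial>M) \<le> (\<integral>\<^sup>+ \<omega>. ennreal (min (T1 \<omega>) (T2 \<omega>)) \<partial>M)"
  proof (rule nn_integral_mono_AE)
    show "AE \<omega> in M. \<Theta> \<omega> \<le> ennreal (min (T1 \<omega>) (T2 \<omega>))"
      using AE_escape_real[OF bm1] AE_escape_real[OF bm2]
    proof eventually_elim
      case (elim \<omega>)
      \<comment> \<open>Projecting to a coordinate does not increase distances, so the planar path
        escapes no later than either coordinate.\<close>
      have "\<Theta> \<omega> \<le> escape_time (\<lambda>t. B i t \<omega>)" for i
        unfolding \<Theta>_def
      proof (rule escape_time_mono)
        fix s s' assume "1 < dist (B i s \<omega>) (B i s' \<omega>)"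
        also have "\<dots> \<le> dist (W s \<omega>) (W s' \<omega>)" unfolding B_def by (rule dist_vec_nth_le)
        finally show "1 < dist (W s \<omega>) (W s' \<omega>)" .
      qed
      then show ?case using elim by (metis min_def)
    qed
  qed
  show ?thesis
    using lower upper expectation_min nn_integral_cong_AE[OF D] nn_integral_cong_AE[OF R] by simp
qed

end
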